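(* Let $R$ be a commutative ring, $G$ an edge-labeled graph over $R$, and $R_G$ its ring of splines. Flat base change with affine schemes commutes with spline structure morphisms: for every flat commutative $R$-algebra $S$, the $S$-schemes $$\operatorname{Spec}(R_G\otimes_R S)\to \operatorname{Spec}(S)\qquad\text{and}\qquad \operatorname{Spec}(S_{F_S(G)})\to\operatorname{Spec}(S)$$ are isomorphic over $\operatorname{Spec}(S)$, where the first is the base change of the spline structure morphism of $G$ and the second is the spline structure morphism of $F_S(G)$. In particular, if $\mathfrak{p}$ is a prime ideal of $R$ then $(R_G)_{\mathfrak{p}}\cong (R_{\mathfrak{p}})_{G_{\mathfrak{p}}}$, and if $f\in R$ then $(R_G)_f\cong (R_f)_{G_f}$.
   Context: An edge-labeled graph $G$ over $R$ is a finite graph $(V,E)$ with a map $\alpha$ from $E$ to the set of ideals of $R$; write $I_{uv}=\alpha(e_{uv})$ for an edge $e_{uv}$ joining $u$ and $v$. The unit ideal is allowed as a label. A spline is a function $s:V\to R$ with $s(u)-s(v)\in I_{uv}$ for every edge $e_{uv}$; the splines form a ring $R_G$ under pointwise operations. The spline structure morphism of $G$ is the morphism $\operatorname{Spec}(R_G)\to\operatorname{Spec}(R)$ induced by the diagonal ring homomorphism $\Delta:R\to R_G$ sending $r$ to the constant spline with value $r$. For a flat commutative $R$-algebra $S$, $F_S(-)=-\otimes_R S$, and $F_S(G)$ is the edge-labeled graph over $F_S(R)=S$ with the same underlying graph, in which each edge ideal $I_{uv}$ is replaced by $F_S(I_{uv})=I_{uv}\otimes_R S$, identified (by flatness) with the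 ideal $I_{uv}S$ of $S$; $S_{F_S(G)}$ is its ring of splines over $S$. For $f\in R$ write $G_f$ for $F_S(G)$ with $S=R_f$, and for a prime $\mathfrak{p}$ write $G_{\mathfrak{p}}$ for $F_S(G)$ with $S=R_{\mathfrak{p}}$. *)

theory Defs
  imports "HOL-Analysis.Abstract_Topology" "HOL-Algebra.QuotRing"
    "HOL-Algebra.Module" "HOL-Algebra.Free_Abelian_Groups"
begin

section \<open>Splines on edge-labeled graphs\<close>

text \<open>Loops and parallel edges are permitted. A simple graph is the case in which the edges are
  two-element sets of vertices and \<open>ends\<close> is the identity.\<close>

record ('v, 'e, 'a) lgraph =
  vertices :: "'v set"
  edges :: "'e set"
  ends :: "'e \<Rightarrow> 'v set"
  label :: "'e \<Rightarrow> 'a set"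

definition edge_labeled_graph :: "('a, 'm) ring_scheme \<Rightarrow> ('v, 'e, 'a) lgraph \<Rightarrow> bool" where
  "edge_labeled_graph R G \<longleftrightarrow>
     finite (vertices G) \<and> finite (edges G) \<and>
     (\<forall>e\<in>edges G. \<exists>u\<in>vertices G. \<exists>v\<in>vertices G. ends G e = {u, v}) \<and>
     (\<forall>e\<in>edges G. ideal (label G e) R)"

definition splines :: "('a, 'm) ring_scheme \<Rightarrow> ('v, 'e, 'a) lgraph \<Rightarrow> ('v \<Rightarrow> 'a) set" where
  "splines R G = {s \<in> vertices G \<rightarrow>\<^sub>E carrier R.
     \<forall>e\<in>edges G. \<forall>u v. ends G e = {u, v} \<longrightarrow> s u \<ominus>\<^bsub>R\<^esub> s v \<in> label G e}"

definition diag :: "('v, 'e, 'a) lgraph \<Rightarrow> 'a \<Rightarrow> 'v \<Rightarrow> 'a" where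
  "diag G r = (\<lambda>v\<in>vertices G. r)"

definition spline_ring :: "('a, 'm) ring_scheme \<Rightarrow> ('v, 'e, 'a) lgraph \<Rightarrow> ('a, 'v \<Rightarrow> 'a) module" where
  "spline_ring R G =
    \<lparr>carrier = splines R G,
     monoid.mult = (\<lambda>s t. \<lambda>v\<in>vertices G. s v \<otimes>\<^bsub>R\<^esub> t v),
     monoid.one = diag G \<one>\<^bsub>R\<^esub>,
     ring.zero = diag G \<zero>\<^bsub>R\<^esub>,
     ring.add = (\<lambda>s t. \<lambda>v\<in>vertices G. s v \<oplus>\<^bsub>R\<^esub> t v),
     module.smult = (\<lambda>r s. \<lambda>v\<in>vertices G. r \<otimes>\<^bsub>R\<^esub> s v)\<rparr>"


section \<open>Tensor products and flatness\<close>

text \<open>The tensor product of two modules is the free abelian group on pairs modulo the usual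
  bilinearity relations. Operations on cosets are given on representatives; the unions below are
  unions of one and the same coset. The ring structure is only meaningful when both factors
  are algebras; for modules without a product those components are junk and play no role.\<close>

definition tensor_rels ::
  "('a, 'k) ring_scheme \<Rightarrow> ('a, 'm, 'i) module_scheme \<Rightarrow> ('a, 'n, 'j) module_scheme \<Rightarrow>
   ('m \<times> 'n \<Rightarrow>\<^sub>0 int) set" where
  "tensor_rels R M N =
     {frag_of (x \<oplus>\<^bsub>M\<^esub> x', y) - frag_of (x, y) - frag_of (x', y) | x x' y.
        x \<in> carrier M \<and> x' \<in> carrier M \<and> y \<in> carrier N} \<union>
     {frag_of (x, y \<oplus>\<^bsub>N\<^esub> y') - frag_of (x, y) - frag_of (x, y') | x y y'.
        x \<in> carrier M \<and> y \<in> carrier N \<and> y' \<in> carrier N} \<union>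
     {frag_of (r \<odot>\<^bsub>M\<^esub> x, y) - frag_of (x, r \<odot>\<^bsub>N\<^esub> y) | r x y.
        r \<in> carrier R \<and> x \<in> carrier M \<and> y \<in> carrier N}"

definition tensor_free ::
  "('a, 'm, 'i) module_scheme \<Rightarrow> ('a, 'n, 'j) module_scheme \<Rightarrow> ('m \<times> 'n \<Rightarrow>\<^sub>0 int) monoid" where
  "tensor_free M N = free_Abelian_group (carrier M \<times> carrier N)"

definition tensor_class ::
  "('a, 'k) ring_scheme \<Rightarrow> ('a, 'm, 'i) module_scheme \<Rightarrow> ('a, 'n, 'j) module_scheme \<Rightarrow>
   ('m \<times> 'n \<Rightarrow>\<^sub>0 int) \<Rightarrow> ('m \<times> 'n \<Rightarrow>\<^sub>0 int) set" where
  "tensor_class R M N c =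
     generate (tensor_free M N) (tensor_rels R M N) #>\<^bsub>tensor_free M N\<^esub> c"

definition pure_tensor ::
  "('a, 'k) ring_scheme \<Rightarrow> ('a, 'm, 'i) module_scheme \<Rightarrow> ('a, 'n, 'j) module_scheme \<Rightarrow>
   'm \<Rightarrow> 'n \<Rightarrow> ('m \<times> 'n \<Rightarrow>\<^sub>0 int) set" where
  "pure_tensor R M N x y = tensor_class R M N (frag_of (x, y))"

definition tensor ::
  "('a, 'k) ring_scheme \<Rightarrow> ('a, 'm, 'i) module_scheme \<Rightarrow> ('a, 'n, 'j) module_scheme \<Rightarrow>
   ('a, ('m \<times> 'n \<Rightarrow>\<^sub>0 int) set) module" where
  "tensor R M N =
    (let Q = tensor_free M N Mod generate (tensor_free M N) (tensor_rels R M N) in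
     \<lparr>carrier = carrier Q,
      monoid.mult = (\<lambda>X Y. \<Union>c\<in>X. \<Union>d\<in>Y. tensor_class R M N
        (frag_extend (\<lambda>(x, y). frag_extend (\<lambda>(x', y').
           frag_of (x \<otimes>\<^bsub>M\<^esub> x', y \<otimes>\<^bsub>N\<^esub> y')) d) c)),
      monoid.one = pure_tensor R M N \<one>\<^bsub>M\<^esub> \<one>\<^bsub>N\<^esub>,
      ring.zero = \<one>\<^bsub>Q\<^esub>,
      ring.add = (\<lambda>X Y. X \<otimes>\<^bsub>Q\<^esub> Y),
      module.smult = (\<lambda>r X. \<Union>c\<in>X. tensor_class R M N
        (frag_extend (\<lambda>(x, y). frag_of (r \<odot>\<^bsub>M\<^esub> x, y)) c))\<rparr>)"

definition tensor_map ::
  "('a, 'k) ring_scheme \<Rightarrow> ('a, 'm, 'i) module_scheme \<Rightarrow> ('a, 'p, 'l) module_scheme \<Rightarrow>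
   ('a, 'n, 'j) module_scheme \<Rightarrow> ('m \<Rightarrow> 'p) \<Rightarrow>
   ('m \<times> 'n \<Rightarrow>\<^sub>0 int) set \<Rightarrow> ('p \<times> 'n \<Rightarrow>\<^sub>0 int) set" where
  "tensor_map R M M' N f X =
     (\<Union>c\<in>X. tensor_class R M' N (frag_extend (\<lambda>(x, y). frag_of (f x, y)) c))"

definition linear_map ::
  "('a, 'k) ring_scheme \<Rightarrow> ('a, 'm, 'i) module_scheme \<Rightarrow> ('a, 'n, 'j) module_scheme \<Rightarrow>
   ('m \<Rightarrow> 'n) \<Rightarrow> bool" where
  "linear_map R M N f \<longleftrightarrow>
     f \<in> carrier M \<rightarrow> carrier N \<and>
     (\<forall>x\<in>carrier M. \<forall>y\<in>carrier M. f (x \<oplus>\<^bsub>M\<^esub> y) = f x \<oplus>\<^bsub>N\<^esub> f y) \<and>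
     (\<forall>r\<in>carrier R. \<forall>x\<in>carrier M. f (r \<odot>\<^bsub>M\<^esub> x) = r \<odot>\<^bsub>N\<^esub> f x)"

text \<open>Flatness: tensoring with \<open>N\<close> preserves exactness of \<open>M1 \<rightarrow> M2 \<rightarrow> M3\<close>. A quantifier over modules
  has to fix a carrier type. Every finitely generated \<open>R\<close>-module, being a quotient of some
  \<open>R\<^sup>n\<close>, is isomorphic to one whose elements are sets of functions \<open>nat \<Rightarrow> 'a\<close>, and so is every
  submodule of it. Flatness can be tested on finitely generated ideals of \<open>R\<close>, so
  nothing is lost by restricting to this carrier type.\<close>

definition flat :: "('a, 'k) ring_scheme \<Rightarrow> ('a, 'n, 'j) module_scheme \<Rightarrow> bool" where
  "flat R N \<longleftrightarrow> module R N \<and>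
     (\<forall>(M1 :: ('a, (nat \<Rightarrow> 'a) set) module) (M2 :: ('a, (nat \<Rightarrow> 'a) set) module)
        (M3 :: ('a, (nat \<Rightarrow> 'a) set) module) f g.
        module R M1 \<and> module R M2 \<and> module R M3 \<and>
        linear_map R M1 M2 f \<and> linear_map R M2 M3 g \<and>
        f ` carrier M1 = a_kernel M2 M3 g \<longrightarrow>
        tensor_map R M1 M2 N f ` carrier (tensor R M1 N) =
          a_kernel (tensor R M2 N) (tensor R M3 N) (tensor_map R M2 M3 N g))"

text \<open>The label \<open>I\<close> becomes the ideal \<open>IS\<close>, generated by the image of \<open>I\<close> under \<open>r \<mapsto> r \<cdot> 1\<close>.\<close>

definition base_change_graph ::
  "('a, 'b, 'i) module_scheme \<Rightarrow> ('v, 'e, 'a) lgraph \<Rightarrow> ('v, 'e, 'b) lgraph" where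
  "base_change_graph S G =
    \<lparr>vertices = vertices G, edges = edges G, ends = ends G,
     label = (\<lambda>e. Idl\<^bsub>S\<^esub> ((\<lambda>r. r \<odot>\<^bsub>S\<^esub> \<one>\<^bsub>S\<^esub>) ` label G e))\<rparr>"


section \<open>Localization\<close>

definition fraction :: "('a, 'm) ring_scheme \<Rightarrow> 'a set \<Rightarrow> 'a \<Rightarrow> 'a \<Rightarrow> ('a \<times> 'a) set" where
  "fraction A T a t = {(b, u). b \<in> carrier A \<and> u \<in> T \<and>
     (\<exists>w\<in>T. w \<otimes>\<^bsub>A\<^esub> (a \<otimes>\<^bsub>A\<^esub> u \<ominus>\<^bsub>A\<^esub> b \<otimes>\<^bsub>A\<^esub> t) = \<zero>\<^bsub>A\<^esub>)}"

text \<open>Meaningful for a multiplicatively closed \<open>T\<close> containing 1.\<close>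

definition localization :: "('a, 'm) ring_scheme \<Rightarrow> 'a set \<Rightarrow> ('a, ('a \<times> 'a) set) module" where
  "localization A T =
    \<lparr>carrier = {fraction A T a t | a t. a \<in> carrier A \<and> t \<in> T},
     monoid.mult = (\<lambda>X Y. \<Union>(a, t)\<in>X. \<Union>(b, u)\<in>Y. fraction A T (a \<otimes>\<^bsub>A\<^esub> b) (t \<otimes>\<^bsub>A\<^esub> u)),
     monoid.one = fraction A T \<one>\<^bsub>A\<^esub> \<one>\<^bsub>A\<^esub>,
     ring.zero = fraction A T \<zero>\<^bsub>A\<^esub> \<one>\<^bsub>A\<^esub>,
     ring.add = (\<lambda>X Y. \<Union>(a, t)\<in>X. \<Union>(b, u)\<in>Y.
       fraction A T (a \<otimes>\<^bsub>A\<^esub> u \<oplus>\<^bsub>A\<^esub> b \<otimes>\<^bsub>A\<^esub> t) (t \<otimes>\<^bsub>A\<^esub> u)),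
     module.smult = (\<lambda>r X. \<Union>(a, t)\<in>X. fraction A T (r \<otimes>\<^bsub>A\<^esub> a) t)\<rparr>"

text \<open>The map from a localization of \<open>A\<close> to \<open>localization B T\<close> induced by \<open>h : A \<rightarrow> B\<close>.\<close>

definition localization_map ::
  "('b, 'n) ring_scheme \<Rightarrow> 'b set \<Rightarrow> ('a \<Rightarrow> 'b) \<Rightarrow> ('a \<times> 'a) set \<Rightarrow> ('b \<times> 'b) set" where
  "localization_map B T h X = (\<Union>(a, t)\<in>X. fraction B T (h a) (h t))"

abbreviation localization_at ::
  "('a, 'm) ring_scheme \<Rightarrow> 'a set \<Rightarrow> ('a, ('a \<times> 'a) set) module" where
  "localization_at A P \<equiv> localization A (carrier A - P)"

definition powers :: "('a, 'm) ring_scheme \<Rightarrow> 'a \<Rightarrow> 'a set" where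
  "powers A f = range (\<lambda>n::nat. f [^]\<^bsub>A\<^esub> n)"

text \<open>\<open>A\<close> and \<open>B\<close> are isomorphic as algebras over \<open>S\<close> via the structure maps \<open>a\<close> and \<open>b\<close>.\<close>

definition algebras_isomorphic ::
  "('s, 'k) ring_scheme \<Rightarrow> ('a, 'm) ring_scheme \<Rightarrow> ('b, 'n) ring_scheme \<Rightarrow>
   ('s \<Rightarrow> 'a) \<Rightarrow> ('s \<Rightarrow> 'b) \<Rightarrow> bool" where
  "algebras_isomorphic S A B a b \<longleftrightarrow>
     (\<exists>h \<in> ring_iso A B. \<forall>s\<in>carrier S. h (a s) = b s)"


section \<open>Ringed spaces and affine schemes\<close>

record ('p, 's) ringed_space =
  space_top :: "'p topology"
  sections :: "'p set \<Rightarrow> 's ring"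
  restr :: "'p set \<Rightarrow> 'p set \<Rightarrow> 's \<Rightarrow> 's"

text \<open>\<open>restr X U V\<close> restricts sections from \<open>U\<close> to \<open>V \<subseteq> U\<close>. The pullback of a morphism
  \<open>X \<rightarrow> Y\<close> on an open set \<open>V\<close> of \<open>Y\<close> maps sections over \<open>V\<close> to sections over the preimage of \<open>V\<close>.\<close>

record ('p, 's, 'q, 't) rs_map =
  on_points :: "'p \<Rightarrow> 'q"
  pullback :: "'q set \<Rightarrow> 't \<Rightarrow> 's"

definition rs_preimage ::
  "('p, 's) ringed_space \<Rightarrow> ('p, 's, 'q, 't) rs_map \<Rightarrow> 'q set \<Rightarrow> 'p set" where
  "rs_preimage X \<phi> V = {x \<in> topspace (space_top X). on_points \<phi> x \<in> V}"

text \<open>For a section \<open>s\<close> over a neighbourhood \<open>U\<close> of \<open>x\<close>: the germ of \<open>s\<close> is a unit of the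
  stalk at \<open>x\<close>.\<close>

definition germ_unit :: "('p, 's) ringed_space \<Rightarrow> 'p set \<Rightarrow> 'p \<Rightarrow> 's \<Rightarrow> bool" where
  "germ_unit X U x s \<longleftrightarrow>
     (\<exists>W. openin (space_top X) W \<and> x \<in> W \<and> W \<subseteq> U \<and>
        restr X U W s \<in> Units (sections X W))"

text \<open>Morphisms of locally ringed spaces. The last clause says that the maps on stalks are
  local homomorphisms.\<close>

definition lrs_morphism ::
  "('p, 's) ringed_space \<Rightarrow> ('q, 't) ringed_space \<Rightarrow> ('p, 's, 'q, 't) rs_map \<Rightarrow> bool" where
  "lrs_morphism X Y \<phi> \<longleftrightarrow>
     continuous_map (space_top X) (space_top Y) (on_points \<phi>) \<and>
     (\<forall>V. openin (space_top Y) V \<longrightarrow>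
        pullback \<phi> V \<in> ring_hom (sections Y V) (sections X (rs_preimage X \<phi> V))) \<and>
     (\<forall>V W. openin (space_top Y) V \<and> openin (space_top Y) W \<and> W \<subseteq> V \<longrightarrow>
        (\<forall>s\<in>carrier (sections Y V). pullback \<phi> W (restr Y V W s) =
           restr X (rs_preimage X \<phi> V) (rs_preimage X \<phi> W) (pullback \<phi> V s))) \<and>
     (\<forall>x\<in>topspace (space_top X). \<forall>V. openin (space_top Y) V \<and> on_points \<phi> x \<in> V \<longrightarrow>
        (\<forall>s\<in>carrier (sections Y V).
           germ_unit X (rs_preimage X \<phi> V) x (pullback \<phi> V s) \<longrightarrow>
           germ_unit Y V (on_points \<phi> x) s))"

text \<open>\<open>rs_comp X \<phi> \<psi>\<close> is \<open>\<psi> \<circ> \<phi>\<close>, for \<open>\<phi>\<close> from \<open>X\<close> to \<open>Y\<close> and \<open>\<psi>\<close> from \<open>Y\<close>.\<close>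

definition rs_comp ::
  "('p, 's) ringed_space \<Rightarrow> ('q, 't) ringed_space \<Rightarrow> ('p, 's, 'q, 't) rs_map \<Rightarrow>
   ('q, 't, 'z, 'w) rs_map \<Rightarrow> ('p, 's, 'z, 'w) rs_map" where
  "rs_comp X Y \<phi> \<psi> =
    \<lparr>on_points = (\<lambda>x. on_points \<psi> (on_points \<phi> x)),
     pullback = (\<lambda>W s. pullback \<phi> (rs_preimage Y \<psi> W) (pullback \<psi> W s))\<rparr>"

definition rs_id :: "('p, 's, 'p, 's) rs_map" where
  "rs_id = \<lparr>on_points = (\<lambda>x. x), pullback = (\<lambda>U s. s)\<rparr>"

definition rs_eq ::
  "('p, 's) ringed_space \<Rightarrow> ('q, 't) ringed_space \<Rightarrow> ('p, 's, 'q, 't) rs_map \<Rightarrow>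
   ('p, 's, 'q, 't) rs_map \<Rightarrow> bool" where
  "rs_eq X Y \<phi> \<psi> \<longleftrightarrow>
     (\<forall>x\<in>topspace (space_top X). on_points \<phi> x = on_points \<psi> x) \<and>
     (\<forall>V. openin (space_top Y) V \<longrightarrow>
        (\<forall>s\<in>carrier (sections Y V). pullback \<phi> V s = pullback \<psi> V s))"

text \<open>\<open>X\<close> and \<open>Y\<close> are isomorphic over \<open>Z\<close> with respect to the structure morphisms
  \<open>\<alpha> : X \<rightarrow> Z\<close> and \<open>\<beta> : Y \<rightarrow> Z\<close>.\<close>

definition isomorphic_over ::
  "('z, 'w) ringed_space \<Rightarrow> ('p, 's) ringed_space \<Rightarrow> ('p, 's, 'z, 'w) rs_map \<Rightarrow>
   ('q, 't) ringed_space \<Rightarrow> ('q, 't, 'z, 'w) rs_map \<Rightarrow> bool" where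
  "isomorphic_over Z X \<alpha> Y \<beta> \<longleftrightarrow>
     lrs_morphism X Z \<alpha> \<and> lrs_morphism Y Z \<beta> \<and>
     (\<exists>\<phi> \<psi>. lrs_morphism X Y \<phi> \<and> lrs_morphism Y X \<psi> \<and>
        rs_eq X X (rs_comp X Y \<phi> \<psi>) rs_id \<and>
        rs_eq Y Y (rs_comp Y X \<psi> \<phi>) rs_id \<and>
        rs_eq X Z (rs_comp X Y \<phi> \<beta>) \<alpha>)"

definition zariski :: "('a, 'm) ring_scheme \<Rightarrow> 'a set topology" where
  "zariski A = topology (\<lambda>U. \<exists>E\<subseteq>carrier A. U = {P. primeideal P A \<and> \<not> E \<subseteq> P})"

lemma istopology_zariski:
  assumes "cring A"
  shows "istopology (\<lambda>U. \<exists>E\<subseteq>carrier A. U = {P. primeideal P A \<and> \<not> E \<subseteq> P})"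
proof -
  interpret cring A by fact
  let ?D = "\<lambda>E. {P. primeideal P A \<and> \<not> E \<subseteq> P}"
  have "\<exists>E\<subseteq>carrier A. ?D E1 \<inter> ?D E2 = ?D E"
    if E: "E1 \<subseteq> carrier A" "E2 \<subseteq> carrier A" for E1 E2
  proof (intro exI conjI)
    let ?E = "{x \<otimes>\<^bsub>A\<^esub> y | x y. x \<in> E1 \<and> y \<in> E2}"
    show "?E \<subseteq> carrier A"
      using E by auto
    have eq: "?E \<subseteq> P \<longleftrightarrow> E1 \<subseteq> P \<or> E2 \<subseteq> P" if "primeideal P A" for P
    proof -
      interpret P: primeideal P A by fact
      have "E2 \<subseteq> P" if "?E \<subseteq> P" "x \<in> E1" "x \<notin> P" for x
      proof
        fix y assume "y \<in> E2"
        then have "x \<otimes>\<^bsub>A\<^esub> y \<in> P" "x \<in> carrier A" "y \<in> carrier A"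
          using that E by auto
        then show "y \<in> P"
          using P.I_prime \<open>x \<notin> P\<close> by auto
      qed
      moreover have "?E \<subseteq> P" if "E1 \<subseteq> P"
        using that E by (auto intro!: P.I_r_closed)
      moreover have "?E \<subseteq> P" if "E2 \<subseteq> P"
        using that E by (auto intro!: P.I_l_closed)
      ultimately show ?thesis
        by (meson subsetI)
    qed
    show "?D E1 \<inter> ?D E2 = ?D ?E"
    proof (rule Set.set_eqI)
      fix P
      show "P \<in> ?D E1 \<inter> ?D E2 \<longleftrightarrow> P \<in> ?D ?E"
        by (simp only: Int_iff mem_Collect_eq) (use eq[of P] in argo)
    qed
  qed
  moreover have "\<exists>E\<subseteq>carrier A. \<Union>\<K> = ?D E"
    if K: "\<forall>U\<in>\<K>. \<exists>E\<subseteq>carrier A. U = ?D E" for \<K>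
  proof -
    from K obtain F where F: "\<forall>U\<in>\<K>. F U \<subseteq> carrier A \<and> U = ?D (F U)"
      by metis
    have "\<Union>\<K> = (\<Union>U\<in>\<K>. ?D (F U))"
      using F by auto
    also have "\<dots> = ?D (\<Union>(F ` \<K>))"
      by (simp add: set_eq_iff UN_subset_iff)
    finally have "\<Union>\<K> = ?D (\<Union>(F ` \<K>))" .
    moreover have "\<Union>(F ` \<K>) \<subseteq> carrier A"
      using F by auto
    ultimately show ?thesis
      by (intro exI conjI)
  qed
  ultimately show ?thesis
    unfolding istopology_def by (intro conjI allI impI) (elim exE conjE, simp)+
qed

lemma openin_zariski:
  "cring A \<Longrightarrow>
    openin (zariski A) U \<longleftrightarrow> (\<exists>E\<subseteq>carrier A. U = {P. primeideal P A \<and> \<not> E \<subseteq> P})"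
  unfolding zariski_def by (simp add: istopology_zariski topology_inverse')

text \<open>Sections over \<open>U\<close> are the families of elements of the local rings at the points of \<open>U\<close> that
  are locally given by a single fraction.\<close>

definition structure_sections ::
  "('a, 'm) ring_scheme \<Rightarrow> 'a set set \<Rightarrow> ('a set \<Rightarrow> ('a \<times> 'a) set) set" where
  "structure_sections A U =
     {s \<in> (\<Pi>\<^sub>E P\<in>U. carrier (localization_at A P)).
       \<forall>P\<in>U. \<exists>W. openin (zariski A) W \<and> P \<in> W \<and> W \<subseteq> U \<and>
         (\<exists>a\<in>carrier A. \<exists>b\<in>carrier A. \<forall>Q\<in>W.
            b \<notin> Q \<and> s Q = fraction A (carrier A - Q) a b)}"

definition structure_sheaf ::
  "('a, 'm) ring_scheme \<Rightarrow> 'a set set \<Rightarrow> ('a set \<Rightarrow> ('a \<times> 'a) set) ring" where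
  "structure_sheaf A U =
    \<lparr>carrier = structure_sections A U,
     monoid.mult = (\<lambda>s t. \<lambda>P\<in>U. s P \<otimes>\<^bsub>localization_at A P\<^esub> t P),
     monoid.one = (\<lambda>P\<in>U. \<one>\<^bsub>localization_at A P\<^esub>),
     ring.zero = (\<lambda>P\<in>U. \<zero>\<^bsub>localization_at A P\<^esub>),
     ring.add = (\<lambda>s t. \<lambda>P\<in>U. s P \<oplus>\<^bsub>localization_at A P\<^esub> t P)\<rparr>"

definition Spec ::
  "('a, 'm) ring_scheme \<Rightarrow> ('a set, 'a set \<Rightarrow> ('a \<times> 'a) set) ringed_space" where
  "Spec A =
    \<lparr>space_top = zariski A,
     sections = structure_sheaf A,
     restr = (\<lambda>U V s. restrict s V)\<rparr>"

text \<open>The morphism \<open>Spec B \<rightarrow> Spec A\<close> induced by a ring homomorphism \<open>h : A \<rightarrow> B\<close>.\<close>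

definition Spec_map ::
  "('a, 'm) ring_scheme \<Rightarrow> ('b, 'n) ring_scheme \<Rightarrow> ('a \<Rightarrow> 'b) \<Rightarrow>
   ('b set, 'b set \<Rightarrow> ('b \<times> 'b) set, 'a set, 'a set \<Rightarrow> ('a \<times> 'a) set) rs_map" where
  "Spec_map A B h =
    (let contract = (\<lambda>Q. {a \<in> carrier A. h a \<in> Q}) in
     \<lparr>on_points = contract,
      pullback = (\<lambda>U s. \<lambda>Q\<in>{Q. primeideal Q B \<and> contract Q \<in> U}.
        localization_map B (carrier B - Q) h (s (contract Q)))\<rparr>)"

definition spline_morphism ::
  "('a, 'm) ring_scheme \<Rightarrow> ('v, 'e, 'a) lgraph \<Rightarrow>
   (('v \<Rightarrow> 'a) set, ('v \<Rightarrow> 'a) set \<Rightarrow> (('v \<Rightarrow> 'a) \<times> ('v \<Rightarrow> 'a)) set,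
    'a set, 'a set \<Rightarrow> ('a \<times> 'a) set) rs_map" where
  "spline_morphism R G = Spec_map R (spline_ring R G) (diag G)"

text \<open>For an \<open>R\<close>-algebra \<open>A\<close>, the base change of \<open>Spec A \<rightarrow> Spec R\<close> along \<open>Spec S \<rightarrow> Spec R\<close>: the fibre
  product is \<open>Spec (A \<otimes> S)\<close>, with the projection to \<open>Spec S\<close> induced by \<open>s \<mapsto> 1 \<otimes> s\<close>.\<close>

definition base_change_morphism ::
  "('a, 'k) ring_scheme \<Rightarrow> ('a, 'm, 'i) module_scheme \<Rightarrow> ('a, 'n, 'j) module_scheme \<Rightarrow>
   (('m \<times> 'n \<Rightarrow>\<^sub>0 int) set set,
    ('m \<times> 'n \<Rightarrow>\<^sub>0 int) set set \<Rightarrow>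
      (('m \<times> 'n \<Rightarrow>\<^sub>0 int) set \<times> ('m \<times> 'n \<Rightarrow>\<^sub>0 int) set) set,
    'n set, 'n set \<Rightarrow> ('n \<times> 'n) set) rs_map" where
  "base_change_morphism R A S = Spec_map S (tensor R A S) (pure_tensor R A S \<one>\<^bsub>A\<^esub>)"

end

theory Submission
  imports Defs "HOL-Algebra.Multiplicative_Group"
begin

text \<open>A spline ring is a finite limit: it is cut out of the product \<open>R\<^sup>V\<close> by the finitely many
  conditions that \<open>s u - s w\<close> vanishes in \<open>R/I\<close>, one for each edge \<open>uw\<close> with label \<open>I\<close>. Tensoring with \<open>S\<close>
  commutes with the finite product \<open>R\<^sup>V\<close>, and by flatness it preserves the exactness of
  \<open>0 \<rightarrow> R\<^sub>G \<rightarrow> R\<^sub>H \<rightarrow> R/I\<close>, where \<open>H\<close> is \<open>G\<close> with one edge removed. By induction on the number of edges, the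
  natural map \<open>s \<otimes> y \<mapsto> (v \<mapsto> s v \<cdot> y)\<close> from \<open>R\<^sub>G \<otimes> S\<close> to the splines over \<open>S\<close> is bijective. It is an
  isomorphism of \<open>S\<close>-algebras, and \<open>Spec\<close> turns it into an isomorphism of schemes over \<open>Spec S\<close>.

  For localizations the isomorphism is written down directly: a spline of fractions has a common
  denominator, because there are only finitely many vertices and edges.\<close>

section \<open>Localization\<close>

text \<open>Flatness enters the inductive step twice. Exactness at \<open>R_H\<close> lifts a spline
  over \<open>S\<close> back to \<open>R_G \<otimes> S\<close>; exactness at \<open>R_G\<close>,
  with the zero endomorphism of \<open>R_G\<close> in place of the map from the zero module, keeps
  the inclusion injective. The edge condition over \<open>S\<close> is membership in
  \<open>I S\<close>, and its link to the sequence is that \<open>y \<mapsto> 1 \<otimes> y\<close>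
  into \<open>R/I \<otimes> S\<close> kills \<open>I S\<close>. Edges are removed one at a time so
  that the third module is a single \<open>R/I\<close>. The map to \<open>R/I\<close> is only
  linear, so the induction is about additive maps. Multiplicativity is checked afterwards on pure
  tensors, and the bijection carries the ring axioms from the splines over \<open>S\<close> to
  \<open>R_G \<otimes> S\<close>. The definition of \<open>flat\<close> speaks of modules whose
  elements are sets of sequences in \<open>R\<close>. Hence every module in these sequences is
  embedded in that type: a spline, read along an enumeration of the vertices, becomes a set of one
  sequence, and a coset becomes a set of constant sequences. The localized spline ring consists of
  fractions, not of tensors, so it has an argument of its own.\<close>

locale multiplicative_subset = cring A for A (structure) +
  fixes T
  assumes subset: "T \<subseteq> carrier A"
    and one_mem: "\<one> \<in> T"
    and mult_mem: "\<lbrakk>t \<in> T; u \<in> T\<rbrakk> \<Longrightarrow> t \<otimes> u \<in> T"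
begin

lemma mem_carrier: "t \<in> T \<Longrightarrow> t \<in> carrier A"
  using subset by blast

text \<open>Expanding the difference in \<open>fraction\<close> leaves an equation between products,
  which rewriting with \<open>m_ac\<close> can handle.\<close>

lemma mem_fraction:
  assumes "a \<in> carrier A" "t \<in> T"
  shows "(b, u) \<in> fraction A T a t \<longleftrightarrow>
    b \<in> carrier A \<and> u \<in> T \<and> (\<exists>w\<in>T. w \<otimes> (a \<otimes> u) = w \<otimes> (b \<otimes> t))"
proof -
  have "w \<otimes> (a \<otimes> u \<ominus> b \<otimes> t) = \<zero> \<longleftrightarrow> w \<otimes> (a \<otimes> u) = w \<otimes> (b \<otimes> t)"
    if "b \<in> carrier A" "u \<in> T" "w \<in> T" for w
  proof -
    have "w \<otimes> (a \<otimes> u \<ominus> b \<otimes> t) = w \<otimes> (a \<otimes> u) \<ominus> w \<otimes> (b \<otimes> t)"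
      using that assms by (simp add: a_minus_def r_distr r_minus mem_carrier)
    then show ?thesis
      using that assms r_right_minus_eq[of "w \<otimes> (a \<otimes> u)" "w \<otimes> (b \<otimes> t)"]
      by (simp add: mem_carrier)
  qed
  then show ?thesis
    unfolding fraction_def by auto
qed

lemma fraction_self: "\<lbrakk>a \<in> carrier A; t \<in> T\<rbrakk> \<Longrightarrow> (a, t) \<in> fraction A T a t"
  using one_mem by (auto simp: mem_fraction)

lemma fraction_sym:
  assumes "a \<in> carrier A" "t \<in> T" "(b, u) \<in> fraction A T a t"
  shows "(a, t) \<in> fraction A T b u"
  using assms by (simp add: mem_fraction) metis

lemma fraction_trans:
  assumes a: "a \<in> carrier A" "t \<in> T" and b: "(b, u) \<in> fraction A T a t"
    and c: "(c, v) \<in> fraction A T b u"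
  shows "(c, v) \<in> fraction A T a t"
proof -
  have bu: "b \<in> carrier A" "u \<in> T"
    using a b by (auto simp: mem_fraction)
  obtain w where w: "w \<in> T" "w \<otimes> (a \<otimes> u) = w \<otimes> (b \<otimes> t)"
    using a b by (auto simp: mem_fraction)
  obtain x where x: "x \<in> T" "x \<otimes> (b \<otimes> v) = x \<otimes> (c \<otimes> u)"
    using bu c by (auto simp: mem_fraction)
  have cv: "c \<in> carrier A" "v \<in> T"
    using bu c by (auto simp: mem_fraction)
  note car = a bu cv w(1) x(1) mem_carrier[OF a(2)] mem_carrier[OF bu(2)] mem_carrier[OF cv(2)]
    mem_carrier[OF w(1)] mem_carrier[OF x(1)]
  \<comment> \<open>The middle denominator \<open>u\<close> enters the witness so that
    \<open>a \<otimes> u\<close> and then \<open>b \<otimes> v\<close> can be formed and replaced by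
    means of the two hypotheses.\<close>
  have "(u \<otimes> (w \<otimes> x)) \<otimes> (a \<otimes> v) = (x \<otimes> v) \<otimes> (w \<otimes> (a \<otimes> u))"
    using car by (simp add: m_ac)
  also have "\<dots> = (w \<otimes> t) \<otimes> (x \<otimes> (b \<otimes> v))"
    using car w(2) by (simp add: m_ac)
  also have "\<dots> = (u \<otimes> (w \<otimes> x)) \<otimes> (c \<otimes> t)"
    using car x(2) by (simp add: m_ac)
  finally show ?thesis
    using car by (auto simp: mem_fraction intro!: bexI[of _ "u \<otimes> (w \<otimes> x)"] mult_mem)
qed

lemma fraction_eqI:
  assumes "a \<in> carrier A" "t \<in> T" "(b, u) \<in> fraction A T a t"
  shows "fraction A T b u = fraction A T a t"
proof -
  have "b \<in> carrier A" "u \<in> T"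
    using assms by (auto simp: mem_fraction)
  then show ?thesis
    using fraction_trans[OF _ _ assms(3)] fraction_trans[OF _ _ fraction_sym[OF assms]] assms(1,2)
    by auto
qed

lemma fraction_eq_iff:
  assumes "a \<in> carrier A" "b \<in> carrier A" "t \<in> T" "u \<in> T"
  shows "fraction A T a t = fraction A T b u \<longleftrightarrow> (\<exists>w\<in>T. w \<otimes> (a \<otimes> u) = w \<otimes> (b \<otimes> t))"
  using fraction_eqI[OF assms(1,3), of b u] fraction_self[OF assms(2,4)] assms
    mem_fraction[OF assms(1,3), of b u] by auto

lemma fraction_eq:
  assumes "a \<in> carrier A" "b \<in> carrier A" "t \<in> T" "u \<in> T" "a \<otimes> u = b \<otimes> t"
  shows "fraction A T a t = fraction A T b u"
  using assms one_mem by (auto simp: fraction_eq_iff)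

lemma fraction_cancel:
  assumes "a \<in> carrier A" "t \<in> T" "u \<in> T"
  shows "fraction A T (a \<otimes> u) (t \<otimes> u) = fraction A T a t"
    and "fraction A T (u \<otimes> a) (u \<otimes> t) = fraction A T a t"
  using assms by (intro fraction_eq; simp add: mult_mem mem_carrier m_ac)+

text \<open>The operations of \<open>localization\<close> are unions over representatives. A
  fraction is nonempty, so a function that is constant on it has that constant as its union.\<close>

lemma UN_fraction:
  assumes "a \<in> carrier A" "t \<in> T"
    and "\<And>b u. (b, u) \<in> fraction A T a t \<Longrightarrow> F b u = X"
  shows "(\<Union>(b, u)\<in>fraction A T a t. F b u) = X"
  by (rule UN_constant_eq[OF fraction_self[OF assms(1,2)]]) (auto dest: assms(3))

section \<open>The ring structure on fractions\<close>

abbreviation L where "L \<equiv> localization A T"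

lemma localization_carrier: "carrier L = {fraction A T a t | a t. a \<in> carrier A \<and> t \<in> T}"
  by (simp add: localization_def)

lemma fraction_closed [simp]: "\<lbrakk>a \<in> carrier A; t \<in> T\<rbrakk> \<Longrightarrow> fraction A T a t \<in> carrier L"
  by (auto simp: localization_carrier)

lemma localization_cases:
  assumes "x \<in> carrier L"
  obtains a t where "a \<in> carrier A" "t \<in> T" "x = fraction A T a t"
  using assms by (auto simp: localization_carrier)

text \<open>The content is independence of the representatives: if \<open>x\<close> and
  \<open>y\<close> witness the equalities in the two factors, then \<open>x \<otimes> y\<close>
  witnesses the equality of the products.\<close>

lemma localization_mult:
  assumes a: "a \<in> carrier A" "t \<in> T" and b: "b \<in> carrier A" "u \<in> T"
  shows "fraction A T a t \<otimes>\<^bsub>L\<^esub> fraction A T b u = fraction A T (a \<otimes> b) (t \<otimes> u)"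
proof -
  have *: "fraction A T (c \<otimes> d) (v \<otimes> w) = fraction A T (a \<otimes> b) (t \<otimes> u)"
    if p: "(c, v) \<in> fraction A T a t" and q: "(d, w) \<in> fraction A T b u" for c v d w
  proof -
    have cd: "c \<in> carrier A" "v \<in> T" "d \<in> carrier A" "w \<in> T"
      using p q a b by (auto simp: mem_fraction)
    obtain x where x: "x \<in> T" "x \<otimes> (a \<otimes> v) = x \<otimes> (c \<otimes> t)"
      using a p by (auto simp: mem_fraction)
    obtain y where y: "y \<in> T" "y \<otimes> (b \<otimes> w) = y \<otimes> (d \<otimes> u)"
      using b q by (auto simp: mem_fraction)
    note car = a b cd x(1) y(1) mem_carrier[OF a(2)] mem_carrier[OF b(2)] mem_carrier[OF cd(2)]
      mem_carrier[OF cd(4)] mem_carrier[OF x(1)] mem_carrier[OF y(1)]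
    have "(x \<otimes> y) \<otimes> ((a \<otimes> b) \<otimes> (v \<otimes> w)) = (x \<otimes> (a \<otimes> v)) \<otimes> (y \<otimes> (b \<otimes> w))"
      using car by (simp add: m_ac)
    also have "\<dots> = (x \<otimes> y) \<otimes> ((c \<otimes> d) \<otimes> (t \<otimes> u))"
      using car by (simp only: x(2) y(2)) (simp add: m_ac)
    finally have "(x \<otimes> y) \<otimes> ((c \<otimes> d) \<otimes> (t \<otimes> u)) = (x \<otimes> y) \<otimes> ((a \<otimes> b) \<otimes> (v \<otimes> w))" ..
    then show ?thesis
      using car by (subst fraction_eq_iff) (auto intro!: bexI[of _ "x \<otimes> y"] mult_mem)
  qed
  then have "(\<Union>(d, w)\<in>fraction A T b u. fraction A T (c \<otimes> d) (v \<otimes> w)) =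
      fraction A T (a \<otimes> b) (t \<otimes> u)" if "(c, v) \<in> fraction A T a t" for c v
    using that by (intro UN_fraction[OF b] *)
  then have "(\<Union>(c, v)\<in>fraction A T a t. \<Union>(d, w)\<in>fraction A T b u.
      fraction A T (c \<otimes> d) (v \<otimes> w)) = fraction A T (a \<otimes> b) (t \<otimes> u)"
    by (rule UN_fraction[OF a])
  then show ?thesis
    by (simp add: localization_def)
qed

lemma localization_add:
  assumes a: "a \<in> carrier A" "t \<in> T" and b: "b \<in> carrier A" "u \<in> T"
  shows "fraction A T a t \<oplus>\<^bsub>L\<^esub> fraction A T b u = fraction A T (a \<otimes> u \<oplus> b \<otimes> t) (t \<otimes> u)"
proof -
  have *: "fraction A T (c \<otimes> w \<oplus> d \<otimes> v) (v \<otimes> w) = fraction A T (a \<otimes> u \<oplus> b \<otimes> t) (t \<otimes> u)"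
    if p: "(c, v) \<in> fraction A T a t" and q: "(d, w) \<in> fraction A T b u" for c v d w
  proof -
    have cd: "c \<in> carrier A" "v \<in> T" "d \<in> carrier A" "w \<in> T"
      using p q a b by (auto simp: mem_fraction)
    obtain x where x: "x \<in> T" "x \<otimes> (a \<otimes> v) = x \<otimes> (c \<otimes> t)"
      using a p by (auto simp: mem_fraction)
    obtain y where y: "y \<in> T" "y \<otimes> (b \<otimes> w) = y \<otimes> (d \<otimes> u)"
      using b q by (auto simp: mem_fraction)
    note car = a b cd x(1) y(1) mem_carrier[OF a(2)] mem_carrier[OF b(2)] mem_carrier[OF cd(2)]
      mem_carrier[OF cd(4)] mem_carrier[OF x(1)] mem_carrier[OF y(1)]
    \<comment> \<open>The sum is regrouped so that the witness equation of each argument appears as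
      a block in a summand of its own.\<close>
    have "(x \<otimes> y) \<otimes> ((a \<otimes> u \<oplus> b \<otimes> t) \<otimes> (v \<otimes> w)) =
        (y \<otimes> (u \<otimes> w)) \<otimes> (x \<otimes> (a \<otimes> v)) \<oplus> (x \<otimes> (t \<otimes> v)) \<otimes> (y \<otimes> (b \<otimes> w))"
      using car by (simp add: m_ac l_distr r_distr)
    also have "\<dots> = (x \<otimes> y) \<otimes> ((c \<otimes> w \<oplus> d \<otimes> v) \<otimes> (t \<otimes> u))"
      using car by (simp only: x(2) y(2)) (simp add: m_ac l_distr r_distr)
    finally have "(x \<otimes> y) \<otimes> ((c \<otimes> w \<oplus> d \<otimes> v) \<otimes> (t \<otimes> u)) =
        (x \<otimes> y) \<otimes> ((a \<otimes> u \<oplus> b \<otimes> t) \<otimes> (v \<otimes> w))" ..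
    then show ?thesis
      using car by (subst fraction_eq_iff) (auto intro!: bexI[of _ "x \<otimes> y"] mult_mem)
  qed
  then have "(\<Union>(d, w)\<in>fraction A T b u. fraction A T (c \<otimes> w \<oplus> d \<otimes> v) (v \<otimes> w)) =
      fraction A T (a \<otimes> u \<oplus> b \<otimes> t) (t \<otimes> u)" if "(c, v) \<in> fraction A T a t" for c v
    using that by (intro UN_fraction[OF b] *)
  then have "(\<Union>(c, v)\<in>fraction A T a t. \<Union>(d, w)\<in>fraction A T b u.
      fraction A T (c \<otimes> w \<oplus> d \<otimes> v) (v \<otimes> w)) = fraction A T (a \<otimes> u \<oplus> b \<otimes> t) (t \<otimes> u)"
    by (rule UN_fraction[OF a])
  then show ?thesis
    by (simp add: localization_def)
qed

lemma localization_smult: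
  assumes r: "r \<in> carrier A" and a: "a \<in> carrier A" "t \<in> T"
  shows "r \<odot>\<^bsub>L\<^esub> fraction A T a t = fraction A T (r \<otimes> a) t"
proof -
  have "fraction A T (r \<otimes> c) v = fraction A T (r \<otimes> a) t" if p: "(c, v) \<in> fraction A T a t" for c v
  proof -
    have cv: "c \<in> carrier A" "v \<in> T"
      using p a by (auto simp: mem_fraction)
    obtain x where x: "x \<in> T" "x \<otimes> (a \<otimes> v) = x \<otimes> (c \<otimes> t)"
      using a p by (auto simp: mem_fraction)
    note car = r a cv x(1) mem_carrier[OF a(2)] mem_carrier[OF cv(2)] mem_carrier[OF x(1)]
    have "x \<otimes> ((r \<otimes> c) \<otimes> t) = r \<otimes> (x \<otimes> (c \<otimes> t))"
      using car by (simp add: m_ac)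
    also have "\<dots> = x \<otimes> ((r \<otimes> a) \<otimes> v)"
      using car by (simp only: x(2)[symmetric]) (simp add: m_ac)
    finally show ?thesis
      using car by (subst fraction_eq_iff) (auto intro!: bexI[of _ x])
  qed
  then have "(\<Union>(c, v)\<in>fraction A T a t. fraction A T (r \<otimes> c) v) = fraction A T (r \<otimes> a) t"
    by (rule UN_fraction[OF a])
  then show ?thesis
    by (simp add: localization_def)
qed

lemma localization_one: "\<one>\<^bsub>L\<^esub> = fraction A T \<one> \<one>"
  and localization_zero: "\<zero>\<^bsub>L\<^esub> = fraction A T \<zero> \<one>"
  by (simp_all add: localization_def)

lemmas localization_ops = localization_mult localization_add localization_one localization_zero

lemma localization_cring: "cring L"
proof (intro cringI abelian_groupI comm_monoidI)
  note [simp] = localization_ops one_mem mult_mem mem_carrier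
  note [elim!] = localization_cases
  fix x assume x: "x \<in> carrier L"
  then obtain a t where a: "a \<in> carrier A" "t \<in> T" "x = fraction A T a t"
    by auto
  then have "\<ominus> a \<in> carrier A"
    by simp
  then have "fraction A T (\<ominus> a) t \<oplus>\<^bsub>L\<^esub> x = \<zero>\<^bsub>L\<^esub>"
    by (simp only: localization_add localization_zero a \<open>\<ominus> a \<in> carrier A\<close>)
      (rule fraction_eq; simp add: a l_minus l_neg)
  then show "\<exists>y\<in>carrier L. y \<oplus>\<^bsub>L\<^esub> x = \<zero>\<^bsub>L\<^esub>"
    using \<open>\<ominus> a \<in> carrier A\<close> a fraction_closed by metis
  show "\<zero>\<^bsub>L\<^esub> \<oplus>\<^bsub>L\<^esub> x = x" "\<one>\<^bsub>L\<^esub> \<otimes>\<^bsub>L\<^esub> x = x"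
    using a by (auto intro!: fraction_eq)
  fix y assume y: "y \<in> carrier L"
  then obtain b u where b: "b \<in> carrier A" "u \<in> T" "y = fraction A T b u"
    by auto
  show "x \<oplus>\<^bsub>L\<^esub> y \<in> carrier L" "x \<otimes>\<^bsub>L\<^esub> y \<in> carrier L"
    using a b by auto
  show "x \<oplus>\<^bsub>L\<^esub> y = y \<oplus>\<^bsub>L\<^esub> x" "x \<otimes>\<^bsub>L\<^esub> y = y \<otimes>\<^bsub>L\<^esub> x"
    using a b by (auto simp: m_comm a_comm)
  fix z assume "z \<in> carrier L"
  then obtain c v where c: "c \<in> carrier A" "v \<in> T" "z = fraction A T c v"
    by auto
  show "(x \<oplus>\<^bsub>L\<^esub> y) \<oplus>\<^bsub>L\<^esub> z = x \<oplus>\<^bsub>L\<^esub> (y \<oplus>\<^bsub>L\<^esub> z)"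
    using a b c by (auto intro!: fraction_eq simp: m_ac a_ac l_distr r_distr)
  show "(x \<otimes>\<^bsub>L\<^esub> y) \<otimes>\<^bsub>L\<^esub> z = x \<otimes>\<^bsub>L\<^esub> (y \<otimes>\<^bsub>L\<^esub> z)"
    using a b c by (auto simp: m_ac)
  show "(x \<oplus>\<^bsub>L\<^esub> y) \<otimes>\<^bsub>L\<^esub> z = x \<otimes>\<^bsub>L\<^esub> z \<oplus>\<^bsub>L\<^esub> y \<otimes>\<^bsub>L\<^esub> z"
    using a b c by simp (rule fraction_eq; simp add: m_ac l_distr r_distr)
qed (auto simp: localization_ops one_mem)

lemma localization_minus:
  assumes a: "a \<in> carrier A" "t \<in> T" and b: "b \<in> carrier A" "u \<in> T"
  shows "fraction A T a t \<ominus>\<^bsub>L\<^esub> fraction A T b u = fraction A T (a \<otimes> u \<ominus> b \<otimes> t) (t \<otimes> u)"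
proof -
  interpret L: cring L
    by (rule localization_cring)
  have "fraction A T (\<ominus> b) u \<oplus>\<^bsub>L\<^esub> fraction A T b u = \<zero>\<^bsub>L\<^esub>"
    using b by (simp only: localization_add localization_zero a_inv_closed)
      (rule fraction_eq; simp add: l_minus l_neg mult_mem mem_carrier one_mem)
  then have "\<ominus>\<^bsub>L\<^esub> fraction A T b u = fraction A T (\<ominus> b) u"
    using b by (intro L.minus_equality) auto
  then show ?thesis
    using a b by (simp add: a_minus_def[of L] a_minus_def[of A] localization_add l_minus mem_carrier)
qed

end

section \<open>Prime complements, powers, and maps between localizations\<close>

lemma multiplicative_subset_prime:
  assumes "cring A" "primeideal P A"
  shows "multiplicative_subset A (carrier A - P)"
proof -
  interpret primeideal P A by fact
  show ?thesis
    using I_prime I_notcarr one_imp_carrier assms(1)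
    by (auto simp: multiplicative_subset_def multiplicative_subset_axioms_def)
qed

lemma multiplicative_subset_powers:
  assumes "cring A" "f \<in> carrier A"
  shows "multiplicative_subset A (powers A f)"
proof -
  interpret cring A by fact
  show ?thesis
    using assms unfolding multiplicative_subset_def multiplicative_subset_axioms_def powers_def
    by (auto simp: nat_pow_mult intro: range_eqI[of _ _ 0])
qed

text \<open>Applying \<open>h\<close> to the equation that identifies two representatives gives the
  equation for their images; its witness stays admissible because \<open>h\<close> maps
  \<open>T\<close> into \<open>U\<close>.\<close>

lemma localization_map_fraction:
  assumes A: "multiplicative_subset A T" and B: "multiplicative_subset B U"
    and h: "h \<in> ring_hom A B" "h ` T \<subseteq> U" and a: "a \<in> carrier A" "t \<in> T"
  shows "localization_map B U h (fraction A T a t) = fraction B U (h a) (h t)"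
proof -
  interpret A: multiplicative_subset A T by fact
  interpret B: multiplicative_subset B U by fact
  note hc = ring_hom_closed[OF h(1)]
  have "fraction B U (h c) (h v) = fraction B U (h a) (h t)" if p: "(c, v) \<in> fraction A T a t" for c v
  proof -
    have cv: "c \<in> carrier A" "v \<in> T"
      using p a by (auto simp: A.mem_fraction)
    obtain x where x: "x \<in> T" "x \<otimes>\<^bsub>A\<^esub> (a \<otimes>\<^bsub>A\<^esub> v) = x \<otimes>\<^bsub>A\<^esub> (c \<otimes>\<^bsub>A\<^esub> t)"
      using a p by (auto simp: A.mem_fraction)
    have "h x \<otimes>\<^bsub>B\<^esub> (h a \<otimes>\<^bsub>B\<^esub> h v) = h x \<otimes>\<^bsub>B\<^esub> (h c \<otimes>\<^bsub>B\<^esub> h t)"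
      using arg_cong[OF x(2), of h] ring_hom_mult[OF h(1)] a cv x(1) by (simp add: A.mem_carrier)
    moreover have "h x \<in> U" "h v \<in> U" "h t \<in> U"
      using h(2) x(1) cv a by auto
    ultimately show ?thesis
      using hc a cv by (subst B.fraction_eq_iff) (auto intro!: bexI[of _ "h x"])
  qed
  then have "(\<Union>(c, v)\<in>fraction A T a t. fraction B U (h c) (h v)) = fraction B U (h a) (h t)"
    by (rule A.UN_fraction[OF a])
  then show ?thesis
    by (simp add: localization_map_def)
qed

lemma localization_map_hom:
  assumes A: "multiplicative_subset A T" and B: "multiplicative_subset B U"
    and h: "h \<in> ring_hom A B" "h ` T \<subseteq> U"
  shows "localization_map B U h \<in> ring_hom (localization A T) (localization B U)"
proof -
  interpret A: multiplicative_subset A T by fact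
  interpret B: multiplicative_subset B U by fact
  note [simp] = localization_map_fraction[OF assms] A.mem_carrier A.localization_ops
    B.localization_ops ring_hom_closed[OF h(1)] ring_hom_mult[OF h(1)] ring_hom_add[OF h(1)]
    A.one_mem A.mult_mem
  have [simp]: "h t \<in> U" if "t \<in> T" for t
    using that h(2) by blast
  show ?thesis
  proof (rule ring_hom_memI)
    show "localization_map B U h \<one>\<^bsub>localization A T\<^esub> = \<one>\<^bsub>localization B U\<^esub>"
      using ring_hom_one[OF h(1)] by simp
  qed (auto elim!: A.localization_cases)
qed

section \<open>Affine schemes\<close>

text \<open>Prime ideals are proper, so none contains \<open>carrier A\<close>, and the open set
  given by \<open>E = carrier A\<close> is the whole spectrum.\<close>

lemma topspace_zariski:
  assumes "cring A"
  shows "topspace (zariski A) = {P. primeideal P A}"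
proof -
  have "\<not> carrier A \<subseteq> P" if "primeideal P A" for P
  proof -
    interpret primeideal P A by fact
    show ?thesis
      using I_notcarr a_subset by auto
  qed
  then have "{P. primeideal P A} = {P. primeideal P A \<and> \<not> carrier A \<subseteq> P}"
    by auto
  then have "openin (zariski A) {P. primeideal P A}"
    unfolding openin_zariski[OF assms] by (intro exI[of _ "carrier A"]) simp
  moreover have "topspace (zariski A) \<subseteq> {P. primeideal P A}"
    unfolding topspace_def using openin_zariski[OF assms] by auto
  ultimately show ?thesis
    using openin_subset by blast
qed

lemma Spec_simps [simp]:
  "space_top (Spec A) = zariski A" "sections (Spec A) = structure_sheaf A"
  "restr (Spec A) U V s = restrict s V"
  by (simp_all add: Spec_def)

lemma structure_sheaf_simps [simp]:
  "carrier (structure_sheaf A U) = structure_sections A U"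
  "s \<otimes>\<^bsub>structure_sheaf A U\<^esub> t = (\<lambda>P\<in>U. s P \<otimes>\<^bsub>localization_at A P\<^esub> t P)"
  "s \<oplus>\<^bsub>structure_sheaf A U\<^esub> t = (\<lambda>P\<in>U. s P \<oplus>\<^bsub>localization_at A P\<^esub> t P)"
  "\<one>\<^bsub>structure_sheaf A U\<^esub> = (\<lambda>P\<in>U. \<one>\<^bsub>localization_at A P\<^esub>)"
  by (simp_all add: structure_sheaf_def)

lemma Spec_map_simps:
  "on_points (Spec_map A B h) Q = {a \<in> carrier A. h a \<in> Q}"
  "pullback (Spec_map A B h) U s =
    (\<lambda>Q\<in>{Q. primeideal Q B \<and> {a \<in> carrier A. h a \<in> Q} \<in> U}.
       localization_map B (carrier B - Q) h (s {a \<in> carrier A. h a \<in> Q}))"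
  by (simp_all add: Spec_map_def)

lemma rs_preimage_Spec_map:
  "cring B \<Longrightarrow> rs_preimage (Spec B) (Spec_map A B h) V =
    {Q. primeideal Q B \<and> {a \<in> carrier A. h a \<in> Q} \<in> V}"
  by (simp add: rs_preimage_def topspace_zariski Spec_map_simps)

lemma structure_section_closed:
  "\<lbrakk>s \<in> structure_sections A U; P \<in> U\<rbrakk> \<Longrightarrow> s P \<in> carrier (localization_at A P)"
  by (auto simp: structure_sections_def)

lemma structure_sectionE:
  assumes "s \<in> structure_sections A U" "P \<in> U"
  obtains W a b where "openin (zariski A) W" "P \<in> W" "W \<subseteq> U" "a \<in> carrier A" "b \<in> carrier A"
    "\<And>Q. Q \<in> W \<Longrightarrow> b \<notin> Q \<and> s Q = fraction A (carrier A - Q) a b"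
proof -
  have "\<exists>W. openin (zariski A) W \<and> P \<in> W \<and> W \<subseteq> U \<and> (\<exists>a\<in>carrier A. \<exists>b\<in>carrier A. \<forall>Q\<in>W.
      b \<notin> Q \<and> s Q = fraction A (carrier A - Q) a b)"
    using assms by (simp add: structure_sections_def)
  then show thesis
    by (elim exE conjE bexE) (rule that, assumption+, simp)
qed

lemma locally_fractionI:
  assumes "openin (zariski A) W" "P \<in> W" "W \<subseteq> U" "a \<in> carrier A" "b \<in> carrier A"
    "\<And>Q. Q \<in> W \<Longrightarrow> b \<notin> Q \<and> s Q = fraction A (carrier A - Q) a b"
  shows "\<exists>W. openin (zariski A) W \<and> P \<in> W \<and> W \<subseteq> U \<and> (\<exists>a\<in>carrier A. \<exists>b\<in>carrier A. \<forall>Q\<in>W.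
    b \<notin> Q \<and> s Q = fraction A (carrier A - Q) a b)"
  using assms by (intro exI[of _ W] conjI) auto

lemma openin_zariski_prime: "\<lbrakk>cring A; openin (zariski A) W; P \<in> W\<rbrakk> \<Longrightarrow> primeideal P A"
  by (auto simp: openin_zariski)

section \<open>The morphism of spectra induced by a ring homomorphism\<close>

locale spec_hom = A: cring A + B: cring B for A (structure) and B (structure) +
  fixes h
  assumes hom: "h \<in> ring_hom A B"
begin

abbreviation contract where "contract Q \<equiv> {a \<in> carrier A. h a \<in> Q}"

abbreviation stalk_map where "stalk_map Q \<equiv> localization_map B (carrier B - Q) h"

lemma primeideal_contract:
  assumes "primeideal Q B"
  shows "primeideal (contract Q) A"
proof -
  interpret ring_hom_ring A B h
    using hom by (intro ring_hom_ringI2 A.ring_axioms B.ring_axioms)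
  show ?thesis
    using assms by (rule primeideal_vimage[OF A.is_cring])
qed

lemma stalk_map_fraction:
  assumes "primeideal Q B" "a \<in> carrier A" "t \<in> carrier A" "t \<notin> contract Q"
  shows "stalk_map Q (fraction A (carrier A - contract Q) a t) =
    fraction B (carrier B - Q) (h a) (h t)"
  using assms primeideal_contract hom ring_hom_closed[OF hom]
  by (intro localization_map_fraction multiplicative_subset_prime A.is_cring B.is_cring) auto

lemma stalk_map_hom:
  assumes "primeideal Q B"
  shows "stalk_map Q \<in> ring_hom (localization_at A (contract Q)) (localization_at B Q)"
  using assms primeideal_contract hom ring_hom_closed[OF hom]
  by (intro localization_map_hom multiplicative_subset_prime A.is_cring B.is_cring) auto

text \<open>The open set given by \<open>E\<close> pulls back to the one given by the image of
  \<open>E\<close> under \<open>h\<close>, since \<open>contract Q\<close> contains \<open>E\<close>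
  exactly if \<open>Q\<close> contains that image.\<close>

lemma openin_preimage:
  assumes "openin (zariski A) V"
  shows "openin (zariski B) {Q. primeideal Q B \<and> contract Q \<in> V}"
proof -
  obtain E where E: "E \<subseteq> carrier A" "V = {P. primeideal P A \<and> \<not> E \<subseteq> P}"
    using assms unfolding openin_zariski[OF A.is_cring] by (elim exE conjE)
  then have "{Q. primeideal Q B \<and> contract Q \<in> V} = {Q. primeideal Q B \<and> \<not> h ` E \<subseteq> Q}"
    using primeideal_contract by auto
  moreover have "h ` E \<subseteq> carrier B"
    using E ring_hom_closed[OF hom] by auto
  ultimately show ?thesis
    unfolding openin_zariski[OF B.is_cring] by blast
qed

text \<open>Where the section is the fraction \<open>a / b\<close> on \<open>W\<close>, its pullback
  is \<open>h a / h b\<close> on the preimage of \<open>W\<close>.\<close>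

lemma pullback_closed:
  assumes V: "openin (zariski A) V" and s: "s \<in> structure_sections A V"
  shows "pullback (Spec_map A B h) V s \<in>
    structure_sections B {Q. primeideal Q B \<and> contract Q \<in> V}"
    (is "?s \<in> structure_sections B ?V")
  unfolding structure_sections_def
proof (intro CollectI conjI ballI)
  show "?s \<in> (\<Pi>\<^sub>E Q\<in>?V. carrier (localization_at B Q))"
    unfolding Spec_map_simps
    by (rule restrict_PiE_iff[THEN iffD2])
      (auto intro!: ring_hom_closed[OF stalk_map_hom] structure_section_closed[OF s])
  fix Q assume Q: "Q \<in> ?V"
  then obtain W a b where W: "openin (zariski A) W" "contract Q \<in> W" "W \<subseteq> V"
    and ab: "a \<in> carrier A" "b \<in> carrier A"
    and f: "\<And>P. P \<in> W \<Longrightarrow> b \<notin> P \<and> s P = fraction A (carrier A - P) a b"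
    using structure_sectionE[OF s] by blast
  show "\<exists>W. openin (zariski B) W \<and> Q \<in> W \<and> W \<subseteq> ?V \<and>
    (\<exists>a\<in>carrier B. \<exists>b\<in>carrier B. \<forall>Q\<in>W. b \<notin> Q \<and> ?s Q = fraction B (carrier B - Q) a b)"
  proof (rule locally_fractionI)
    show "openin (zariski B) {Q. primeideal Q B \<and> contract Q \<in> W}"
      by (rule openin_preimage[OF W(1)])
    show "h a \<in> carrier B"
      using ab ring_hom_closed[OF hom] by auto
    show "h b \<in> carrier B"
      using ab ring_hom_closed[OF hom] by auto
    fix Q' assume Q': "Q' \<in> {Q. primeideal Q B \<and> contract Q \<in> W}"
    then show "h b \<notin> Q' \<and> ?s Q' = fraction B (carrier B - Q') (h a) (h b)"
      using W(3) f[of "contract Q'"] ab by (auto simp: Spec_map_simps stalk_map_fraction)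
  qed (use Q W in auto)
qed

lemma pullback_hom:
  assumes V: "openin (zariski A) V"
  shows "pullback (Spec_map A B h) V \<in> ring_hom (structure_sheaf A V)
    (structure_sheaf B {Q. primeideal Q B \<and> contract Q \<in> V})"
proof (rule ring_hom_memI)
  note [simp] = ring_hom_mult[OF stalk_map_hom] ring_hom_add[OF stalk_map_hom]
    ring_hom_one[OF stalk_map_hom] structure_section_closed
  fix s t
  assume "s \<in> carrier (structure_sheaf A V)" "t \<in> carrier (structure_sheaf A V)"
  then have st: "s \<in> structure_sections A V" "t \<in> structure_sections A V"
    by simp_all
  show "pullback (Spec_map A B h) V (s \<otimes>\<^bsub>structure_sheaf A V\<^esub> t) =
      pullback (Spec_map A B h) V s \<otimes>\<^bsub>structure_sheaf B {Q. primeideal Q B \<and> contract Q \<in> V}\<^esub>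
      pullback (Spec_map A B h) V t"
    "pullback (Spec_map A B h) V (s \<oplus>\<^bsub>structure_sheaf A V\<^esub> t) =
      pullback (Spec_map A B h) V s \<oplus>\<^bsub>structure_sheaf B {Q. primeideal Q B \<and> contract Q \<in> V}\<^esub>
      pullback (Spec_map A B h) V t"
    using st by (auto simp: Spec_map_simps fun_eq_iff)
next
  show "pullback (Spec_map A B h) V \<one>\<^bsub>structure_sheaf A V\<^esub> =
    \<one>\<^bsub>structure_sheaf B {Q. primeideal Q B \<and> contract Q \<in> V}\<^esub>"
    by (auto simp: Spec_map_simps fun_eq_iff ring_hom_one[OF stalk_map_hom])
qed (use pullback_closed[OF V] in simp)

text \<open>If \<open>s\<close> is given by \<open>a/b\<close> near \<open>contract Q\<close> and its pullback is a unit at \<open>Q\<close>, then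
  \<open>h a\<close> avoids \<open>Q\<close>, so \<open>b/a\<close> is an inverse of \<open>s\<close> on the neighbourhood where \<open>a\<close> does not vanish.\<close>

lemma germ_unit_contract:
  assumes V: "openin (zariski A) V" and Q: "primeideal Q B" "contract Q \<in> V"
    and s: "s \<in> structure_sections A V"
    and unit: "germ_unit (Spec B) {Q. primeideal Q B \<and> contract Q \<in> V} Q
      (pullback (Spec_map A B h) V s)"
  shows "germ_unit (Spec A) V (contract Q) s"
proof -
  interpret BQ: multiplicative_subset B "carrier B - Q"
    by (rule multiplicative_subset_prime[OF B.is_cring Q(1)])
  obtain W a b where W: "openin (zariski A) W" "contract Q \<in> W" "W \<subseteq> V"
    and ab: "a \<in> carrier A" "b \<in> carrier A"
    and f: "\<And>P. P \<in> W \<Longrightarrow> b \<notin> P \<and> s P = fraction A (carrier A - P) a b"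
    using structure_sectionE[OF s Q(2)] by blast
  obtain W' r where W': "Q \<in> W'" "W' \<subseteq> {Q. primeideal Q B \<and> contract Q \<in> V}"
    and r: "r \<in> structure_sections B W'"
    "restrict (pullback (Spec_map A B h) V s) W' \<otimes>\<^bsub>structure_sheaf B W'\<^esub> r =
      \<one>\<^bsub>structure_sheaf B W'\<^esub>"
    using unit unfolding germ_unit_def Units_def by auto
  have hab: "h a \<in> carrier B" "h b \<in> carrier B - Q"
    using ab f[OF W(2)] ring_hom_closed[OF hom] by auto
  \<comment> \<open>That the germ at \<open>Q\<close> has an inverse \<open>c / t\<close> means
    \<open>w (h a) c = w (h b) t\<close> for some \<open>w\<close> outside \<open>Q\<close>. The
    right side is a product of elements outside the prime \<open>Q\<close>, while \<open>h a\<close>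
    in \<open>Q\<close> would put the left side into \<open>Q\<close>.\<close>
  have "h a \<notin> Q"
  proof
    assume a: "h a \<in> Q"
    obtain c t where c: "c \<in> carrier B" "t \<in> carrier B - Q"
      "r Q = fraction B (carrier B - Q) c t"
      using structure_section_closed[OF r(1) W'(1)] by (auto elim: BQ.localization_cases)
    have "stalk_map Q (s (contract Q)) \<otimes>\<^bsub>localization_at B Q\<^esub> r Q = \<one>\<^bsub>localization_at B Q\<^esub>"
      using fun_cong[OF r(2), of Q] W'(1) Q by (simp add: Spec_map_simps)
    then have "fraction B (carrier B - Q) (h a \<otimes>\<^bsub>B\<^esub> c) (h b \<otimes>\<^bsub>B\<^esub> t) =
        fraction B (carrier B - Q) \<one>\<^bsub>B\<^esub> \<one>\<^bsub>B\<^esub>"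
      using f[OF W(2)] ab Q(1) c hab
      by (simp add: stalk_map_fraction BQ.localization_mult BQ.localization_one)
    then obtain w where w: "w \<in> carrier B - Q"
      "w \<otimes>\<^bsub>B\<^esub> (h a \<otimes>\<^bsub>B\<^esub> c \<otimes>\<^bsub>B\<^esub> \<one>\<^bsub>B\<^esub>) = w \<otimes>\<^bsub>B\<^esub> (\<one>\<^bsub>B\<^esub> \<otimes>\<^bsub>B\<^esub> (h b \<otimes>\<^bsub>B\<^esub> t))"
      using c hab BQ.one_mem BQ.mult_mem by (subst (asm) BQ.fraction_eq_iff) auto
    interpret Q: primeideal Q B by (rule Q(1))
    have "w \<otimes>\<^bsub>B\<^esub> (h a \<otimes>\<^bsub>B\<^esub> c \<otimes>\<^bsub>B\<^esub> \<one>\<^bsub>B\<^esub>) \<in> Q"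
      using a c(1) w(1) by (simp add: Q.I_l_closed Q.I_r_closed Q.Icarr)
    moreover have "w \<otimes>\<^bsub>B\<^esub> (\<one>\<^bsub>B\<^esub> \<otimes>\<^bsub>B\<^esub> (h b \<otimes>\<^bsub>B\<^esub> t)) \<in> carrier B - Q"
      using w(1) c hab by (intro BQ.mult_mem BQ.one_mem)
    ultimately show False
      using w(2) by simp
  qed
  define W0 where "W0 = W \<inter> {P. primeideal P A \<and> \<not> {a} \<subseteq> P}"
  have "openin (zariski A) {P. primeideal P A \<and> \<not> {a} \<subseteq> P}"
    unfolding openin_zariski[OF A.is_cring] using ab(1) by (intro exI[of _ "{a}"]) simp
  then have W0: "openin (zariski A) W0"
    unfolding W0_def using W(1) by blast
  have W0_iff: "P \<in> W0 \<longleftrightarrow> P \<in> W \<and> primeideal P A \<and> a \<notin> P" for P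
    by (simp add: W0_def)
  have mem: "contract Q \<in> W0"
    using W(2) \<open>h a \<notin> Q\<close> primeideal_contract[OF Q(1)] by (simp add: W0_iff)
  define r0 where "r0 = (\<lambda>P\<in>W0. fraction A (carrier A - P) b a)"
  have AP: "multiplicative_subset A (carrier A - P)" if "P \<in> W0" for P
    using that by (intro multiplicative_subset_prime A.is_cring) (simp add: W0_iff)
  have abP: "a \<in> carrier A - P" "b \<in> carrier A - P" if "P \<in> W0" for P
    using that ab f[of P] by (auto simp: W0_iff)
  have inv: "fraction A (carrier A - P) a b \<otimes>\<^bsub>localization_at A P\<^esub> fraction A (carrier A - P) b a =
      \<one>\<^bsub>localization_at A P\<^esub>" if "P \<in> W0" for P
  proof -
    interpret AP: multiplicative_subset A "carrier A - P"
      by (rule AP[OF that])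
    show ?thesis
      using abP[OF that] ab AP.one_mem AP.mult_mem
      by (simp only: AP.localization_mult AP.localization_one)
        (rule AP.fraction_eq; simp add: A.m_comm)
  qed
  have inv': "fraction A (carrier A - P) b a \<otimes>\<^bsub>localization_at A P\<^esub> fraction A (carrier A - P) a b =
      \<one>\<^bsub>localization_at A P\<^esub>" if "P \<in> W0" for P
  proof -
    interpret AP: multiplicative_subset A "carrier A - P"
      by (rule AP[OF that])
    interpret L: cring "localization_at A P"
      by (rule AP.localization_cring)
    show ?thesis
      using inv[OF that] abP[OF that] ab by (subst L.m_comm) auto
  qed
  have sW0: "restrict s W0 \<in> structure_sections A W0"
    unfolding structure_sections_def
  proof (intro CollectI conjI ballI)
    show "restrict s W0 \<in> (\<Pi>\<^sub>E P\<in>W0. carrier (localization_at A P))"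
      using W(3) structure_section_closed[OF s] by (auto simp: W0_iff)
    fix P assume "P \<in> W0"
    then show "\<exists>W. openin (zariski A) W \<and> P \<in> W \<and> W \<subseteq> W0 \<and> (\<exists>a\<in>carrier A. \<exists>b\<in>carrier A. \<forall>Q\<in>W.
        b \<notin> Q \<and> restrict s W0 Q = fraction A (carrier A - Q) a b)"
      using W0 ab f by (intro locally_fractionI[of _ W0 _ _ a b]) (auto simp: W0_iff)
  qed
  have rW0: "r0 \<in> structure_sections A W0"
    unfolding structure_sections_def
  proof (intro CollectI conjI ballI)
    show "r0 \<in> (\<Pi>\<^sub>E P\<in>W0. carrier (localization_at A P))"
      unfolding r0_def using abP AP multiplicative_subset.fraction_closed[OF AP]
      by (auto simp: ab)
    fix P assume "P \<in> W0"
    then show "\<exists>W. openin (zariski A) W \<and> P \<in> W \<and> W \<subseteq> W0 \<and> (\<exists>a\<in>carrier A. \<exists>b\<in>carrier A. \<forall>Q\<in>W.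
        b \<notin> Q \<and> r0 Q = fraction A (carrier A - Q) a b)"
      using W0 ab by (intro locally_fractionI[of _ W0 _ _ b a]) (auto simp: W0_iff r0_def)
  qed
  have "restrict s W0 \<in> Units (structure_sheaf A W0)"
    unfolding Units_def using sW0 rW0 inv inv' f
    by (auto intro!: bexI[of _ r0] simp: r0_def W0_iff fun_eq_iff)
  then show ?thesis
    unfolding germ_unit_def Spec_simps using W0 mem W(3)
    by (intro exI[of _ W0]) (auto simp: W0_iff)
qed

lemma lrs_morphism_Spec_map: "lrs_morphism (Spec B) (Spec A) (Spec_map A B h)"
  unfolding lrs_morphism_def Spec_simps rs_preimage_Spec_map[OF B.is_cring]
    topspace_zariski[OF B.is_cring]
proof (intro conjI allI impI ballI)
  show "continuous_map (zariski B) (zariski A) (on_points (Spec_map A B h))"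
    using openin_preimage primeideal_contract
    by (auto simp: continuous_map_def topspace_zariski A.is_cring B.is_cring Spec_map_simps)
  fix V assume "openin (zariski A) V"
  then show "pullback (Spec_map A B h) V \<in> ring_hom (structure_sheaf A V)
      (structure_sheaf B {Q. primeideal Q B \<and> contract Q \<in> V})"
    by (rule pullback_hom)
next
  fix V W s
  assume "openin (zariski A) V \<and> openin (zariski A) W \<and> W \<subseteq> V"
  then show "pullback (Spec_map A B h) W (restrict s W) =
      restrict (pullback (Spec_map A B h) V s) {Q. primeideal Q B \<and> contract Q \<in> W}"
    by (auto simp: Spec_map_simps fun_eq_iff)
next
  fix Q V s
  assume "Q \<in> {P. primeideal P B}"
    and "openin (zariski A) V \<and> on_points (Spec_map A B h) Q \<in> V"
    and "s \<in> carrier (structure_sheaf A V)"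
    and "germ_unit (Spec B) {Q. primeideal Q B \<and> contract Q \<in> V} Q
      (pullback (Spec_map A B h) V s)"
  then show "germ_unit (Spec A) V (on_points (Spec_map A B h) Q) s"
    using germ_unit_contract by (simp add: Spec_map_simps)
qed

end

section \<open>Functoriality of the spectrum\<close>

lemma Spec_map_comp:
  assumes "spec_hom A B h" "spec_hom B C g"
  shows "rs_eq (Spec C) (Spec A) (rs_comp (Spec C) (Spec B) (Spec_map B C g) (Spec_map A B h))
    (Spec_map A C (\<lambda>a. g (h a)))"
proof -
  interpret h: spec_hom A B h by fact
  interpret g: spec_hom B C g by fact
  have gh: "(\<lambda>a. g (h a)) \<in> ring_hom A C"
    using ring_hom_trans[OF h.hom g.hom] by (simp add: comp_def)
  interpret gh: spec_hom A C "\<lambda>a. g (h a)"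
    using gh by unfold_locales
  \<comment> \<open>The second equation is the form that a double contraction takes once the inner
    set is unfolded.\<close>
  have con: "h.contract (g.contract Q) = gh.contract Q"
    "{a \<in> carrier A. h a \<in> carrier B \<and> g (h a) \<in> Q} = gh.contract Q" for Q
    using ring_hom_closed[OF h.hom] by auto
  have "g.stalk_map Q (h.stalk_map (g.contract Q) x) = gh.stalk_map Q x"
    if Q: "primeideal Q C" and x: "x \<in> carrier (localization_at A (gh.contract Q))" for Q x
  proof -
    interpret multiplicative_subset A "carrier A - gh.contract Q"
      by (rule multiplicative_subset_prime[OF h.A.is_cring gh.primeideal_contract[OF Q]])
    obtain a t where a: "a \<in> carrier A" "t \<in> carrier A - gh.contract Q"
      "x = fraction A (carrier A - gh.contract Q) a t"
      using x by (rule localization_cases)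
    have t: "t \<in> carrier A" "t \<notin> h.contract (g.contract Q)"
      using a(2) by auto
    have "h.stalk_map (g.contract Q) x =
        fraction B (carrier B - g.contract Q) (h a) (h t)"
      using h.stalk_map_fraction[OF g.primeideal_contract[OF Q] a(1) t] unfolding con a(3) .
    then show ?thesis
      using g.stalk_map_fraction[OF Q, of "h a" "h t"] gh.stalk_map_fraction[OF Q, of a t] a
        ring_hom_closed[OF h.hom] by auto
  qed
  then show ?thesis
    unfolding rs_eq_def Spec_simps rs_comp_def
    by (auto simp: rs_preimage_Spec_map h.B.is_cring Spec_map_simps con fun_eq_iff
        g.primeideal_contract structure_section_closed)
qed

text \<open>Homomorphisms are functions on a whole type, so two that agree on the carrier may still
  differ; this is why morphisms are compared with \<open>rs_eq\<close> and not with
  equality.\<close>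

lemma Spec_map_cong:
  assumes "spec_hom A B h" "spec_hom A B g" and eq: "\<And>a. a \<in> carrier A \<Longrightarrow> h a = g a"
  shows "rs_eq (Spec B) (Spec A) (Spec_map A B h) (Spec_map A B g)"
proof -
  interpret h: spec_hom A B h by fact
  interpret g: spec_hom A B g by fact
  have con: "h.contract Q = g.contract Q" for Q
    using eq by auto
  have "h.stalk_map Q x = g.stalk_map Q x"
    if Q: "primeideal Q B" and x: "x \<in> carrier (localization_at A (g.contract Q))" for Q x
  proof -
    interpret multiplicative_subset A "carrier A - g.contract Q"
      by (rule multiplicative_subset_prime[OF h.A.is_cring g.primeideal_contract[OF Q]])
    obtain a t where a: "a \<in> carrier A" "t \<in> carrier A - g.contract Q"
      "x = fraction A (carrier A - g.contract Q) a t"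
      using x by (rule localization_cases)
    then show ?thesis
      using g.stalk_map_fraction[OF Q, of a t] h.stalk_map_fraction[OF Q, of a t]
      by (simp add: con eq)
  qed
  then show ?thesis
    unfolding rs_eq_def Spec_simps
    by (auto simp: Spec_map_simps con fun_eq_iff structure_section_closed)
qed

lemma Spec_map_id:
  assumes "spec_hom A A h" and eq: "\<And>a. a \<in> carrier A \<Longrightarrow> h a = a"
  shows "rs_eq (Spec A) (Spec A) (Spec_map A A h) rs_id"
proof -
  interpret spec_hom A A h by fact
  have con: "contract Q = Q" if "primeideal Q A" for Q
    using eq ideal.Icarr[OF primeideal.axioms(1)[OF that]] by auto
  have "stalk_map Q x = x"
    if Q: "primeideal Q A" and x: "x \<in> carrier (localization_at A Q)" for Q x
  proof -
    interpret multiplicative_subset A "carrier A - Q"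
      by (rule multiplicative_subset_prime[OF A.is_cring Q])
    obtain a t where a: "a \<in> carrier A" "t \<in> carrier A - Q" "x = fraction A (carrier A - Q) a t"
      using x by (rule localization_cases)
    then show ?thesis
      using stalk_map_fraction[OF Q, of a t] by (simp add: con[OF Q] eq)
  qed
  then have "pullback (Spec_map A A h) V s = s"
    if V: "openin (zariski A) V" and s: "s \<in> structure_sections A V" for V s
  proof -
    \<comment> \<open>Off \<open>V\<close> both sides take the default value of a restricted
      function: \<open>V\<close> consists of primes, and these are their own contractions, so the
      pullback is restricted to exactly \<open>V\<close>.\<close>
    have "s \<in> extensional V"
      using s by (simp add: structure_sections_def PiE_def)
    then show ?thesis
      using \<open>\<And>x Q. \<lbrakk>primeideal Q A; x \<in> carrier (localization_at A Q)\<rbrakk> \<Longrightarrow> stalk_map Q x = x\<close>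
        structure_section_closed[OF s] con openin_zariski_prime[OF A.is_cring V]
      unfolding Spec_map_simps
      by (intro extensionalityI[of _ V]) (auto simp: extensional_def)
  qed
  then show ?thesis
    unfolding rs_eq_def Spec_simps
    by (auto simp: topspace_zariski A.is_cring con Spec_map_simps(1) rs_id_def)
qed

lemma rs_eq_trans: "\<lbrakk>rs_eq X Y f g; rs_eq X Y g k\<rbrakk> \<Longrightarrow> rs_eq X Y f k"
  by (auto simp: rs_eq_def)

text \<open>The functor \<open>Spec\<close> reverses arrows, so the morphism from
  \<open>Spec A\<close> to \<open>Spec B\<close> comes from the inverse of \<open>h\<close>. The
  triangle over \<open>Spec S\<close> therefore uses \<open>comm\<close> in the inverted form
  \<open>kb\<close>.\<close>

proposition Spec_isomorphic_over:
  assumes a: "spec_hom S A a" and b: "spec_hom S B b" and h: "h \<in> ring_iso A B"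
    and comm: "\<And>s. s \<in> carrier S \<Longrightarrow> h (a s) = b s"
  shows "isomorphic_over (Spec S) (Spec A) (Spec_map S A a) (Spec B) (Spec_map S B b)"
proof -
  interpret a: spec_hom S A a by fact
  interpret b: spec_hom S B b by fact
  let ?k = "inv_into (carrier A) h"
  have k: "?k \<in> ring_iso B A"
    by (rule ring_iso_set_sym[OF a.B.ring_axioms h])
  have hk: "spec_hom A B h" "spec_hom B A ?k"
    using h k unfolding ring_iso_def by (unfold_locales; blast)+
  have bij: "bij_betw h (carrier A) (carrier B)"
    using h by (simp add: ring_iso_def)
  have kh: "?k (h x) = x" if "x \<in> carrier A" for x
    using bij_betw_inv_into_left[OF bij that] .
  have hk_id: "h (?k y) = y" if "y \<in> carrier B" for y
    using bij_betw_inv_into_right[OF bij that] .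
  have kb: "?k (b s) = a s" if "s \<in> carrier S" for s
    using kh[OF ring_hom_closed[OF a.hom that]] comm[OF that] by simp
  \<comment> \<open>Stated over fresh types, because it is used for three different triples of
    rings.\<close>
  have comp: "spec_hom A C (\<lambda>x. g (f x))" if "spec_hom A B f" "spec_hom B C g"
    for A :: "('p, 'q) ring_scheme" and B :: "('r, 's) ring_scheme" and C :: "('t, 'u) ring_scheme"
      and f g
    using that ring_hom_trans[of f A B g C]
    by (simp add: spec_hom_def spec_hom_axioms_def comp_def)
  show ?thesis
    unfolding isomorphic_over_def
  proof (intro conjI exI)
    show "lrs_morphism (Spec A) (Spec S) (Spec_map S A a)"
      by (rule a.lrs_morphism_Spec_map)
    show "lrs_morphism (Spec B) (Spec S) (Spec_map S B b)"
      by (rule b.lrs_morphism_Spec_map)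
    show "lrs_morphism (Spec A) (Spec B) (Spec_map B A ?k)"
      "lrs_morphism (Spec B) (Spec A) (Spec_map A B h)"
      using hk by (simp_all add: spec_hom.lrs_morphism_Spec_map)
    show "rs_eq (Spec A) (Spec A)
        (rs_comp (Spec A) (Spec B) (Spec_map B A ?k) (Spec_map A B h)) rs_id"
      using kh comp[OF hk] by (intro rs_eq_trans[OF Spec_map_comp[OF hk]] Spec_map_id)
    show "rs_eq (Spec B) (Spec B)
        (rs_comp (Spec B) (Spec A) (Spec_map A B h) (Spec_map B A ?k)) rs_id"
      using hk_id comp[OF hk(2,1)] by (intro rs_eq_trans[OF Spec_map_comp[OF hk(2,1)]] Spec_map_id)
    show "rs_eq (Spec A) (Spec S)
        (rs_comp (Spec A) (Spec B) (Spec_map B A ?k) (Spec_map S B b)) (Spec_map S A a)"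
      using kb comp[OF b hk(2)] a
      by (intro rs_eq_trans[OF Spec_map_comp[OF b hk(2)]] Spec_map_cong)
  qed
qed

section \<open>Splines\<close>

lemma spline_ring_simps [simp]:
  "carrier (spline_ring R G) = splines R G"
  "s \<otimes>\<^bsub>spline_ring R G\<^esub> t = (\<lambda>v\<in>vertices G. s v \<otimes>\<^bsub>R\<^esub> t v)"
  "s \<oplus>\<^bsub>spline_ring R G\<^esub> t = (\<lambda>v\<in>vertices G. s v \<oplus>\<^bsub>R\<^esub> t v)"
  "\<one>\<^bsub>spline_ring R G\<^esub> = diag G \<one>\<^bsub>R\<^esub>"
  "\<zero>\<^bsub>spline_ring R G\<^esub> = diag G \<zero>\<^bsub>R\<^esub>"
  "r \<odot>\<^bsub>spline_ring R G\<^esub> s = (\<lambda>v\<in>vertices G. r \<otimes>\<^bsub>R\<^esub> s v)"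
  by (simp_all add: spline_ring_def)

lemma diag_apply [simp]: "v \<in> vertices G \<Longrightarrow> diag G r v = r"
  by (simp add: diag_def)

locale spline_graph = cring R for R (structure) +
  fixes G
  assumes graph: "edge_labeled_graph R G"
begin

abbreviation V where "V \<equiv> vertices G"
abbreviation E where "E \<equiv> edges G"
abbreviation R_G where "R_G \<equiv> spline_ring R G"

lemma finite_V: "finite V" and finite_E: "finite E"
  using graph by (auto simp: edge_labeled_graph_def)

lemma label_ideal: "e \<in> E \<Longrightarrow> ideal (label G e) R"
  using graph by (auto simp: edge_labeled_graph_def)

lemma ends_in_V: "\<lbrakk>e \<in> E; ends G e = {u, v}\<rbrakk> \<Longrightarrow> u \<in> V \<and> v \<in> V"
  using graph unfolding edge_labeled_graph_def by (metis insertI1 insert_commute empty_iff insertE)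

lemma edge_cases:
  assumes "e \<in> E"
  obtains u v where "u \<in> V" "v \<in> V" "ends G e = {u, v}"
  using assms graph unfolding edge_labeled_graph_def by meson

lemma spline_closed [simp]: "\<lbrakk>s \<in> splines R G; v \<in> V\<rbrakk> \<Longrightarrow> s v \<in> carrier R"
  by (auto simp: splines_def)

lemma spline_edge: "\<lbrakk>s \<in> splines R G; e \<in> E; ends G e = {u, v}\<rbrakk> \<Longrightarrow> s u \<ominus> s v \<in> label G e"
  by (auto simp: splines_def)

lemma spline_eqI:
  assumes "s \<in> splines R G" "t \<in> splines R G" "\<And>v. v \<in> V \<Longrightarrow> s v = t v"
  shows "s = t"
  using assms by (auto simp: splines_def intro: PiE_ext)

lemma restrict_splineI:
  assumes closed: "\<And>v. v \<in> V \<Longrightarrow> f v \<in> carrier R"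
    and edge: "\<And>e u v. \<lbrakk>e \<in> E; ends G e = {u, v}; u \<in> V; v \<in> V\<rbrakk> \<Longrightarrow> f u \<ominus> f v \<in> label G e"
  shows "(\<lambda>v\<in>V. f v) \<in> splines R G"
  using assms ends_in_V by (auto simp: splines_def)

text \<open>The definition of \<open>splines\<close> asks for the condition in both orders of the
  ends of an edge. A label is closed under negation, so one order suffices.\<close>

lemma splineI_orientation:
  assumes s: "s \<in> V \<rightarrow>\<^sub>E carrier R"
    and edge: "\<And>e. e \<in> E \<Longrightarrow> \<exists>u v. ends G e = {u, v} \<and> s u \<ominus> s v \<in> label G e"
  shows "s \<in> splines R G"
  unfolding splines_def
proof (intro CollectI conjI ballI allI impI s)
  fix e u v assume e: "e \<in> E" "ends G e = {u, v}"
  interpret I: ideal "label G e" R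
    by (rule label_ideal[OF e(1)])
  obtain u' v' where uv: "ends G e = {u', v'}" "s u' \<ominus> s v' \<in> label G e"
    using edge[OF e(1)] by blast
  have car: "s u' \<in> carrier R" "s v' \<in> carrier R"
    using ends_in_V[OF e(1) uv(1)] s by auto
  have "s v' \<ominus> s u' = \<ominus> (s u' \<ominus> s v')"
    using car by (simp add: a_minus_def minus_add a_comm)
  then have "s v' \<ominus> s u' \<in> label G e"
    using I.a_inv_closed[OF uv(2)] by simp
  moreover have "u = u' \<and> v = v' \<or> u = v' \<and> v = u'"
    using e(2) uv(1) by (auto simp: doubleton_eq_iff)
  ultimately show "s u \<ominus> s v \<in> label G e"
    using uv(2) by auto
qed

lemma diag_spline: "r \<in> carrier R \<Longrightarrow> diag G r \<in> splines R G"
  unfolding diag_def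
  by (rule restrict_splineI) (auto simp: a_minus_def r_neg dest!: label_ideal
      intro: additive_subgroup.zero_closed ideal.axioms(1))

lemma add_spline:
  assumes "s \<in> splines R G" "t \<in> splines R G"
  shows "(\<lambda>v\<in>V. s v \<oplus> t v) \<in> splines R G"
proof (rule restrict_splineI)
  fix e u v assume e: "e \<in> E" "ends G e = {u, v}" and uv: "u \<in> V" "v \<in> V"
  interpret I: ideal "label G e" R
    by (rule label_ideal[OF e(1)])
  have "(s u \<oplus> t u) \<ominus> (s v \<oplus> t v) = (s u \<ominus> s v) \<oplus> (t u \<ominus> t v)"
    using assms uv by (simp add: a_minus_def minus_add a_ac)
  then show "(s u \<oplus> t u) \<ominus> (s v \<oplus> t v) \<in> label G e"
    using spline_edge e assms by (simp add: I.a_closed)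
qed (use assms in simp)

lemma mult_spline:
  assumes "s \<in> splines R G" "t \<in> splines R G"
  shows "(\<lambda>v\<in>V. s v \<otimes> t v) \<in> splines R G"
proof (rule restrict_splineI)
  fix e u v assume e: "e \<in> E" "ends G e = {u, v}" and uv: "u \<in> V" "v \<in> V"
  interpret I: ideal "label G e" R
    by (rule label_ideal[OF e(1)])
  \<comment> \<open>The mixed term \<open>s u \<otimes> t v\<close> is inserted, which leaves one
    edge difference in each summand.\<close>
  have "s u \<otimes> t u \<ominus> s v \<otimes> t v = s u \<otimes> (t u \<ominus> t v) \<oplus> (s u \<ominus> s v) \<otimes> t v"
    using assms uv
    by (simp add: a_minus_def l_distr r_distr l_minus r_minus a_assoc) (simp add: a_assoc[symmetric] l_neg)
  then show "s u \<otimes> t u \<ominus> s v \<otimes> t v \<in> label G e"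
    using spline_edge e assms uv by (simp add: I.a_closed I.I_l_closed I.I_r_closed)
qed (use assms in simp)

lemma smult_spline:
  assumes "r \<in> carrier R" "s \<in> splines R G"
  shows "(\<lambda>v\<in>V. r \<otimes> s v) \<in> splines R G"
  using mult_spline[OF diag_spline[OF assms(1)] assms(2)] by (simp cong: restrict_cong)

lemma spline_ring_cring: "cring R_G"
proof (intro cringI abelian_groupI comm_monoidI)
  note [simp] = add_spline mult_spline diag_spline
  fix s assume s: "s \<in> carrier R_G"
  have "(\<lambda>v\<in>V. \<ominus> \<one> \<otimes> s v) \<in> splines R G"
    using s by (intro smult_spline) auto
  moreover have "(\<lambda>v\<in>V. \<ominus> \<one> \<otimes> s v) \<oplus>\<^bsub>R_G\<^esub> s = \<zero>\<^bsub>R_G\<^esub>"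
    using s by (auto simp: diag_def l_minus l_neg intro!: restrict_ext)
  ultimately show "\<exists>t\<in>carrier R_G. t \<oplus>\<^bsub>R_G\<^esub> s = \<zero>\<^bsub>R_G\<^esub>"
    by (intro bexI) simp_all
  show "\<zero>\<^bsub>R_G\<^esub> \<oplus>\<^bsub>R_G\<^esub> s = s" "\<one>\<^bsub>R_G\<^esub> \<otimes>\<^bsub>R_G\<^esub> s = s"
    using s add_spline[of "diag G \<zero>" s] mult_spline[of "diag G \<one>" s]
    by (auto intro!: spline_eqI[of _ s])
  fix t assume t: "t \<in> carrier R_G"
  show "s \<oplus>\<^bsub>R_G\<^esub> t \<in> carrier R_G" "s \<otimes>\<^bsub>R_G\<^esub> t \<in> carrier R_G"
    using s t by simp_all
  show "s \<oplus>\<^bsub>R_G\<^esub> t = t \<oplus>\<^bsub>R_G\<^esub> s" "s \<otimes>\<^bsub>R_G\<^esub> t = t \<otimes>\<^bsub>R_G\<^esub> s"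
    using s t by (auto simp: m_comm a_comm intro!: restrict_ext)
  fix r assume r: "r \<in> carrier R_G"
  show "(s \<oplus>\<^bsub>R_G\<^esub> t) \<oplus>\<^bsub>R_G\<^esub> r = s \<oplus>\<^bsub>R_G\<^esub> (t \<oplus>\<^bsub>R_G\<^esub> r)"
    "(s \<otimes>\<^bsub>R_G\<^esub> t) \<otimes>\<^bsub>R_G\<^esub> r = s \<otimes>\<^bsub>R_G\<^esub> (t \<otimes>\<^bsub>R_G\<^esub> r)"
    "(s \<oplus>\<^bsub>R_G\<^esub> t) \<otimes>\<^bsub>R_G\<^esub> r = s \<otimes>\<^bsub>R_G\<^esub> r \<oplus>\<^bsub>R_G\<^esub> t \<otimes>\<^bsub>R_G\<^esub> r"
    using s t r by (auto simp: m_assoc a_assoc l_distr intro!: restrict_ext)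
qed (simp_all add: diag_spline)

lemma diag_hom: "diag G \<in> ring_hom R R_G"
  by (rule ring_hom_memI) (simp_all add: diag_spline, auto simp: diag_def intro!: restrict_ext)

lemma spline_ring_module: "module R R_G"
proof (rule moduleI)
  show "abelian_group R_G"
    using spline_ring_cring by (simp add: cring_def ring_def)
qed (auto simp: smult_spline is_cring l_distr r_distr m_assoc intro!: restrict_ext
    spline_eqI[OF smult_spline])

lemma evaluation_hom: "v \<in> V \<Longrightarrow> (\<lambda>s. s v) \<in> ring_hom R_G R"
  by (rule ring_hom_memI) auto

end

section \<open>Base change of edge-labeled graphs\<close>

lemma base_change_graph_simps [simp]:
  "vertices (base_change_graph S G) = vertices G" "edges (base_change_graph S G) = edges G"
  "ends (base_change_graph S G) = ends G"
  "label (base_change_graph S G) e = Idl\<^bsub>S\<^esub> ((\<lambda>r. r \<odot>\<^bsub>S\<^esub> \<one>\<^bsub>S\<^esub>) ` label G e)"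
  by (simp_all add: base_change_graph_def)

lemma diag_base_change [simp]: "diag (base_change_graph S G) = diag G"
  by (simp add: diag_def fun_eq_iff)

text \<open>The hypotheses ask only that the generators of the extended labels lie in the ring
  \<open>S\<close>; in this form the lemma serves a localization as well as an algebra.\<close>

lemma (in spline_graph) base_change_spline_graph:
  assumes "cring S" and "\<And>r. r \<in> carrier R \<Longrightarrow> r \<odot>\<^bsub>S\<^esub> \<one>\<^bsub>S\<^esub> \<in> carrier S"
  shows "spline_graph S (base_change_graph S G)"
proof -
  interpret S: cring S by fact
  have "ideal (label (base_change_graph S G) e) S" if "e \<in> E" for e
    using assms(2) ideal.Icarr[OF label_ideal[OF that]] by (auto intro!: S.genideal_ideal)
  then have "edge_labeled_graph S (base_change_graph S G)"
    using graph by (auto simp: edge_labeled_graph_def)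
  then show ?thesis
    by unfold_locales
qed


section \<open>Localization of splines\<close>

context multiplicative_subset
begin

text \<open>The product of all \<open>w x\<close> serves as \<open>p\<close>, with the product of
  the other factors as cofactor. The lemma provides common denominators over the vertices and also
  turns finitely many witnesses into one.\<close>

lemma common_multiple:
  assumes "finite X" "\<And>x. x \<in> X \<Longrightarrow> w x \<in> T"
  obtains p c where "p \<in> T" "\<And>x. x \<in> X \<Longrightarrow> c x \<in> carrier A \<and> p = c x \<otimes> w x"
proof -
  have "\<exists>p\<in>T. \<forall>x\<in>X. \<exists>c\<in>carrier A. p = c \<otimes> w x"
    using assms
  proof (induction X)
    case empty
    show ?case
      using one_mem by auto
  next
    case (insert y X)
    then obtain p where p: "p \<in> T" "\<forall>x\<in>X. \<exists>c\<in>carrier A. p = c \<otimes> w x"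
      by auto
    have y: "w y \<in> T" "w y \<in> carrier A"
      using insert.prems mem_carrier by auto
    have "\<exists>c\<in>carrier A. p \<otimes> w y = c \<otimes> w x" if x: "x \<in> X" for x
    proof -
      obtain c where "c \<in> carrier A" "p = c \<otimes> w x"
        using p(2) x by auto
      moreover have "w x \<in> carrier A"
        using insert.prems x mem_carrier by auto
      ultimately show ?thesis
        using y by (intro bexI[of _ "c \<otimes> w y"]) (auto simp: m_ac)
    qed
    then show ?case
      using p(1) y mem_carrier by (intro bexI[of _ "p \<otimes> w y"]) (auto intro: mult_mem)
  qed
  then show thesis
    using that by metis
qed

text \<open>The fractions with numerator in \<open>I\<close> form an ideal, by passing to common
  denominators, and it contains the generators \<open>i / 1\<close>. Conversely \<open>i / t\<close>
  is the multiple \<open>(1 / t) (i / 1)\<close> of a generator.\<close>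

lemma mem_Idl_localization:
  assumes "ideal I A"
  shows "x \<in> Idl\<^bsub>L\<^esub> ((\<lambda>r. r \<odot>\<^bsub>L\<^esub> \<one>\<^bsub>L\<^esub>) ` I) \<longleftrightarrow> (\<exists>i\<in>I. \<exists>t\<in>T. x = fraction A T i t)"
proof
  interpret I: ideal I A by fact
  interpret L: cring L by (rule localization_cring)
  have smult_one: "r \<odot>\<^bsub>L\<^esub> \<one>\<^bsub>L\<^esub> = fraction A T r \<one>" if "r \<in> carrier A" for r
    using that by (simp add: localization_one localization_smult one_mem)
  let ?J = "{fraction A T i t | i t. i \<in> I \<and> t \<in> T}"
  have "ideal ?J L"
  proof (rule idealI[OF L.ring_axioms])
    show "subgroup ?J (add_monoid L)"
    proof (rule L.add.subgroupI)
      show "?J \<subseteq> carrier L"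
        using I.Icarr by auto
      show "?J \<noteq> {}"
        using I.zero_closed one_mem by blast
      fix x assume "x \<in> ?J"
      then obtain i t where i: "i \<in> I" "t \<in> T" "x = fraction A T i t"
        by auto
      \<comment> \<open>The negative of \<open>x\<close> is read off from \<open>0 - x\<close>, for
        which \<open>localization_minus\<close> supplies a numerator.\<close>
      have "fraction A T \<zero> \<one> \<ominus>\<^bsub>L\<^esub> x = fraction A T (\<zero> \<otimes> t \<ominus> i \<otimes> \<one>) (\<one> \<otimes> t)"
        unfolding i by (rule localization_minus) (use i one_mem I.Icarr in auto)
      then have "\<ominus>\<^bsub>L\<^esub> x = fraction A T (\<ominus> i) t"
        using i I.Icarr by (simp add: a_minus_def mem_carrier localization_zero[symmetric])
      then show "\<ominus>\<^bsub>L\<^esub> x \<in> ?J"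
        using i by auto
      fix y assume "y \<in> ?J"
      then obtain j u where j: "j \<in> I" "u \<in> T" "y = fraction A T j u"
        by auto
      then have "i \<otimes> u \<oplus> j \<otimes> t \<in> I"
        using i by (intro I.a_closed I.I_r_closed) (auto simp: mem_carrier)
      then show "x \<oplus>\<^bsub>L\<^esub> y \<in> ?J"
        using i j I.Icarr by (auto simp: localization_add intro: mult_mem)
    qed
    fix x y assume "x \<in> ?J" "y \<in> carrier L"
    then obtain i t b u where "i \<in> I" "t \<in> T" "x = fraction A T i t"
        "b \<in> carrier A" "u \<in> T" "y = fraction A T b u"
      by (auto elim: localization_cases)
    then show "y \<otimes>\<^bsub>L\<^esub> x \<in> ?J" "x \<otimes>\<^bsub>L\<^esub> y \<in> ?J"
      using I.Icarr by (auto simp: localization_mult intro: mult_mem I.I_l_closed I.I_r_closed)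
  qed
  moreover have "(\<lambda>r. r \<odot>\<^bsub>L\<^esub> \<one>\<^bsub>L\<^esub>) ` I \<subseteq> ?J"
    using smult_one one_mem I.Icarr by auto
  ultimately have "Idl\<^bsub>L\<^esub> ((\<lambda>r. r \<odot>\<^bsub>L\<^esub> \<one>\<^bsub>L\<^esub>) ` I) \<subseteq> ?J"
    by (rule L.genideal_minimal)
  then show "\<exists>i\<in>I. \<exists>t\<in>T. x = fraction A T i t"
    if x: "x \<in> Idl\<^bsub>L\<^esub> ((\<lambda>r. r \<odot>\<^bsub>L\<^esub> \<one>\<^bsub>L\<^esub>) ` I)"
    using x by blast
  show "x \<in> Idl\<^bsub>L\<^esub> ((\<lambda>r. r \<odot>\<^bsub>L\<^esub> \<one>\<^bsub>L\<^esub>) ` I)" if x: "\<exists>i\<in>I. \<exists>t\<in>T. x = fraction A T i t"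
  proof -
    obtain i t where i: "i \<in> I" "t \<in> T" "x = fraction A T i t"
      using x by auto
    have sub: "(\<lambda>r. r \<odot>\<^bsub>L\<^esub> \<one>\<^bsub>L\<^esub>) ` I \<subseteq> carrier L"
      using I.Icarr by (auto simp: smult_one one_mem)
    interpret J: ideal "Idl\<^bsub>L\<^esub> ((\<lambda>r. r \<odot>\<^bsub>L\<^esub> \<one>\<^bsub>L\<^esub>) ` I)" L
      by (rule L.genideal_ideal[OF sub])
    have "x = fraction A T \<one> t \<otimes>\<^bsub>L\<^esub> (i \<odot>\<^bsub>L\<^esub> \<one>\<^bsub>L\<^esub>)"
      using i I.Icarr by (simp add: smult_one localization_mult one_mem mem_carrier)
    moreover have "i \<odot>\<^bsub>L\<^esub> \<one>\<^bsub>L\<^esub> \<in> Idl\<^bsub>L\<^esub> ((\<lambda>r. r \<odot>\<^bsub>L\<^esub> \<one>\<^bsub>L\<^esub>) ` I)"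
      using L.genideal_self[OF sub] i(1) by blast
    ultimately show ?thesis
      using i by (simp add: J.I_l_closed)
  qed
qed

end

proposition localization_spline_ring:
  assumes T: "multiplicative_subset R T" and G: "edge_labeled_graph R G"
  shows "algebras_isomorphic (localization R T)
    (localization (spline_ring R G) (diag G ` T))
    (spline_ring (localization R T) (base_change_graph (localization R T) G))
    (localization_map (spline_ring R G) (diag G ` T) (diag G))
    (diag (base_change_graph (localization R T) G))"
proof -
  interpret R: multiplicative_subset R T by (rule T)
  interpret G: spline_graph R G by unfold_locales (rule G)
  let ?T = "diag G ` T" and ?RG = "spline_ring R G" and ?L = "localization R T"
  let ?GL = "base_change_graph ?L G" and ?LG = "localization (spline_ring R G) (diag G ` T)"
  interpret RG: cring ?RG by (rule G.spline_ring_cring)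
  have T': "multiplicative_subset ?RG ?T"
  proof (intro multiplicative_subset.intro RG.is_cring multiplicative_subset_axioms.intro)
    show "?T \<subseteq> carrier ?RG"
      using R.mem_carrier G.diag_spline by auto
    show "\<one>\<^bsub>?RG\<^esub> \<in> ?T"
      using R.one_mem by simp
    show "s \<otimes>\<^bsub>?RG\<^esub> t \<in> ?T" if "s \<in> ?T" "t \<in> ?T" for s t
    proof -
      obtain x y where "x \<in> T" "y \<in> T" "s = diag G x" "t = diag G y"
        using \<open>s \<in> ?T\<close> \<open>t \<in> ?T\<close> by auto
      then show ?thesis
        using ring_hom_mult[OF G.diag_hom, of x y] R.mem_carrier R.mult_mem by (metis imageI)
    qed
  qed
  interpret M: multiplicative_subset ?RG ?T by (rule T')
  interpret L: cring ?L by (rule R.localization_cring)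
  interpret GL: spline_graph ?L ?GL
    by (rule G.base_change_spline_graph[OF R.localization_cring])
      (simp add: R.localization_one R.localization_smult R.one_mem)
  \<comment> \<open>At each vertex, \<open>h\<close> is the localization of the evaluation
    \<open>s \<mapsto> s v\<close>, which sends \<open>diag G t\<close> back to \<open>t\<close>.
    Compatibility with the ring operations is therefore inherited from
    \<open>localization_map_hom\<close>.\<close>
  define h where "h = (\<lambda>X. \<lambda>v\<in>vertices G. localization_map R T (\<lambda>s. s v) X)"
  have ev: "localization_map R T (\<lambda>s. s v) \<in> ring_hom ?LG ?L" if "v \<in> G.V" for v
    using that by (intro localization_map_hom T' T G.evaluation_hom) auto
  have h_apply: "h (fraction ?RG ?T s (diag G t)) v = fraction R T (s v) t"
    if "s \<in> splines R G" "t \<in> T" "v \<in> G.V" for s t v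
    using that localization_map_fraction[OF T' T G.evaluation_hom[OF that(3)], of s "diag G t"]
    by (simp add: h_def image_subset_iff)
  have cases: "\<exists>s t. s \<in> splines R G \<and> t \<in> T \<and> X = fraction ?RG ?T s (diag G t)"
    if X: "X \<in> carrier ?LG" for X
    using X by (rule M.localization_cases) auto
  have h_closed: "h X \<in> splines ?L ?GL" if X0: "X \<in> carrier ?LG" for X
  proof -
    obtain s t where X: "s \<in> splines R G" "t \<in> T" "X = fraction ?RG ?T s (diag G t)"
      using cases[OF X0] by blast
    have "(\<lambda>v\<in>vertices ?GL. fraction R T (s v) t) \<in> splines ?L ?GL"
    proof (rule GL.restrict_splineI)
      fix e u v assume e: "e \<in> edges ?GL" "ends ?GL e = {u, v}"
        and uv: "u \<in> vertices ?GL" "v \<in> vertices ?GL"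
      then have e': "e \<in> G.E" "ends G e = {u, v}" "u \<in> G.V" "v \<in> G.V"
        by auto
      interpret I: ideal "label G e" R
        by (rule G.label_ideal[OF e'(1)])
      have "s u \<otimes>\<^bsub>R\<^esub> t \<ominus>\<^bsub>R\<^esub> s v \<otimes>\<^bsub>R\<^esub> t = (s u \<ominus>\<^bsub>R\<^esub> s v) \<otimes>\<^bsub>R\<^esub> t"
        using X e' R.mem_carrier by (simp add: a_minus_def R.l_distr R.l_minus)
      also have "\<dots> \<in> label G e"
        using G.spline_edge[OF X(1) e'(1,2)] X(2) R.mem_carrier by (simp add: I.I_r_closed)
      finally have "s u \<otimes>\<^bsub>R\<^esub> t \<ominus>\<^bsub>R\<^esub> s v \<otimes>\<^bsub>R\<^esub> t \<in> label G e" .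
      moreover have "fraction R T (s u) t \<ominus>\<^bsub>?L\<^esub> fraction R T (s v) t =
          fraction R T (s u \<otimes>\<^bsub>R\<^esub> t \<ominus>\<^bsub>R\<^esub> s v \<otimes>\<^bsub>R\<^esub> t) (t \<otimes>\<^bsub>R\<^esub> t)"
        using X e' by (intro R.localization_minus) auto
      ultimately show "fraction R T (s u) t \<ominus>\<^bsub>?L\<^esub> fraction R T (s v) t \<in> label ?GL e"
        using R.mult_mem[OF X(2) X(2)]
        by (simp only: base_change_graph_simps R.mem_Idl_localization[OF G.label_ideal[OF e'(1)]])
          blast
    qed (use X in simp)
    moreover have "h X = (\<lambda>v\<in>vertices ?GL. fraction R T (s v) t)"
    proof
      show "h X v = (\<lambda>v\<in>vertices ?GL. fraction R T (s v) t) v" for v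
        using h_apply[OF X(1,2), of v] X(3) by (cases "v \<in> G.V") (auto simp: h_def)
    qed
    ultimately show ?thesis
      by simp
  qed
  have inj: "X = Y" if X0: "X \<in> carrier ?LG" and Y0: "Y \<in> carrier ?LG" and eq: "h X = h Y" for X Y
  proof -
    obtain s t where X: "s \<in> splines R G" "t \<in> T" "X = fraction ?RG ?T s (diag G t)"
      using cases[OF X0] by blast
    obtain s' t' where Y: "s' \<in> splines R G" "t' \<in> T" "Y = fraction ?RG ?T s' (diag G t')"
      using cases[OF Y0] by blast
    have "\<exists>w\<in>T. w \<otimes>\<^bsub>R\<^esub> (s v \<otimes>\<^bsub>R\<^esub> t') = w \<otimes>\<^bsub>R\<^esub> (s' v \<otimes>\<^bsub>R\<^esub> t)" if v: "v \<in> G.V" for v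
    proof -
      have "fraction R T (s v) t = fraction R T (s' v) t'"
        using fun_cong[OF eq, of v] h_apply[OF X(1,2) v] h_apply[OF Y(1,2) v] X(3) Y(3) by simp
      then show ?thesis
        using X Y v by (subst (asm) R.fraction_eq_iff) auto
    qed
    \<comment> \<open>Equality at each vertex comes with its own witness \<open>w v\<close>. A
      common multiple \<open>p\<close> of these works at all vertices, so \<open>diag G p\<close>
      witnesses equality of the two fractions of splines.\<close>
    then obtain w where w: "\<And>v. v \<in> G.V \<Longrightarrow>
        w v \<in> T \<and> w v \<otimes>\<^bsub>R\<^esub> (s v \<otimes>\<^bsub>R\<^esub> t') = w v \<otimes>\<^bsub>R\<^esub> (s' v \<otimes>\<^bsub>R\<^esub> t)"
      by metis
    then obtain p c where p: "p \<in> T" "\<And>v. v \<in> G.V \<Longrightarrow> c v \<in> carrier R \<and> p = c v \<otimes>\<^bsub>R\<^esub> w v"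
      using R.common_multiple[OF G.finite_V, of w] by metis
    have "p \<otimes>\<^bsub>R\<^esub> (s v \<otimes>\<^bsub>R\<^esub> t') = p \<otimes>\<^bsub>R\<^esub> (s' v \<otimes>\<^bsub>R\<^esub> t)" if v: "v \<in> G.V" for v
      using w[OF v] p(2)[OF v] X Y v R.mem_carrier by (simp add: R.m_assoc)
    then have "diag G p \<otimes>\<^bsub>?RG\<^esub> (s \<otimes>\<^bsub>?RG\<^esub> diag G t') = diag G p \<otimes>\<^bsub>?RG\<^esub> (s' \<otimes>\<^bsub>?RG\<^esub> diag G t)"
      by (auto intro!: restrict_ext)
    then show ?thesis
      using X Y p(1) by (simp only: X(3) Y(3)) (subst M.fraction_eq_iff; auto)
  qed
  have surj: "\<exists>X\<in>carrier ?LG. h X = y" if y: "y \<in> splines ?L ?GL" for y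
  proof -
    have "\<exists>a\<in>carrier R. \<exists>t\<in>T. y v = fraction R T a t" if "v \<in> G.V" for v
      using GL.spline_closed[OF y, of v] that by (simp add: R.localization_carrier) blast
    then obtain a d where ad: "\<And>v. v \<in> G.V \<Longrightarrow> a v \<in> carrier R \<and> d v \<in> T \<and> y v = fraction R T (a v) (d v)"
      by metis
    then obtain p c where p: "p \<in> T" "\<And>v. v \<in> G.V \<Longrightarrow> c v \<in> carrier R \<and> p = c v \<otimes>\<^bsub>R\<^esub> d v"
      using R.common_multiple[OF G.finite_V, of d] by metis
    \<comment> \<open>The numerators of \<open>y\<close> over the common denominator
      \<open>p\<close>.\<close>
    define b where "b v = c v \<otimes>\<^bsub>R\<^esub> a v" for v
    have b: "b v \<in> carrier R" "y v = fraction R T (b v) p" if "v \<in> G.V" for v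
    proof -
      show "b v \<in> carrier R"
        using ad[OF that] p(2)[OF that] by (simp add: b_def)
      have "a v \<otimes>\<^bsub>R\<^esub> p = b v \<otimes>\<^bsub>R\<^esub> d v"
        using ad[OF that] p(2)[OF that] R.mem_carrier by (simp add: b_def R.m_ac)
      then show "y v = fraction R T (b v) p"
        using ad[OF that] R.fraction_eq[OF _ \<open>b v \<in> carrier R\<close> _ p(1)] by simp
    qed
    \<comment> \<open>The numerators \<open>b\<close> need not form a spline over \<open>R\<close>:
      that \<open>y u - y v\<close> lies in the extended label only puts some multiple of
      \<open>b u - b v\<close> into the label itself.\<close>
    have "\<exists>w\<in>T. \<exists>u v. ends G e = {u, v} \<and> w \<otimes>\<^bsub>R\<^esub> (b u \<ominus>\<^bsub>R\<^esub> b v) \<in> label G e" if e: "e \<in> G.E" for e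
    proof -
      obtain u v where uv: "u \<in> G.V" "v \<in> G.V" "ends G e = {u, v}"
        using G.edge_cases[OF e] .
      interpret I: ideal "label G e" R
        by (rule G.label_ideal[OF e])
      have "y u \<ominus>\<^bsub>?L\<^esub> y v \<in> label ?GL e"
        using GL.spline_edge[OF y] e uv by simp
      then obtain i t where i: "i \<in> label G e" "t \<in> T" "y u \<ominus>\<^bsub>?L\<^esub> y v = fraction R T i t"
        by (auto simp: R.mem_Idl_localization[OF G.label_ideal[OF e]])
      have "y u \<ominus>\<^bsub>?L\<^esub> y v = fraction R T (b u \<otimes>\<^bsub>R\<^esub> p \<ominus>\<^bsub>R\<^esub> b v \<otimes>\<^bsub>R\<^esub> p) (p \<otimes>\<^bsub>R\<^esub> p)"
        unfolding b(2)[OF uv(1)] b(2)[OF uv(2)] using b(1) uv p(1) by (intro R.localization_minus) auto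
      moreover have "b u \<otimes>\<^bsub>R\<^esub> p \<ominus>\<^bsub>R\<^esub> b v \<otimes>\<^bsub>R\<^esub> p = (b u \<ominus>\<^bsub>R\<^esub> b v) \<otimes>\<^bsub>R\<^esub> p"
        using b(1) uv p(1) R.mem_carrier by (simp add: a_minus_def R.l_distr R.l_minus)
      ultimately have "fraction R T ((b u \<ominus>\<^bsub>R\<^esub> b v) \<otimes>\<^bsub>R\<^esub> p) (p \<otimes>\<^bsub>R\<^esub> p) = fraction R T i t"
        using i(3) by simp
      then obtain w where w: "w \<in> T" "w \<otimes>\<^bsub>R\<^esub> ((b u \<ominus>\<^bsub>R\<^esub> b v) \<otimes>\<^bsub>R\<^esub> p \<otimes>\<^bsub>R\<^esub> t) = w \<otimes>\<^bsub>R\<^esub> (i \<otimes>\<^bsub>R\<^esub> (p \<otimes>\<^bsub>R\<^esub> p))"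
        using i(1,2) I.Icarr b(1) uv p(1) R.mult_mem R.mem_carrier
        by (subst (asm) R.fraction_eq_iff) auto
      have "(w \<otimes>\<^bsub>R\<^esub> (p \<otimes>\<^bsub>R\<^esub> t)) \<otimes>\<^bsub>R\<^esub> (b u \<ominus>\<^bsub>R\<^esub> b v) = w \<otimes>\<^bsub>R\<^esub> ((b u \<ominus>\<^bsub>R\<^esub> b v) \<otimes>\<^bsub>R\<^esub> p \<otimes>\<^bsub>R\<^esub> t)"
        using w(1) p(1) i(2) b(1) uv R.mem_carrier by (simp add: R.m_ac)
      also have "\<dots> \<in> label G e"
        unfolding w(2) using w(1) p(1) i(1) R.mem_carrier
        by (simp add: I.I_l_closed I.I_r_closed)
      finally have "(w \<otimes>\<^bsub>R\<^esub> (p \<otimes>\<^bsub>R\<^esub> t)) \<otimes>\<^bsub>R\<^esub> (b u \<ominus>\<^bsub>R\<^esub> b v) \<in> label G e" .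
      then show ?thesis
        using w(1) p(1) i(2) R.mult_mem uv(3) by (intro bexI[of _ "w \<otimes>\<^bsub>R\<^esub> (p \<otimes>\<^bsub>R\<^esub> t)"]) auto
    qed
    then obtain w where w: "\<And>e. e \<in> G.E \<Longrightarrow>
        w e \<in> T \<and> (\<exists>u v. ends G e = {u, v} \<and> w e \<otimes>\<^bsub>R\<^esub> (b u \<ominus>\<^bsub>R\<^esub> b v) \<in> label G e)"
      by metis
    then obtain q c' where q: "q \<in> T" "\<And>e. e \<in> G.E \<Longrightarrow> c' e \<in> carrier R \<and> q = c' e \<otimes>\<^bsub>R\<^esub> w e"
      using R.common_multiple[OF G.finite_E, of w] by metis
    \<comment> \<open>Scaling by a common multiple \<open>q\<close> of all the \<open>w e\<close>
      repairs every edge at once; the denominator is enlarged to \<open>q \<otimes> p\<close> to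
      compensate.\<close>
    define s where "s = (\<lambda>v\<in>G.V. q \<otimes>\<^bsub>R\<^esub> b v)"
    have s: "s \<in> splines R G"
    proof (rule G.splineI_orientation)
      show "s \<in> G.V \<rightarrow>\<^sub>E carrier R"
        using b(1) q(1) R.mem_carrier by (auto simp: s_def)
      fix e assume e: "e \<in> G.E"
      then obtain u v where uv: "ends G e = {u, v}" "w e \<otimes>\<^bsub>R\<^esub> (b u \<ominus>\<^bsub>R\<^esub> b v) \<in> label G e"
        using w by blast
      interpret I: ideal "label G e" R
        by (rule G.label_ideal[OF e])
      have V: "u \<in> G.V" "v \<in> G.V"
        using G.ends_in_V[OF e uv(1)] by auto
      have "s u \<ominus>\<^bsub>R\<^esub> s v = q \<otimes>\<^bsub>R\<^esub> (b u \<ominus>\<^bsub>R\<^esub> b v)"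
        using V b(1) q(1) R.mem_carrier by (simp add: s_def a_minus_def R.r_distr R.r_minus)
      also have "\<dots> = c' e \<otimes>\<^bsub>R\<^esub> (w e \<otimes>\<^bsub>R\<^esub> (b u \<ominus>\<^bsub>R\<^esub> b v))"
        using q(2)[OF e] w[OF e] V b(1) R.mem_carrier by (simp add: R.m_assoc)
      also have "\<dots> \<in> label G e"
        using q(2)[OF e] uv(2) by (simp add: I.I_l_closed)
      finally show "\<exists>u v. ends G e = {u, v} \<and> s u \<ominus>\<^bsub>R\<^esub> s v \<in> label G e"
        using uv(1) by blast
    qed
    have qp: "q \<otimes>\<^bsub>R\<^esub> p \<in> T"
      using q(1) p(1) R.mult_mem by simp
    have X: "fraction ?RG ?T s (diag G (q \<otimes>\<^bsub>R\<^esub> p)) \<in> carrier ?LG"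
      using s qp by simp
    have "h (fraction ?RG ?T s (diag G (q \<otimes>\<^bsub>R\<^esub> p))) = y"
    proof (rule GL.spline_eqI[OF h_closed[OF X] y])
      fix v assume "v \<in> vertices ?GL"
      then have v: "v \<in> G.V"
        by simp
      then show "h (fraction ?RG ?T s (diag G (q \<otimes>\<^bsub>R\<^esub> p))) v = y v"
        using h_apply[OF s qp v] b[OF v] q(1) p(1) by (simp add: s_def R.fraction_cancel)
    qed
    then show ?thesis
      using X by blast
  qed
  have "h \<in> ring_iso ?LG (spline_ring ?L ?GL)"
  proof (rule ring_iso_memI)
    show "bij_betw h (carrier ?LG) (carrier (spline_ring ?L ?GL))"
      unfolding bij_betw_def
    proof
      show "inj_on h (carrier ?LG)"
        using inj by (rule inj_onI)
      show "h ` carrier ?LG = carrier (spline_ring ?L ?GL)"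
        using surj h_closed by fastforce
    qed
    show "h x \<in> carrier (spline_ring ?L ?GL)" if "x \<in> carrier ?LG" for x
      using h_closed[OF that] by simp
    fix x y assume "x \<in> carrier ?LG" "y \<in> carrier ?LG"
    then show "h (x \<otimes>\<^bsub>?LG\<^esub> y) = h x \<otimes>\<^bsub>spline_ring ?L ?GL\<^esub> h y"
      "h (x \<oplus>\<^bsub>?LG\<^esub> y) = h x \<oplus>\<^bsub>spline_ring ?L ?GL\<^esub> h y"
      using ring_hom_mult[OF ev] ring_hom_add[OF ev] by (simp_all add: h_def cong: restrict_cong)
  next
    show "h \<one>\<^bsub>?LG\<^esub> = \<one>\<^bsub>spline_ring ?L ?GL\<^esub>"
      using ring_hom_one[OF ev] by (simp add: h_def diag_def cong: restrict_cong)
  qed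
  moreover have "h (localization_map ?RG ?T (diag G) x) = diag ?GL x" if x: "x \<in> carrier ?L" for x
  proof -
    obtain r t where r: "r \<in> carrier R" "t \<in> T" "x = fraction R T r t"
      using x by (rule R.localization_cases)
    have *: "localization_map ?RG ?T (diag G) x = fraction ?RG ?T (diag G r) (diag G t)"
      unfolding r(3) using r by (intro localization_map_fraction T T' G.diag_hom) auto
    have "fraction ?RG ?T (diag G r) (diag G t) \<in> carrier ?LG"
      using r G.diag_spline by simp
    then show ?thesis
      unfolding * using r G.diag_spline GL.diag_spline[OF x] h_apply
      by (intro GL.spline_eqI h_closed) auto
  qed
  ultimately show ?thesis
    unfolding algebras_isomorphic_def by blast
qed

section \<open>Tensor products\<close>

lemma keys_frag_extend_subset:
  assumes "Poly_Mapping.keys c \<subseteq> S" "\<And>p. p \<in> S \<Longrightarrow> Poly_Mapping.keys (\<phi> p) \<subseteq> S'"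
  shows "Poly_Mapping.keys (frag_extend \<phi> c) \<subseteq> S'"
  using keys_frag_extend[of \<phi> c] assms by blast

locale tensor_factors = M: module R M + N: module R N for R and M and N
begin

abbreviation F where "F \<equiv> tensor_free M N"
abbreviation H where "H \<equiv> generate F (tensor_rels R M N)"
abbreviation keys_ok where "keys_ok c \<equiv> Poly_Mapping.keys c \<subseteq> carrier M \<times> carrier N"
abbreviation cls where "cls \<equiv> tensor_class R M N"
abbreviation pure where "pure \<equiv> pure_tensor R M N"
abbreviation MN where "MN \<equiv> tensor R M N"

lemma free_simps:
  "c \<in> carrier F \<longleftrightarrow> keys_ok c" "c \<otimes>\<^bsub>F\<^esub> d = c + d" "\<one>\<^bsub>F\<^esub> = 0"
  by (simp_all add: tensor_free_def)

lemma keys_ok_intros: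
  "keys_ok 0" "keys_ok c \<Longrightarrow> keys_ok d \<Longrightarrow> keys_ok (c + d)"
  "keys_ok c \<Longrightarrow> keys_ok d \<Longrightarrow> keys_ok (c - d)" "keys_ok c \<Longrightarrow> keys_ok (- c)"
  "x \<in> carrier M \<Longrightarrow> y \<in> carrier N \<Longrightarrow> keys_ok (frag_of (x, y))"
  using keys_add[of c d] keys_diff[of c d] by auto

lemma tensor_rels_cases [consumes 1, case_names add_left add_right smult]:
  assumes "c \<in> tensor_rels R M N"
  obtains x x' y where "x \<in> carrier M" "x' \<in> carrier M" "y \<in> carrier N"
      "c = frag_of (x \<oplus>\<^bsub>M\<^esub> x', y) - frag_of (x, y) - frag_of (x', y)"
    | x y y' where "x \<in> carrier M" "y \<in> carrier N" "y' \<in> carrier N"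
      "c = frag_of (x, y \<oplus>\<^bsub>N\<^esub> y') - frag_of (x, y) - frag_of (x, y')"
    | r x y where "r \<in> carrier R" "x \<in> carrier M" "y \<in> carrier N"
      "c = frag_of (r \<odot>\<^bsub>M\<^esub> x, y) - frag_of (x, r \<odot>\<^bsub>N\<^esub> y)"
  using assms unfolding tensor_rels_def Un_iff mem_Collect_eq by (elim disjE exE conjE)

lemma rels_closed: "tensor_rels R M N \<subseteq> carrier F"
proof
  fix c assume "c \<in> tensor_rels R M N"
  then show "c \<in> carrier F"
    by (cases rule: tensor_rels_cases) (simp_all only: free_simps, (intro keys_ok_intros; simp)+)
qed

lemma subgroup_H: "subgroup H F"
  using group.generate_is_subgroup[OF _ rels_closed] by (simp add: tensor_free_def)

lemma H_closed: "c \<in> H \<Longrightarrow> keys_ok c"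
  using subgroup.mem_carrier[OF subgroup_H] by (simp add: free_simps)

lemma H_zero: "0 \<in> H"
  using subgroup.one_closed[OF subgroup_H] by (simp add: free_simps)

lemma H_add: "\<lbrakk>c \<in> H; d \<in> H\<rbrakk> \<Longrightarrow> c + d \<in> H"
  using subgroup.m_closed[OF subgroup_H] by (simp add: free_simps)

lemma H_uminus: "c \<in> H \<Longrightarrow> - c \<in> H"
  using subgroup.m_inv_closed[OF subgroup_H, of c] H_closed[of c] by (simp add: tensor_free_def)

lemma H_diff: "\<lbrakk>c \<in> H; d \<in> H\<rbrakk> \<Longrightarrow> c - d \<in> H"
  using H_add[OF _ H_uminus, of c d] by simp

lemma H_rel: "c \<in> tensor_rels R M N \<Longrightarrow> c \<in> H"
  by (rule generate.incl)

lemma H_add_left: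
  assumes "x \<in> carrier M" "x' \<in> carrier M" "y \<in> carrier N"
  shows "frag_of (x \<oplus>\<^bsub>M\<^esub> x', y) - frag_of (x, y) - frag_of (x', y) \<in> H"
  using assms by (intro H_rel) (auto simp: tensor_rels_def)

lemma H_add_right:
  assumes "x \<in> carrier M" "y \<in> carrier N" "y' \<in> carrier N"
  shows "frag_of (x, y \<oplus>\<^bsub>N\<^esub> y') - frag_of (x, y) - frag_of (x, y') \<in> H"
  using assms by (intro H_rel) (auto simp: tensor_rels_def)

lemma H_smult:
  assumes "r \<in> carrier R" "x \<in> carrier M" "y \<in> carrier N"
  shows "frag_of (r \<odot>\<^bsub>M\<^esub> x, y) - frag_of (x, r \<odot>\<^bsub>N\<^esub> y) \<in> H"
  using assms by (intro H_rel) (auto simp: tensor_rels_def)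

lemma mem_cls: "d \<in> cls c \<longleftrightarrow> d - c \<in> H"
  by (force simp: tensor_class_def r_coset_def free_simps)

lemma cls_eqI: "d - c \<in> H \<Longrightarrow> cls d = cls c"
proof -
  assume *: "d - c \<in> H"
  have "x - d \<in> H \<longleftrightarrow> x - c \<in> H" for x
    using H_add[OF _ *, of "x - d"] H_diff[OF _ *, of "x - c"] by auto
  then show "cls d = cls c"
    by (auto simp: mem_cls)
qed

lemma cls_eq_iff: "cls d = cls c \<longleftrightarrow> d - c \<in> H"
  using cls_eqI[of d c] mem_cls[of d d] mem_cls[of d c] H_zero by auto

lemma UN_cls: "(\<And>d. d - c \<in> H \<Longrightarrow> f d = X) \<Longrightarrow> (\<Union>d\<in>cls c. f d) = X"
  by (rule UN_constant_eq[of c]) (auto simp: mem_cls H_zero)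

lemma carrier_tensor: "carrier MN = {cls c | c. keys_ok c}"
  by (auto simp: tensor_def FactGroup_def RCOSETS_def Let_def tensor_class_def free_simps)

lemma cls_closed [simp]: "keys_ok c \<Longrightarrow> cls c \<in> carrier MN"
  by (auto simp: carrier_tensor)

lemma normal_H: "H \<lhd> F"
  using subgroup_H unfolding tensor_free_def
  by (simp add: comm_group.normal_iff_subgroup[OF abelian_free_Abelian_group])

lemma cls_add: "\<lbrakk>keys_ok c; keys_ok d\<rbrakk> \<Longrightarrow> cls c \<oplus>\<^bsub>MN\<^esub> cls d = cls (c + d)"
  using normal.rcos_sum[OF normal_H, of c d]
  by (simp add: tensor_def FactGroup_def Let_def tensor_class_def free_simps)

lemma tensor_zero: "\<zero>\<^bsub>MN\<^esub> = cls 0"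
  by (simp add: tensor_def FactGroup_def Let_def tensor_class_def r_coset_def free_simps)

lemma tensor_abelian_group: "abelian_group MN"
proof (rule abelian_groupI)
  fix X assume "X \<in> carrier MN"
  then obtain c where c: "keys_ok c" "X = cls c"
    by (auto simp: carrier_tensor)
  then have "cls (- c) \<oplus>\<^bsub>MN\<^esub> X = \<zero>\<^bsub>MN\<^esub>"
    by (simp add: cls_add keys_ok_intros(4) tensor_zero)
  then show "\<exists>Y\<in>carrier MN. Y \<oplus>\<^bsub>MN\<^esub> X = \<zero>\<^bsub>MN\<^esub>"
    using c(1) by (intro bexI[of _ "cls (- c)"] cls_closed keys_ok_intros)
next
  fix X Y assume "X \<in> carrier MN" "Y \<in> carrier MN"
  then obtain c d where "keys_ok c" "X = cls c" "keys_ok d" "Y = cls d"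
    by (auto simp: carrier_tensor)
  then show "X \<oplus>\<^bsub>MN\<^esub> Y \<in> carrier MN"
    by (simp add: cls_add keys_ok_intros(2))
qed (auto simp: carrier_tensor cls_add keys_ok_intros tensor_zero algebra_simps)

sublocale tensor: abelian_group MN
  by (rule tensor_abelian_group)

lemma cls_uminus: "keys_ok c \<Longrightarrow> \<ominus>\<^bsub>MN\<^esub> cls c = cls (- c)"
  by (rule tensor.minus_equality) (auto simp: cls_add keys_ok_intros tensor_zero)

lemma cls_diff: "\<lbrakk>keys_ok c; keys_ok d\<rbrakk> \<Longrightarrow> cls (c - d) = cls c \<ominus>\<^bsub>MN\<^esub> cls d"
  by (simp add: a_minus_def cls_uminus cls_add keys_ok_intros)

lemma pure_closed [simp]: "\<lbrakk>x \<in> carrier M; y \<in> carrier N\<rbrakk> \<Longrightarrow> pure x y \<in> carrier MN"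
  by (simp add: pure_tensor_def)

lemma pure_add_left:
  assumes "x \<in> carrier M" "x' \<in> carrier M" "y \<in> carrier N"
  shows "pure (x \<oplus>\<^bsub>M\<^esub> x') y = pure x y \<oplus>\<^bsub>MN\<^esub> pure x' y"
  using H_add_left[OF assms] assms by (simp add: pure_tensor_def cls_add cls_eq_iff algebra_simps)

lemma pure_add_right:
  assumes "x \<in> carrier M" "y \<in> carrier N" "y' \<in> carrier N"
  shows "pure x (y \<oplus>\<^bsub>N\<^esub> y') = pure x y \<oplus>\<^bsub>MN\<^esub> pure x y'"
  using H_add_right[OF assms] assms by (simp add: pure_tensor_def cls_add cls_eq_iff algebra_simps)

lemma pure_balanced:
  assumes "r \<in> carrier R" "x \<in> carrier M" "y \<in> carrier N"
  shows "pure (r \<odot>\<^bsub>M\<^esub> x) y = pure x (r \<odot>\<^bsub>N\<^esub> y)"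
  using H_smult[OF assms] by (simp add: pure_tensor_def cls_eq_iff)

lemma pure_zero_left:
  assumes "y \<in> carrier N"
  shows "pure \<zero>\<^bsub>M\<^esub> y = \<zero>\<^bsub>MN\<^esub>"
proof -
  have "pure \<zero>\<^bsub>M\<^esub> y \<oplus>\<^bsub>MN\<^esub> pure \<zero>\<^bsub>M\<^esub> y = pure \<zero>\<^bsub>M\<^esub> y"
    using pure_add_left[of "\<zero>\<^bsub>M\<^esub>" "\<zero>\<^bsub>M\<^esub>" y] assms by simp
  then show ?thesis
    using assms tensor.add.r_cancel_one[of "pure \<zero>\<^bsub>M\<^esub> y" "pure \<zero>\<^bsub>M\<^esub> y"] by simp
qed

lemma pure_zero_right:
  assumes "x \<in> carrier M"
  shows "pure x \<zero>\<^bsub>N\<^esub> = \<zero>\<^bsub>MN\<^esub>"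
  using pure_balanced[of "\<zero>\<^bsub>R\<^esub>" x "\<zero>\<^bsub>N\<^esub>"] assms pure_zero_left by simp

lemma pure_uminus_left:
  assumes "x \<in> carrier M" "y \<in> carrier N"
  shows "pure (\<ominus>\<^bsub>M\<^esub> x) y = \<ominus>\<^bsub>MN\<^esub> pure x y"
  using pure_add_left[of "\<ominus>\<^bsub>M\<^esub> x" x y] assms
  by (intro tensor.minus_equality[symmetric]) (simp_all add: M.M.l_neg pure_zero_left)

lemma tensor_induct [consumes 1, case_names zero pure add]:
  assumes X: "X \<in> carrier MN"
    and zero: "P \<zero>\<^bsub>MN\<^esub>"
    and pure: "\<And>x y. \<lbrakk>x \<in> carrier M; y \<in> carrier N\<rbrakk> \<Longrightarrow> P (pure x y)"
    and add: "\<And>X Y. \<lbrakk>X \<in> carrier MN; Y \<in> carrier MN; P X; P Y\<rbrakk> \<Longrightarrow> P (X \<oplus>\<^bsub>MN\<^esub> Y)"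
  shows "P X"
proof -
  obtain c where c: "keys_ok c" "X = cls c"
    using X by (auto simp: carrier_tensor)
  \<comment> \<open>The claim is strengthened by the negative because induction on the free abelian
    group proceeds by differences. The negative of a pure tensor is again pure, so
    \<open>tensor_induct\<close> gets by with sums.\<close>
  have "P (cls c) \<and> P (\<ominus>\<^bsub>MN\<^esub> cls c)"
    using c(1)
  proof (induction c rule: free_Abelian_group_induct[consumes 1, case_names zero diff frag])
    case zero
    show ?case
      using assms(2) by (simp add: tensor_zero cls_uminus)
  next
    case (diff c d)
    then show ?case
      by (simp add: cls_diff a_minus_def tensor.minus_add add)
  next
    case (frag p)
    then show ?case
      using pure pure_uminus_left[symmetric] by (auto simp: pure_tensor_def[symmetric])
  qed
  then show ?thesis
    using c(2) by simp
qed

lemma H_induct [consumes 1, case_names zero rel uminus add]: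
  assumes "c \<in> H"
    and "P 0" and "\<And>c. c \<in> tensor_rels R M N \<Longrightarrow> P c"
    and "\<And>c. \<lbrakk>c \<in> H; P c\<rbrakk> \<Longrightarrow> P (- c)"
    and "\<And>c d. \<lbrakk>c \<in> H; d \<in> H; P c; P d\<rbrakk> \<Longrightarrow> P (c + d)"
  shows "P c"
  using assms(1)
proof (induction rule: generate.induct)
  case (inv c)
  moreover have "inv\<^bsub>F\<^esub> c = - c"
    using rels_closed inv by (auto simp: tensor_free_def)
  ultimately show ?case
    using assms(3,4) H_rel by simp
qed (use assms in \<open>auto simp: free_simps\<close>)

text \<open>The universal property of the tensor product. The extension of \<open>b\<close> to
  formal sums kills the relations, hence the subgroup \<open>H\<close> that they generate, and so it
  is constant on cosets.\<close>

lemma tensor_lift: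
  fixes A (structure)
  assumes A: "abelian_group A"
    and closed: "\<And>x y. \<lbrakk>x \<in> carrier M; y \<in> carrier N\<rbrakk> \<Longrightarrow> b x y \<in> carrier A"
    and add_left: "\<And>x x' y. \<lbrakk>x \<in> carrier M; x' \<in> carrier M; y \<in> carrier N\<rbrakk> \<Longrightarrow>
      b (x \<oplus>\<^bsub>M\<^esub> x') y = b x y \<oplus> b x' y"
    and add_right: "\<And>x y y'. \<lbrakk>x \<in> carrier M; y \<in> carrier N; y' \<in> carrier N\<rbrakk> \<Longrightarrow>
      b x (y \<oplus>\<^bsub>N\<^esub> y') = b x y \<oplus> b x y'"
    and balanced: "\<And>r x y. \<lbrakk>r \<in> carrier R; x \<in> carrier M; y \<in> carrier N\<rbrakk> \<Longrightarrow>
      b (r \<odot>\<^bsub>M\<^esub> x) y = b x (r \<odot>\<^bsub>N\<^esub> y)"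
  obtains g where "\<And>X. X \<in> carrier MN \<Longrightarrow> g X \<in> carrier A"
    "\<And>X Y. \<lbrakk>X \<in> carrier MN; Y \<in> carrier MN\<rbrakk> \<Longrightarrow> g (X \<oplus>\<^bsub>MN\<^esub> Y) = g X \<oplus> g Y"
    "\<And>x y. \<lbrakk>x \<in> carrier M; y \<in> carrier N\<rbrakk> \<Longrightarrow> g (pure x y) = b x y"
proof -
  interpret A: abelian_group A by fact
  have "case_prod b ` (carrier M \<times> carrier N) \<subseteq> carrier (add_monoid A)"
    using closed by auto
  then obtain h where h: "h \<in> hom F (add_monoid A)"
    and h_of: "\<And>p. p \<in> carrier M \<times> carrier N \<Longrightarrow> h (frag_of p) = case_prod b p"
    using comm_group.free_Abelian_group_universal[OF A.a_comm_group, of "case_prod b" "carrier M \<times> carrier N"]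
    unfolding tensor_free_def by blast
  have h_closed: "h c \<in> carrier A" if "keys_ok c" for c
    using h that by (auto simp: hom_def free_simps)
  have h_add: "h (c + d) = h c \<oplus> h d" if "keys_ok c" "keys_ok d" for c d
    using h that by (auto simp: hom_def free_simps)
  have h_zero: "h 0 = \<zero>"
    using h_add[of 0 0] h_closed[of 0] by (simp add: keys_ok_intros)
  have h_uminus: "h (- c) = \<ominus> h c" if "keys_ok c" for c
    using h_add[of "- c" c] h_closed that h_zero
    by (intro A.minus_equality[symmetric]) (simp_all add: keys_ok_intros)
  have h_diff: "h (c - d) = h c \<ominus> h d" if "keys_ok c" "keys_ok d" for c d
    using h_add[of c "- d"] h_uminus that by (simp add: a_minus_def keys_ok_intros)
  have rels: "h c = \<zero>" if "c \<in> tensor_rels R M N" for c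
    using that
  proof (cases rule: tensor_rels_cases)
    case (add_left x x' y)
    then show ?thesis
      using assms(3) by (simp add: h_diff keys_ok_intros h_of closed a_minus_def A.r_neg A.a_ac)
  next
    case (add_right x y y')
    then show ?thesis
      using assms(4) by (simp add: h_diff keys_ok_intros h_of closed a_minus_def A.r_neg A.a_ac)
  next
    case (smult r x y)
    then show ?thesis
      by (simp add: h_diff keys_ok_intros h_of closed a_minus_def A.r_neg balanced)
  qed
  have h_H: "h c = \<zero>" if "c \<in> H" for c
    using that by (induction rule: H_induct) (auto simp: h_zero rels h_uminus h_add H_closed)
  \<comment> \<open>The chosen representative does not matter, because \<open>h\<close> vanishes on
    \<open>H\<close>.\<close>
  define g where "g X = h (SOME c. keys_ok c \<and> X = cls c)" for X
  have g: "g (cls c) = h c" if c: "keys_ok c" for c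
  proof -
    let ?d = "SOME d. keys_ok d \<and> cls c = cls d"
    have d: "keys_ok ?d \<and> cls c = cls ?d"
      by (rule someI[of _ c]) (use c in simp)
    then have "h c = h (c - ?d) \<oplus> h ?d"
      using h_add[of "c - ?d" ?d] c by (simp add: keys_ok_intros)
    also have "\<dots> = h ?d"
      using d h_H[of "c - ?d"] h_closed[of ?d] by (simp add: cls_eq_iff)
    finally show ?thesis
      by (simp add: g_def)
  qed
  show thesis
  proof
    show "g X \<in> carrier A" if "X \<in> carrier MN" for X
      using that h_closed g by (auto simp: carrier_tensor)
    show "g (X \<oplus>\<^bsub>MN\<^esub> Y) = g X \<oplus> g Y" if "X \<in> carrier MN" "Y \<in> carrier MN" for X Y
      using that by (auto simp: carrier_tensor cls_add g h_add keys_ok_intros)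
    show "g (pure x y) = b x y" if "x \<in> carrier M" "y \<in> carrier N" for x y
      using that by (simp add: pure_tensor_def g h_of)
  qed
qed

end

text \<open>A map \<open>frag_extend \<phi>\<close> is additive, so it has to be checked only on the
  relations. Functoriality and well-definedness of the product in each argument are
  instances.\<close>

lemma frag_extend_preserves_H:
  assumes "tensor_factors R M N" "tensor_factors R' M' N'"
    and "\<And>c. c \<in> tensor_rels R M N \<Longrightarrow>
      frag_extend \<phi> c \<in> generate (tensor_free M' N') (tensor_rels R' M' N')"
    and "c \<in> generate (tensor_free M N) (tensor_rels R M N)"
  shows "frag_extend \<phi> c \<in> generate (tensor_free M' N') (tensor_rels R' M' N')"
proof -
  interpret P: tensor_factors R M N by fact
  interpret P': tensor_factors R' M' N' by fact
  show ?thesis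
    using assms(4)
    by (induction rule: P.H_induct)
      (auto simp: P'.H_zero assms(3) frag_extend_minus frag_extend_add P'.H_uminus P'.H_add)
qed


subsection \<open>Functoriality\<close>

locale linear_tensor = P: tensor_factors R M N + P': tensor_factors R M' N for R M N M' +
  fixes f
  assumes linear: "linear_map R M M' f"
begin

lemma f_closed [simp]: "x \<in> carrier M \<Longrightarrow> f x \<in> carrier M'"
  and f_add: "\<lbrakk>x \<in> carrier M; y \<in> carrier M\<rbrakk> \<Longrightarrow> f (x \<oplus>\<^bsub>M\<^esub> y) = f x \<oplus>\<^bsub>M'\<^esub> f y"
  and f_smult: "\<lbrakk>r \<in> carrier R; x \<in> carrier M\<rbrakk> \<Longrightarrow> f (r \<odot>\<^bsub>M\<^esub> x) = r \<odot>\<^bsub>M'\<^esub> f x"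
  using linear by (auto simp: linear_map_def)

abbreviation ext where "ext \<equiv> frag_extend (\<lambda>(x, y). frag_of (f x, y))"
abbreviation fN where "fN \<equiv> tensor_map R M M' N f"

lemma ext_H: "c \<in> P.H \<Longrightarrow> ext c \<in> P'.H"
proof (rule frag_extend_preserves_H[OF P.tensor_factors_axioms P'.tensor_factors_axioms])
  fix c assume "c \<in> tensor_rels R M N"
  then show "ext c \<in> P'.H"
    by (cases rule: P.tensor_rels_cases)
      (simp_all add: frag_extend_diff f_add f_smult P'.H_add_left P'.H_add_right P'.H_smult)
qed

lemma ext_keys: "P.keys_ok c \<Longrightarrow> P'.keys_ok (ext c)"
  by (rule keys_frag_extend_subset) auto

lemma tensor_map_cls: "fN (P.cls c) = P'.cls (ext c)"
  unfolding tensor_map_def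
proof (rule P.UN_cls)
  fix d assume "d - c \<in> P.H"
  then show "P'.cls (ext d) = P'.cls (ext c)"
    using ext_H[of "d - c"] by (simp add: P'.cls_eq_iff frag_extend_diff)
qed

lemma tensor_map_closed [simp]: "X \<in> carrier P.MN \<Longrightarrow> fN X \<in> carrier P'.MN"
  by (auto simp: P.carrier_tensor tensor_map_cls ext_keys)

lemma tensor_map_add:
  "\<lbrakk>X \<in> carrier P.MN; Y \<in> carrier P.MN\<rbrakk> \<Longrightarrow> fN (X \<oplus>\<^bsub>P.MN\<^esub> Y) = fN X \<oplus>\<^bsub>P'.MN\<^esub> fN Y"
  by (auto simp: P.carrier_tensor tensor_map_cls ext_keys P.cls_add P'.cls_add frag_extend_add)

lemma tensor_map_zero: "fN \<zero>\<^bsub>P.MN\<^esub> = \<zero>\<^bsub>P'.MN\<^esub>"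
  by (simp add: P.tensor_zero P'.tensor_zero tensor_map_cls)

lemma tensor_map_pure: "fN (P.pure x y) = P'.pure (f x) y"
  by (simp add: pure_tensor_def tensor_map_cls)

lemma tensor_map_uminus: "X \<in> carrier P.MN \<Longrightarrow> fN (\<ominus>\<^bsub>P.MN\<^esub> X) = \<ominus>\<^bsub>P'.MN\<^esub> fN X"
  using tensor_map_add[of "\<ominus>\<^bsub>P.MN\<^esub> X" X]
  by (intro P'.tensor.minus_equality[symmetric]) (simp_all add: P.tensor.l_neg tensor_map_zero)

end

text \<open>The composite is represented by a third function \<open>k\<close> that agrees with it on
  the carrier only; two composites that differ as functions can then be compared through one
  \<open>k\<close>.\<close>

lemma tensor_map_compose:
  assumes "linear_tensor R M N M' f" "linear_tensor R M' N M'' g" "linear_tensor R M N M'' k"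
    and "\<And>x. x \<in> carrier M \<Longrightarrow> g (f x) = k x" and X: "X \<in> carrier (tensor R M N)"
  shows "tensor_map R M' M'' N g (tensor_map R M M' N f X) = tensor_map R M M'' N k X"
proof -
  interpret f: linear_tensor R M N M' f by fact
  interpret g: linear_tensor R M' N M'' g by fact
  interpret k: linear_tensor R M N M'' k by fact
  show ?thesis
    using X by (induction rule: f.P.tensor_induct)
      (auto simp: f.tensor_map_zero g.tensor_map_zero k.tensor_map_zero f.tensor_map_add
        g.tensor_map_add k.tensor_map_add f.tensor_map_pure g.tensor_map_pure k.tensor_map_pure assms(4))
qed

lemma tensor_map_ident:
  assumes "linear_tensor R M N M f"
    and "\<And>x. x \<in> carrier M \<Longrightarrow> f x = x" and X: "X \<in> carrier (tensor R M N)"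
  shows "tensor_map R M M N f X = X"
proof -
  interpret f: linear_tensor R M N M f by fact
  show ?thesis
    using X by (induction rule: f.P.tensor_induct)
      (auto simp: f.tensor_map_zero f.tensor_map_add f.tensor_map_pure assms(2))
qed


subsection \<open>Tensor products of algebras\<close>

locale tensor_algebras = A: algebra R A + B: algebra R B for R A B
begin

sublocale tensor_factors R A B
  by unfold_locales

text \<open>The biadditive extension of the product to formal sums, as it occurs inside
  \<open>tensor\<close>. Additivity in \<open>c\<close> is immediate from this nesting, while
  additivity in \<open>d\<close> takes an induction on \<open>c\<close>.\<close>

definition bmult where
  "bmult c d = frag_extend (\<lambda>(x, y). frag_extend (\<lambda>(x', y').
    frag_of (x \<otimes>\<^bsub>A\<^esub> x', y \<otimes>\<^bsub>B\<^esub> y')) d) c"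

lemma bmult_add_left: "bmult (c + c') d = bmult c d + bmult c' d"
  and bmult_diff_left: "bmult (c - c') d = bmult c d - bmult c' d"
  by (simp_all add: bmult_def frag_extend_add frag_extend_diff)

lemma bmult_add_right: "bmult c (d + d') = bmult c d + bmult c d'"
proof -
  have "Poly_Mapping.keys c \<subseteq> UNIV"
    by simp
  then show ?thesis
  proof (induction c rule: frag_induction)
    case (one p)
    then show ?case
      by (cases p) (simp add: bmult_def frag_extend_add)
  next
    case (diff c c')
    then show ?case
      by (simp add: bmult_diff_left)
  qed (simp add: bmult_def)
qed

lemma bmult_diff_right: "bmult c (d - d') = bmult c d - bmult c d'"
  using bmult_add_right[of c "d - d'" d'] by simp

lemma bmult_zero: "bmult 0 d = 0" "bmult c 0 = 0"
  using bmult_diff_left[of 0 0 d] bmult_diff_right[of c 0 0] by simp_all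

lemma bmult_keys:
  assumes "keys_ok c" "keys_ok d"
  shows "keys_ok (bmult c d)"
  unfolding bmult_def
proof (rule keys_frag_extend_subset[OF assms(1)])
  fix p assume "p \<in> carrier A \<times> carrier B"
  then show "keys_ok (case p of (x, y) \<Rightarrow>
      frag_extend (\<lambda>(x', y'). frag_of (x \<otimes>\<^bsub>A\<^esub> x', y \<otimes>\<^bsub>B\<^esub> y')) d)"
    by (cases p) (auto simp del: subset_iff intro!: keys_frag_extend_subset[OF assms(2)])
qed

text \<open>By additivity in \<open>d\<close> it suffices to multiply by a single generator
  \<open>(z, w)\<close>, and this multiplication sends relations to elements of \<open>H\<close>, by
  the distributive laws and \<open>smult_assoc2\<close>.\<close>

lemma bmult_H_left:
  assumes "c \<in> H" "keys_ok d"
  shows "bmult c d \<in> H"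
  using assms(2)
proof (induction d rule: free_Abelian_group_induct[consumes 1, case_names zero diff frag])
  case (frag p)
  then obtain z w where p: "p = (z, w)" "z \<in> carrier A" "w \<in> carrier B"
    by auto
  have "frag_extend (\<lambda>(x, y). frag_of (x \<otimes>\<^bsub>A\<^esub> z, y \<otimes>\<^bsub>B\<^esub> w)) c \<in> H"
  proof (rule frag_extend_preserves_H[OF tensor_factors_axioms tensor_factors_axioms _ assms(1)])
    fix c assume "c \<in> tensor_rels R A B"
    then show "frag_extend (\<lambda>(x, y). frag_of (x \<otimes>\<^bsub>A\<^esub> z, y \<otimes>\<^bsub>B\<^esub> w)) c \<in> H"
      using p by (cases rule: tensor_rels_cases)
        (simp_all add: frag_extend_diff A.l_distr B.l_distr A.smult_assoc2 B.smult_assoc2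
          H_add_left H_add_right H_smult)
  qed
  then show ?case
    by (simp add: bmult_def p)
qed (simp_all add: bmult_zero bmult_diff_right H_zero H_diff)

lemma bmult_H_right:
  assumes "keys_ok c" "d \<in> H"
  shows "bmult c d \<in> H"
  using assms(1)
proof (induction c rule: free_Abelian_group_induct[consumes 1, case_names zero diff frag])
  case (frag p)
  then obtain z w where p: "p = (z, w)" "z \<in> carrier A" "w \<in> carrier B"
    by auto
  have smult: "z \<otimes>\<^bsub>A\<^esub> (r \<odot>\<^bsub>A\<^esub> x) = r \<odot>\<^bsub>A\<^esub> (z \<otimes>\<^bsub>A\<^esub> x)"
    if "r \<in> carrier R" "x \<in> carrier A" for r x
    using A.smult_assoc2[of r x z] that p(2) by (simp add: A.m_comm)
  have smult': "w \<otimes>\<^bsub>B\<^esub> (r \<odot>\<^bsub>B\<^esub> y) = r \<odot>\<^bsub>B\<^esub> (w \<otimes>\<^bsub>B\<^esub> y)"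
    if "r \<in> carrier R" "y \<in> carrier B" for r y
    using B.smult_assoc2[of r y w] that p(3) by (simp add: B.m_comm)
  have "frag_extend (\<lambda>(x, y). frag_of (z \<otimes>\<^bsub>A\<^esub> x, w \<otimes>\<^bsub>B\<^esub> y)) d \<in> H"
  proof (rule frag_extend_preserves_H[OF tensor_factors_axioms tensor_factors_axioms _ assms(2)])
    fix c assume "c \<in> tensor_rels R A B"
    then show "frag_extend (\<lambda>(x, y). frag_of (z \<otimes>\<^bsub>A\<^esub> x, w \<otimes>\<^bsub>B\<^esub> y)) c \<in> H"
      using p by (cases rule: tensor_rels_cases)
        (simp_all add: frag_extend_diff A.r_distr B.r_distr smult smult'
          H_add_left H_add_right H_smult)
  qed
  then show ?case
    by (simp add: bmult_def p)
qed (simp_all add: bmult_zero bmult_diff_left H_zero H_diff)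

lemma cls_mult:
  assumes "keys_ok c" "keys_ok d"
  shows "cls c \<otimes>\<^bsub>MN\<^esub> cls d = cls (bmult c d)"
proof -
  \<comment> \<open>The difference is split at \<open>bmult c d'\<close>, so that each part has a
    factor in \<open>H\<close>.\<close>
  have "cls (bmult c' d') = cls (bmult c d)" if "c' - c \<in> H" "d' - d \<in> H" for c' d'
  proof -
    have "keys_ok d'"
      using keys_ok_intros(2)[OF H_closed[OF that(2)] assms(2)] by simp
    have "bmult c' d' - bmult c d = bmult (c' - c) d' + bmult c (d' - d)"
      by (simp add: bmult_diff_left bmult_diff_right)
    also have "\<dots> \<in> H"
      using that assms \<open>keys_ok d'\<close> by (intro H_add bmult_H_left bmult_H_right)
    finally show ?thesis
      by (simp add: cls_eq_iff)
  qed
  then have "(\<Union>c'\<in>cls c. \<Union>d'\<in>cls d. cls (bmult c' d')) = cls (bmult c d)"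
    by (intro UN_cls)
  then show ?thesis
    by (simp add: tensor_def Let_def bmult_def)
qed

lemma tensor_mult_closed:
  assumes "X \<in> carrier MN" "Y \<in> carrier MN"
  shows "X \<otimes>\<^bsub>MN\<^esub> Y \<in> carrier MN"
proof -
  obtain c d where "keys_ok c" "X = cls c" "keys_ok d" "Y = cls d"
    using assms by (auto simp: carrier_tensor)
  then show ?thesis
    by (simp add: cls_mult bmult_keys)
qed

lemma tensor_mult_add_left:
  "\<lbrakk>X \<in> carrier MN; Y \<in> carrier MN; Z \<in> carrier MN\<rbrakk> \<Longrightarrow>
    (X \<oplus>\<^bsub>MN\<^esub> Y) \<otimes>\<^bsub>MN\<^esub> Z = X \<otimes>\<^bsub>MN\<^esub> Z \<oplus>\<^bsub>MN\<^esub> Y \<otimes>\<^bsub>MN\<^esub> Z"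
  by (auto simp: carrier_tensor cls_mult bmult_keys cls_add keys_ok_intros bmult_add_left)

lemma tensor_mult_add_right:
  "\<lbrakk>X \<in> carrier MN; Y \<in> carrier MN; Z \<in> carrier MN\<rbrakk> \<Longrightarrow>
    Z \<otimes>\<^bsub>MN\<^esub> (X \<oplus>\<^bsub>MN\<^esub> Y) = Z \<otimes>\<^bsub>MN\<^esub> X \<oplus>\<^bsub>MN\<^esub> Z \<otimes>\<^bsub>MN\<^esub> Y"
  by (auto simp: carrier_tensor cls_mult bmult_keys cls_add keys_ok_intros bmult_add_right)

lemma tensor_mult_zero:
  assumes "X \<in> carrier MN"
  shows "\<zero>\<^bsub>MN\<^esub> \<otimes>\<^bsub>MN\<^esub> X = \<zero>\<^bsub>MN\<^esub>" "X \<otimes>\<^bsub>MN\<^esub> \<zero>\<^bsub>MN\<^esub> = \<zero>\<^bsub>MN\<^esub>"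
  using assms by (auto simp: carrier_tensor tensor_zero cls_mult keys_ok_intros bmult_zero)

lemma pure_mult:
  "\<lbrakk>x \<in> carrier A; x' \<in> carrier A; y \<in> carrier B; y' \<in> carrier B\<rbrakk> \<Longrightarrow>
    pure x y \<otimes>\<^bsub>MN\<^esub> pure x' y' = pure (x \<otimes>\<^bsub>A\<^esub> x') (y \<otimes>\<^bsub>B\<^esub> y')"
  by (simp add: pure_tensor_def cls_mult bmult_def)

lemma tensor_one: "\<one>\<^bsub>MN\<^esub> = pure \<one>\<^bsub>A\<^esub> \<one>\<^bsub>B\<^esub>"
  by (simp add: tensor_def Let_def)

end

section \<open>Flatness over arbitrary carrier types\<close>

text \<open>The definition of \<open>flat\<close> speaks about modules of a single carrier type only; other modules are
  moved to this type along an injection. The multiplication and the unit are junk.\<close>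

definition transport_module :: "('m \<Rightarrow> 'c) \<Rightarrow> ('a, 'm, 'i) module_scheme \<Rightarrow> ('a, 'c) module" where
  "transport_module \<iota> M = (let \<kappa> = inv_into (carrier M) \<iota> in
    \<lparr>carrier = \<iota> ` carrier M,
     monoid.mult = (\<lambda>X Y. X), monoid.one = \<iota> \<zero>\<^bsub>M\<^esub>, ring.zero = \<iota> \<zero>\<^bsub>M\<^esub>,
     ring.add = (\<lambda>X Y. \<iota> (\<kappa> X \<oplus>\<^bsub>M\<^esub> \<kappa> Y)),
     module.smult = (\<lambda>r X. \<iota> (r \<odot>\<^bsub>M\<^esub> \<kappa> X))\<rparr>)"

locale transported = module R M for R M +
  fixes \<iota>
  assumes inj: "inj_on \<iota> (carrier M)"
begin

abbreviation \<kappa> where "\<kappa> \<equiv> inv_into (carrier M) \<iota>"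
abbreviation T where "T \<equiv> transport_module \<iota> M"

lemma inv_left [simp]: "x \<in> carrier M \<Longrightarrow> \<kappa> (\<iota> x) = x"
  by (rule inv_into_f_f[OF inj])

lemma transport_simps [simp]:
  "carrier T = \<iota> ` carrier M" "\<zero>\<^bsub>T\<^esub> = \<iota> \<zero>\<^bsub>M\<^esub>" "X \<oplus>\<^bsub>T\<^esub> Y = \<iota> (\<kappa> X \<oplus>\<^bsub>M\<^esub> \<kappa> Y)"
  "r \<odot>\<^bsub>T\<^esub> X = \<iota> (r \<odot>\<^bsub>M\<^esub> \<kappa> X)"
  by (simp_all add: transport_module_def Let_def)

lemma transport_module: "module R T"
proof (rule moduleI)
  show "abelian_group T"
  proof (rule abelian_groupI)
    fix X assume "X \<in> carrier T"
    then obtain x where "x \<in> carrier M" "X = \<iota> x"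
      by auto
    then show "\<exists>Y\<in>carrier T. Y \<oplus>\<^bsub>T\<^esub> X = \<zero>\<^bsub>T\<^esub>"
      by (intro bexI[of _ "\<iota> (\<ominus>\<^bsub>M\<^esub> x)"]) (auto simp: M.l_neg)
  qed (auto simp: M.a_ac)
qed (auto simp: R.is_cring smult_l_distr smult_r_distr smult_assoc1)

lemma transport_linear: "linear_map R M T \<iota>" "linear_map R T M \<kappa>"
  by (auto simp: linear_map_def)

end

lemma linear_map_comp:
  "\<lbrakk>linear_map R M1 M2 f; linear_map R M2 M3 g\<rbrakk> \<Longrightarrow> linear_map R M1 M3 (\<lambda>x. g (f x))"
  by (auto simp: linear_map_def Pi_iff)

lemma linear_tensorI:
  "\<lbrakk>module R M; module R M'; module R N; linear_map R M M' f\<rbrakk> \<Longrightarrow> linear_tensor R M N M' f"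
  by (simp add: linear_tensor_def linear_tensor_axioms_def tensor_factors_def)

lemma mem_a_kernel: "x \<in> a_kernel G H h \<longleftrightarrow> x \<in> carrier G \<and> h x = \<zero>\<^bsub>H\<^esub>"
  by (auto simp: a_kernel_def kernel_def)

text \<open>The injections move the three modules to the carrier type of \<open>flat\<close>, where
  the hypothesis applies. Each transported module is isomorphic to the original, so exactness after
  tensoring can be carried back.\<close>

lemma flat_exact:
  fixes R :: "('a, 'k) ring_scheme" and M1 :: "('a, 'm1, 'i1) module_scheme"
    and M2 :: "('a, 'm2, 'i2) module_scheme" and M3 :: "('a, 'm3, 'i3) module_scheme"
    and \<iota>1 :: "'m1 \<Rightarrow> (nat \<Rightarrow> 'a) set" and \<iota>2 :: "'m2 \<Rightarrow> (nat \<Rightarrow> 'a) set"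
    and \<iota>3 :: "'m3 \<Rightarrow> (nat \<Rightarrow> 'a) set"
  assumes flat: "flat R N"
    and M: "module R M1" "module R M2" "module R M3"
    and \<iota>: "inj_on \<iota>1 (carrier M1)" "inj_on \<iota>2 (carrier M2)" "inj_on \<iota>3 (carrier M3)"
    and f: "linear_map R M1 M2 f" and g: "linear_map R M2 M3 g"
    and exact: "f ` carrier M1 = a_kernel M2 M3 g"
  shows "tensor_map R M1 M2 N f ` carrier (tensor R M1 N) =
    a_kernel (tensor R M2 N) (tensor R M3 N) (tensor_map R M2 M3 N g)"
proof -
  interpret T1: transported R M1 \<iota>1 using M(1) \<iota>(1) by (simp add: transported_def transported_axioms_def)
  interpret T2: transported R M2 \<iota>2 using M(2) \<iota>(2) by (simp add: transported_def transported_axioms_def)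
  interpret T3: transported R M3 \<iota>3 using M(3) \<iota>(3) by (simp add: transported_def transported_axioms_def)
  have N: "module R N"
    using flat by (simp add: flat_def)
  define f' where "f' = (\<lambda>x. \<iota>2 (f (T1.\<kappa> x)))"
  define g' where "g' = (\<lambda>x. \<iota>3 (g (T2.\<kappa> x)))"
  have f': "linear_map R T1.T T2.T f'"
    unfolding f'_def
    by (intro linear_map_comp[OF linear_map_comp[OF T1.transport_linear(2) f] T2.transport_linear(1)])
  have g': "linear_map R T2.T T3.T g'"
    unfolding g'_def
    by (intro linear_map_comp[OF linear_map_comp[OF T2.transport_linear(2) g] T3.transport_linear(1)])
  have fc: "f x \<in> carrier M2" if "x \<in> carrier M1" for x
    using f that by (auto simp: linear_map_def)
  have gc: "g x \<in> carrier M3" if "x \<in> carrier M2" for x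
    using g that by (auto simp: linear_map_def)
  have exact': "f' ` carrier T1.T = a_kernel T2.T T3.T g'"
  proof -
    have "\<iota>3 (g x) = \<iota>3 \<zero>\<^bsub>M3\<^esub> \<longleftrightarrow> g x = \<zero>\<^bsub>M3\<^esub>" if "x \<in> carrier M2" for x
      using that gc by (intro inj_on_eq_iff[OF T3.inj]) auto
    then have ker: "\<iota>2 ` a_kernel M2 M3 g = a_kernel T2.T T3.T g'"
      by (auto simp: mem_a_kernel g'_def intro!: imageI)
    have "f' ` carrier T1.T = \<iota>2 ` f ` carrier M1"
      by (auto simp: f'_def image_iff)
    also have "\<dots> = a_kernel T2.T T3.T g'"
      unfolding exact by (rule ker)
    finally show ?thesis .
  qed
  have flat': "tensor_map R T1.T T2.T N f' ` carrier (tensor R T1.T N) =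
      a_kernel (tensor R T2.T N) (tensor R T3.T N) (tensor_map R T2.T T3.T N g')"
    using flat T1.transport_module T2.transport_module T3.transport_module f' g' exact'
    unfolding flat_def by blast
  note mods = M N T1.transport_module T2.transport_module T3.transport_module
  note lins = f g f' g' T1.transport_linear T2.transport_linear T3.transport_linear
  interpret lf: linear_tensor R M1 N M2 f by (intro linear_tensorI mods lins)
  interpret lg: linear_tensor R M2 N M3 g by (intro linear_tensorI mods lins)
  interpret lf': linear_tensor R T1.T N T2.T f' by (intro linear_tensorI mods lins)
  interpret lg': linear_tensor R T2.T N T3.T g' by (intro linear_tensorI mods lins)
  interpret i1: linear_tensor R M1 N T1.T \<iota>1 by (intro linear_tensorI mods lins)
  interpret i2: linear_tensor R M2 N T2.T \<iota>2 by (intro linear_tensorI mods lins)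
  interpret i3: linear_tensor R M3 N T3.T \<iota>3 by (intro linear_tensorI mods lins)
  interpret k1: linear_tensor R T1.T N M1 T1.\<kappa> by (intro linear_tensorI mods lins)
  interpret k2: linear_tensor R T2.T N M2 T2.\<kappa> by (intro linear_tensorI mods lins)
  interpret k3: linear_tensor R T3.T N M3 T3.\<kappa> by (intro linear_tensorI mods lins)
  interpret ifn: linear_tensor R M1 N T2.T "\<lambda>x. \<iota>2 (f x)" by (intro linear_tensorI mods linear_map_comp[OF f] lins)
  interpret ig: linear_tensor R M2 N T3.T "\<lambda>x. \<iota>3 (g x)" by (intro linear_tensorI mods linear_map_comp[OF g] lins)
  interpret fk: linear_tensor R T1.T N M2 "\<lambda>x. f (T1.\<kappa> x)" by (intro linear_tensorI mods linear_map_comp[OF _ f] lins)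
  interpret id2: linear_tensor R M2 N M2 "\<lambda>x. x" by (intro linear_tensorI mods) (simp add: linear_map_def)
  interpret id3: linear_tensor R M3 N M3 "\<lambda>x. x" by (intro linear_tensorI mods) (simp add: linear_map_def)
  \<comment> \<open>The \<open>k\<close> maps are left inverses of the \<open>i\<close> maps, and
    the squares \<open>gi\<close>, \<open>fi\<close> and \<open>kf\<close> between the sequence and
    its transport commute. The final diagram chase rests on these facts.\<close>
  have ki2: "k2.fN (i2.fN y) = y" if "y \<in> carrier (tensor R M2 N)" for y
    using tensor_map_compose[OF i2.linear_tensor_axioms k2.linear_tensor_axioms id2.linear_tensor_axioms _ that]
      tensor_map_ident[OF id2.linear_tensor_axioms _ that] by simp
  have ki3: "k3.fN (i3.fN y) = y" if "y \<in> carrier (tensor R M3 N)" for y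
    using tensor_map_compose[OF i3.linear_tensor_axioms k3.linear_tensor_axioms id3.linear_tensor_axioms _ that]
      tensor_map_ident[OF id3.linear_tensor_axioms _ that] by simp
  have gi: "lg'.fN (i2.fN y) = i3.fN (lg.fN y)" if "y \<in> carrier (tensor R M2 N)" for y
    using tensor_map_compose[OF i2.linear_tensor_axioms lg'.linear_tensor_axioms ig.linear_tensor_axioms _ that]
      tensor_map_compose[OF lg.linear_tensor_axioms i3.linear_tensor_axioms ig.linear_tensor_axioms _ that]
    by (simp add: g'_def)
  have fi: "lf'.fN (i1.fN x) = i2.fN (lf.fN x)" if "x \<in> carrier (tensor R M1 N)" for x
    using tensor_map_compose[OF i1.linear_tensor_axioms lf'.linear_tensor_axioms ifn.linear_tensor_axioms _ that]
      tensor_map_compose[OF lf.linear_tensor_axioms i2.linear_tensor_axioms ifn.linear_tensor_axioms _ that]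
    by (simp add: f'_def)
  have kf: "k2.fN (lf'.fN z) = lf.fN (k1.fN z)" if "z \<in> carrier (tensor R T1.T N)" for z
    using tensor_map_compose[OF lf'.linear_tensor_axioms k2.linear_tensor_axioms fk.linear_tensor_axioms _ that]
      tensor_map_compose[OF k1.linear_tensor_axioms lf.linear_tensor_axioms fk.linear_tensor_axioms _ that]
    by (auto simp: f'_def fc)
  show ?thesis
  proof (intro equalityI subsetI)
    fix y assume "y \<in> lf.fN ` carrier (tensor R M1 N)"
    then obtain x where x: "x \<in> carrier (tensor R M1 N)" "y = lf.fN x"
      by blast
    then have y: "y \<in> carrier (tensor R M2 N)"
      by simp
    have "i2.fN y \<in> lf'.fN ` carrier (tensor R T1.T N)"
      using fi[OF x(1)] x i1.tensor_map_closed[OF x(1)] by (metis imageI)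
    then have "i3.fN (lg.fN y) = \<zero>\<^bsub>tensor R T3.T N\<^esub>"
      using gi[OF y] unfolding flat' by (simp add: mem_a_kernel)
    then have "k3.fN \<zero>\<^bsub>tensor R T3.T N\<^esub> = lg.fN y"
      using ki3[of "lg.fN y"] y by simp
    then show "y \<in> a_kernel (tensor R M2 N) (tensor R M3 N) lg.fN"
      using y k3.tensor_map_zero by (simp add: mem_a_kernel)
  next
    fix y assume "y \<in> a_kernel (tensor R M2 N) (tensor R M3 N) lg.fN"
    then have y: "y \<in> carrier (tensor R M2 N)" "lg.fN y = \<zero>\<^bsub>tensor R M3 N\<^esub>"
      by (simp_all add: mem_a_kernel)
    then have "i2.fN y \<in> a_kernel (tensor R T2.T N) (tensor R T3.T N) lg'.fN"
      using gi[OF y(1)] i3.tensor_map_zero i2.tensor_map_closed[OF y(1)] by (simp add: mem_a_kernel)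
    then obtain z where z: "z \<in> carrier (tensor R T1.T N)" "i2.fN y = lf'.fN z"
      unfolding flat'[symmetric] by blast
    then have "y = lf.fN (k1.fN z)"
      using ki2[OF y(1)] kf[OF z(1)] by simp
    then show "y \<in> lf.fN ` carrier (tensor R M1 N)"
      using k1.tensor_map_closed[OF z(1)] by blast
  qed
qed


section \<open>Flat base change of splines\<close>

text \<open>The record \<open>R Quot I\<close> is a ring only; exact sequences need
  \<open>R/I\<close> as an \<open>R\<close>-module, with scalars acting through their
  cosets.\<close>

definition quotient_module :: "('a, 'k) ring_scheme \<Rightarrow> 'a set \<Rightarrow> ('a, 'a set) module" where
  "quotient_module R I =
    \<lparr>carrier = carrier (R Quot I), monoid.mult = monoid.mult (R Quot I),
     monoid.one = \<one>\<^bsub>R Quot I\<^esub>, ring.zero = \<zero>\<^bsub>R Quot I\<^esub>, ring.add = ring.add (R Quot I),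
     module.smult = (\<lambda>r X. (I +>\<^bsub>R\<^esub> r) \<otimes>\<^bsub>R Quot I\<^esub> X)\<rparr>"

lemma quotient_module_simps [simp]:
  "carrier (quotient_module R I) = carrier (R Quot I)"
  "\<zero>\<^bsub>quotient_module R I\<^esub> = \<zero>\<^bsub>R Quot I\<^esub>"
  "X \<oplus>\<^bsub>quotient_module R I\<^esub> Y = X \<oplus>\<^bsub>R Quot I\<^esub> Y"
  "r \<odot>\<^bsub>quotient_module R I\<^esub> X = (I +>\<^bsub>R\<^esub> r) \<otimes>\<^bsub>R Quot I\<^esub> X"
  by (simp_all add: quotient_module_def)

lemma quotient_module:
  assumes "cring R" "ideal I R"
  shows "module R (quotient_module R I)"
proof -
  interpret R: cring R by fact
  interpret I: ideal I R by fact
  interpret Q: cring "R Quot I"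
    by (rule I.quotient_is_cring[OF R.is_cring])
  note hom = I.rcos_ring_hom
  show ?thesis
  proof (rule moduleI)
    show "abelian_group (quotient_module R I)"
    proof (rule abelian_groupI)
      fix X assume "X \<in> carrier (quotient_module R I)"
      then show "\<exists>Y\<in>carrier (quotient_module R I). Y \<oplus>\<^bsub>quotient_module R I\<^esub> X = \<zero>\<^bsub>quotient_module R I\<^esub>"
        by (intro bexI[of _ "\<ominus>\<^bsub>R Quot I\<^esub> X"]) (simp_all add: Q.l_neg)
    qed (auto simp: Q.a_ac)
  qed (auto simp: R.is_cring ring_hom_closed[OF hom] ring_hom_add[OF hom] ring_hom_mult[OF hom]
      ring_hom_one[OF hom] Q.l_distr Q.r_distr Q.m_assoc)
qed

lemma (in spline_graph) spline_ring_algebra: "algebra R R_G"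
proof -
  interpret module R R_G
    by (rule spline_ring_module)
  show ?thesis
    by (rule algebraI) (auto simp: is_cring spline_ring_cring smult_spline l_distr r_distr m_assoc
        intro!: restrict_ext spline_eqI[OF smult_spline])
qed

section \<open>The comparison map from \<open>R_G \<otimes> S\<close> to the splines over
  \<open>S\<close>\<close>

locale spline_algebra = spline_graph R G + S: algebra R S for R (structure) and G and S
begin

abbreviation FG where "FG \<equiv> base_change_graph S G"

sublocale pair: tensor_algebras R R_G S
  by (intro tensor_algebras.intro spline_ring_algebra S.algebra_axioms)

sublocale FG: spline_graph S FG
  by (rule base_change_spline_graph[OF S.M_cring]) simp

text \<open>The map is characterized by its properties because \<open>tensor_lift\<close> yields it
  by existence only. The induction over edges then speaks about every such map of the smaller graph.
  Values are constrained at vertices, where splines carry their information.\<close>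

definition comparison where
  "comparison \<theta> \<longleftrightarrow>
    (\<forall>X\<in>carrier pair.MN. \<theta> X \<in> splines S FG) \<and>
    (\<forall>X\<in>carrier pair.MN. \<forall>Y\<in>carrier pair.MN. \<forall>v\<in>V. \<theta> (X \<oplus>\<^bsub>pair.MN\<^esub> Y) v = \<theta> X v \<oplus>\<^bsub>S\<^esub> \<theta> Y v) \<and>
    (\<forall>s\<in>splines R G. \<forall>y\<in>carrier S. \<forall>v\<in>V. \<theta> (pair.pure s y) v = s v \<odot>\<^bsub>S\<^esub> y)"

lemma comparisonD:
  assumes "comparison \<theta>"
  shows "X \<in> carrier pair.MN \<Longrightarrow> \<theta> X \<in> splines S FG"
    and "\<lbrakk>X \<in> carrier pair.MN; Y \<in> carrier pair.MN; v \<in> V\<rbrakk> \<Longrightarrow>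
      \<theta> (X \<oplus>\<^bsub>pair.MN\<^esub> Y) v = \<theta> X v \<oplus>\<^bsub>S\<^esub> \<theta> Y v"
    and "\<lbrakk>s \<in> splines R G; y \<in> carrier S; v \<in> V\<rbrakk> \<Longrightarrow> \<theta> (pair.pure s y) v = s v \<odot>\<^bsub>S\<^esub> y"
  using assms by (auto simp: comparison_def)

lemma comparison_apply_closed:
  "\<lbrakk>comparison \<theta>; X \<in> carrier pair.MN; v \<in> V\<rbrakk> \<Longrightarrow> \<theta> X v \<in> carrier S"
  using FG.spline_closed[OF comparisonD(1), of \<theta> X v] by simp

lemma comparison_zero:
  assumes "comparison \<theta>" "v \<in> V"
  shows "\<theta> \<zero>\<^bsub>pair.MN\<^esub> v = \<zero>\<^bsub>S\<^esub>"
proof -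
  have "\<theta> \<zero>\<^bsub>pair.MN\<^esub> v \<oplus>\<^bsub>S\<^esub> \<theta> \<zero>\<^bsub>pair.MN\<^esub> v = \<theta> \<zero>\<^bsub>pair.MN\<^esub> v"
    using comparisonD(2)[OF assms(1) _ _ assms(2), of "\<zero>\<^bsub>pair.MN\<^esub>" "\<zero>\<^bsub>pair.MN\<^esub>"] by simp
  then show ?thesis
    using comparison_apply_closed[OF assms(1) _ assms(2), of "\<zero>\<^bsub>pair.MN\<^esub>"]
    by (simp add: S.M.add.r_cancel_one)
qed

lemma smult_minus_left:
  assumes "a \<in> carrier R" "b \<in> carrier R" "y \<in> carrier S"
  shows "(a \<ominus> b) \<odot>\<^bsub>S\<^esub> y = a \<odot>\<^bsub>S\<^esub> y \<ominus>\<^bsub>S\<^esub> b \<odot>\<^bsub>S\<^esub> y"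
  using assms by (simp add: a_minus_def S.smult_l_distr S.smult_l_minus)

text \<open>Along an edge the difference is \<open>r \<odot> y = (r \<odot> 1) \<otimes> y\<close>
  with \<open>r\<close> in the label, a multiple of a generator of the extended label.\<close>

lemma smult_spline_base_change:
  assumes s: "s \<in> splines R G" and y: "y \<in> carrier S"
  shows "(\<lambda>v\<in>V. s v \<odot>\<^bsub>S\<^esub> y) \<in> splines S FG"
proof -
  have "(\<lambda>v\<in>vertices FG. s v \<odot>\<^bsub>S\<^esub> y) \<in> splines S FG"
  proof (rule FG.restrict_splineI)
    fix e u v assume "e \<in> edges FG" "ends FG e = {u, v}" and "u \<in> vertices FG" "v \<in> vertices FG"
    then have e: "e \<in> E" "ends G e = {u, v}" and uv: "u \<in> V" "v \<in> V"
      by simp_all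
    interpret I: ideal "label FG e" S
      using e by (intro FG.label_ideal) simp
    let ?r = "s u \<ominus> s v"
    have r: "?r \<in> label G e" "?r \<in> carrier R"
      using spline_edge[OF s e] s uv by simp_all
    have sub: "(\<lambda>r. r \<odot>\<^bsub>S\<^esub> \<one>\<^bsub>S\<^esub>) ` label G e \<subseteq> carrier S"
      using ideal.Icarr[OF label_ideal[OF e(1)]] by auto
    have "?r \<odot>\<^bsub>S\<^esub> \<one>\<^bsub>S\<^esub> \<in> label FG e"
      using subsetD[OF S.genideal_self[OF sub] imageI[OF r(1)]] by simp
    then have "(?r \<odot>\<^bsub>S\<^esub> \<one>\<^bsub>S\<^esub>) \<otimes>\<^bsub>S\<^esub> y \<in> label FG e"
      using y by (rule I.I_r_closed)
    also have "(?r \<odot>\<^bsub>S\<^esub> \<one>\<^bsub>S\<^esub>) \<otimes>\<^bsub>S\<^esub> y = ?r \<odot>\<^bsub>S\<^esub> (\<one>\<^bsub>S\<^esub> \<otimes>\<^bsub>S\<^esub> y)"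
      using r(2) y by (intro S.smult_assoc2) auto
    also have "\<dots> = s u \<odot>\<^bsub>S\<^esub> y \<ominus>\<^bsub>S\<^esub> s v \<odot>\<^bsub>S\<^esub> y"
      using s uv y by (simp add: smult_minus_left)
    finally show "s u \<odot>\<^bsub>S\<^esub> y \<ominus>\<^bsub>S\<^esub> s v \<odot>\<^bsub>S\<^esub> y \<in> label FG e" .
  qed (use s y in simp)
  then show ?thesis
    by simp
qed

lemma ex_comparison: "\<exists>\<theta>. comparison \<theta>"
proof -
  have "abelian_group (spline_ring S FG)"
    using FG.spline_ring_cring by (simp add: cring_def ring_def)
  then obtain g where "\<And>X. X \<in> carrier pair.MN \<Longrightarrow> g X \<in> carrier (spline_ring S FG)"
    "\<And>X Y. \<lbrakk>X \<in> carrier pair.MN; Y \<in> carrier pair.MN\<rbrakk> \<Longrightarrow>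
      g (X \<oplus>\<^bsub>pair.MN\<^esub> Y) = g X \<oplus>\<^bsub>spline_ring S FG\<^esub> g Y"
    "\<And>s y. \<lbrakk>s \<in> carrier R_G; y \<in> carrier S\<rbrakk> \<Longrightarrow> g (pair.pure s y) = (\<lambda>v\<in>V. s v \<odot>\<^bsub>S\<^esub> y)"
    by (rule pair.tensor_lift[where b = "\<lambda>s y. \<lambda>v\<in>V. s v \<odot>\<^bsub>S\<^esub> y"])
      (auto simp: smult_spline_base_change S.smult_l_distr S.smult_r_distr S.smult_assoc1
        m_comm[of _ "_ _"] simp flip: S.smult_assoc1 intro!: restrict_ext)
  then show ?thesis
    unfolding comparison_def by (intro exI[of _ g]) auto
qed

end

section \<open>Bijectivity of the comparison map by induction on the edges\<close>

context spline_algebra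
begin

lemma comparison_bijI:
  assumes \<theta>: "comparison \<theta>"
    and dist: "\<And>X Y. \<lbrakk>X \<in> carrier pair.MN; Y \<in> carrier pair.MN; \<And>v. v \<in> V \<Longrightarrow> \<theta> X v = \<theta> Y v\<rbrakk> \<Longrightarrow> X = Y"
    and surj: "\<And>t. t \<in> splines S FG \<Longrightarrow> \<exists>X\<in>carrier pair.MN. \<forall>v\<in>V. \<theta> X v = t v"
  shows "bij_betw \<theta> (carrier pair.MN) (splines S FG)"
  unfolding bij_betw_def
proof
  show "inj_on \<theta> (carrier pair.MN)"
    using dist by (intro inj_onI) simp
  show "\<theta> ` carrier pair.MN = splines S FG"
  proof (intro equalityI subsetI)
    show "t \<in> splines S FG" if "t \<in> \<theta> ` carrier pair.MN" for t
      using that comparisonD(1)[OF \<theta>] by auto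
    show "t \<in> \<theta> ` carrier pair.MN" if t: "t \<in> splines S FG" for t
    proof -
      obtain X where X: "X \<in> carrier pair.MN" "\<forall>v\<in>V. \<theta> X v = t v"
        using surj[OF t] by blast
      have "\<theta> X = t"
        using X(2) by (intro FG.spline_eqI comparisonD(1)[OF \<theta> X(1)] t) simp
      then show ?thesis
        using X(1) by blast
    qed
  qed
qed

text \<open>The standard basis of the free module of all functions on the vertices; its members are
  splines when no edge imposes a condition.\<close>

definition unit_vector where
  "unit_vector v = (\<lambda>u\<in>V. if u = v then \<one> else \<zero>)"

lemma unit_vector_apply [simp]: "u \<in> V \<Longrightarrow> unit_vector v u = (if u = v then \<one> else \<zero>)"
  by (simp add: unit_vector_def)

text \<open>The inverse sends \<open>t\<close> to the sum of
  \<open>unit_vector v \<otimes> t v\<close> over the vertices. The fact \<open>expansion\<close>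
  says that this undoes \<open>\<theta>\<close>, and evaluating \<open>\<theta>\<close> on the sum
  gives the other direction.\<close>

lemma comparison_bij_no_edges:
  assumes \<theta>: "comparison \<theta>" and E: "E = {}"
  shows "bij_betw \<theta> (carrier pair.MN) (splines S FG)"
proof (rule comparison_bijI[OF \<theta>])
  have spline: "s \<in> splines R G" if "s \<in> V \<rightarrow>\<^sub>E carrier R" for s
    using that by (simp add: splines_def E)
  have uv: "unit_vector v \<in> splines R G" for v
    by (rule spline) (simp add: unit_vector_def)
  let ?\<Sigma> = "\<lambda>W t. \<Oplus>\<^bsub>pair.MN\<^esub>v\<in>W. pair.pure (unit_vector v) (t v)"
  have term_closed: "pair.pure (unit_vector v) y \<in> carrier pair.MN" if "y \<in> carrier S" for v y
    using uv that by simp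
  \<comment> \<open>Here \<open>W\<close> contains the support of \<open>s\<close>. The induction
    splits off the coordinate at \<open>w\<close> and keeps the remainder \<open>s'\<close>,
    supported in the smaller set; balancedness moves the scalar \<open>s w\<close> to the right
    factor.\<close>
  have pure_sum: "pair.pure s y = ?\<Sigma> W (\<lambda>v. s v \<odot>\<^bsub>S\<^esub> y)"
    if "finite W" "W \<subseteq> V" "s \<in> splines R G" "y \<in> carrier S" "\<And>v. v \<in> V - W \<Longrightarrow> s v = \<zero>" for W s y
    using that
  proof (induction W arbitrary: s)
    case empty
    then have "s = \<zero>\<^bsub>R_G\<^esub>"
      by (intro spline_eqI diag_spline) (simp_all add: diag_spline)
    then show ?case
      using pair.pure_zero_left[of y] empty by simp
  next
    case (insert w W)
    define s' where "s' = (\<lambda>v\<in>V. if v = w then \<zero> else s v)"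
    have w: "w \<in> V" "s w \<in> carrier R"
      using insert.prems by auto
    have s': "s' \<in> splines R G"
      using insert.prems by (intro spline) (auto simp: s'_def)
    have sw: "s w \<odot>\<^bsub>R_G\<^esub> unit_vector w \<in> splines R G"
      using smult_spline[OF w(2) uv] by simp
    have split: "s = s w \<odot>\<^bsub>R_G\<^esub> unit_vector w \<oplus>\<^bsub>R_G\<^esub> s'"
      using insert.prems(2) w add_spline[OF sw s'] s'
      by (intro spline_eqI) (auto simp: s'_def)
    have "pair.pure s' y = ?\<Sigma> W (\<lambda>v. s' v \<odot>\<^bsub>S\<^esub> y)"
      using insert.prems by (intro insert.IH s') (auto simp: s'_def)
    also have "\<dots> = ?\<Sigma> W (\<lambda>v. s v \<odot>\<^bsub>S\<^esub> y)"
      using insert.hyps insert.prems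
      by (intro pair.tensor.add.finprod_cong') (auto simp: s'_def intro!: term_closed)
    finally have IH: "pair.pure s' y = ?\<Sigma> W (\<lambda>v. s v \<odot>\<^bsub>S\<^esub> y)" .
    have "pair.pure s y = pair.pure (s w \<odot>\<^bsub>R_G\<^esub> unit_vector w \<oplus>\<^bsub>R_G\<^esub> s') y"
      using split by simp
    also have "\<dots> = pair.pure (s w \<odot>\<^bsub>R_G\<^esub> unit_vector w) y \<oplus>\<^bsub>pair.MN\<^esub> pair.pure s' y"
      using sw s' insert.prems(3) by (intro pair.pure_add_left) auto
    also have "pair.pure (s w \<odot>\<^bsub>R_G\<^esub> unit_vector w) y = pair.pure (unit_vector w) (s w \<odot>\<^bsub>S\<^esub> y)"
      using uv w insert.prems(3) by (intro pair.pure_balanced) auto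
    finally show ?case
      using insert.hyps insert.prems
      by (subst pair.tensor.finsum_insert) (auto simp: IH intro!: term_closed)
  qed
  have expansion: "X = ?\<Sigma> V (\<theta> X)" if "X \<in> carrier pair.MN" for X
    using that
  proof (induction rule: pair.tensor_induct)
    case zero
    have "?\<Sigma> V (\<theta> \<zero>\<^bsub>pair.MN\<^esub>) = ?\<Sigma> V (\<lambda>v. \<zero>\<^bsub>S\<^esub>)"
      by (rule pair.tensor.add.finprod_cong') (auto simp: comparison_zero[OF \<theta>] intro!: term_closed)
    also have "\<dots> = \<zero>\<^bsub>pair.MN\<^esub>"
      using uv by (intro pair.tensor.add.finprod_one_eqI) (simp add: pair.pure_zero_right)
    finally show ?case ..
  next
    case (pure s y)
    then have "pair.pure s y = ?\<Sigma> V (\<lambda>v. s v \<odot>\<^bsub>S\<^esub> y)"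
      by (intro pure_sum finite_V) auto
    also have "\<dots> = ?\<Sigma> V (\<theta> (pair.pure s y))"
      using pure by (intro pair.tensor.add.finprod_cong')
        (auto simp: comparisonD(3)[OF \<theta>] intro!: term_closed)
    finally show ?case .
  next
    case (add X Y)
    have "?\<Sigma> V (\<theta> (X \<oplus>\<^bsub>pair.MN\<^esub> Y)) =
        (\<Oplus>\<^bsub>pair.MN\<^esub>v\<in>V. pair.pure (unit_vector v) (\<theta> X v) \<oplus>\<^bsub>pair.MN\<^esub> pair.pure (unit_vector v) (\<theta> Y v))"
      using add uv by (intro pair.tensor.add.finprod_cong')
        (auto simp: comparisonD(2)[OF \<theta>] comparison_apply_closed[OF \<theta>] pair.pure_add_right
          intro!: term_closed)
    also have "\<dots> = ?\<Sigma> V (\<theta> X) \<oplus>\<^bsub>pair.MN\<^esub> ?\<Sigma> V (\<theta> Y)"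
      using add by (intro pair.tensor.finsum_addf)
        (auto simp: comparison_apply_closed[OF \<theta>] intro!: term_closed)
    also have "\<dots> = X \<oplus>\<^bsub>pair.MN\<^esub> Y"
      using add.IH by simp
    finally show ?case ..
  qed
  show "X = Y" if X: "X \<in> carrier pair.MN" and Y: "Y \<in> carrier pair.MN"
    and eq: "\<And>v. v \<in> V \<Longrightarrow> \<theta> X v = \<theta> Y v" for X Y
  proof -
    have "?\<Sigma> V (\<theta> X) = ?\<Sigma> V (\<theta> Y)"
      using eq Y by (intro pair.tensor.add.finprod_cong')
        (auto simp: comparison_apply_closed[OF \<theta>] intro!: term_closed)
    then show ?thesis
      using expansion[OF X] expansion[OF Y] by simp
  qed
  show "\<exists>X\<in>carrier pair.MN. \<forall>v\<in>V. \<theta> X v = t v" if t: "t \<in> splines S FG" for t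
  proof -
    have tc: "t v \<in> carrier S" if "v \<in> V" for v
      using FG.spline_closed[OF t] that by simp
    have closed: "?\<Sigma> W t \<in> carrier pair.MN" if "W \<subseteq> V" for W
      using that tc by (intro pair.tensor.finsum_closed) (auto intro!: term_closed)
    \<comment> \<open>Partial sums over \<open>W\<close> allow induction on \<open>W\<close>; the
      case \<open>W = V\<close> gives the required preimage of \<open>t\<close>.\<close>
    have "\<theta> (?\<Sigma> W t) u = (if u \<in> W then t u else \<zero>\<^bsub>S\<^esub>)" if "finite W" "W \<subseteq> V" "u \<in> V" for W u
      using that
    proof (induction W)
      case empty
      then show ?case
        by (simp add: comparison_zero[OF \<theta>])
    next
      case (insert w W)
      have "?\<Sigma> (insert w W) t = pair.pure (unit_vector w) (t w) \<oplus>\<^bsub>pair.MN\<^esub> ?\<Sigma> W t"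
        using insert.hyps insert.prems tc by (intro pair.tensor.finsum_insert) (auto intro!: term_closed)
      then have "\<theta> (?\<Sigma> (insert w W) t) u =
          \<theta> (pair.pure (unit_vector w) (t w)) u \<oplus>\<^bsub>S\<^esub> \<theta> (?\<Sigma> W t) u"
        using insert.prems tc closed
        by (simp add: comparisonD(2)[OF \<theta>] term_closed)
      also have "\<theta> (pair.pure (unit_vector w) (t w)) u = unit_vector w u \<odot>\<^bsub>S\<^esub> t w"
        using insert.prems tc uv by (intro comparisonD(3)[OF \<theta>]) auto
      finally show ?case
        using insert tc by auto
    qed
    then show ?thesis
      using closed[of V] finite_V by (intro bexI[of _ "?\<Sigma> V t"]) auto
  qed
qed

text \<open>Splines on \<open>G\<close> are the kernel of \<open>s \<mapsto> s u - s w mod I\<close> on the splines of \<open>G\<close> without the edge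
  \<open>e = uw\<close> labelled \<open>I\<close>. Tensoring this exact sequence with \<open>S\<close> proves the inductive step.\<close>

lemma comparison_bij_add_edge:
  assumes flat: "flat R S" and \<theta>: "comparison \<theta>" and e: "e \<in> E"
    and G': "G' = G\<lparr>edges := E - {e}\<rparr>"
    and IH: "\<And>\<theta>'. spline_algebra.comparison R G' S \<theta>' \<Longrightarrow>
      bij_betw \<theta>' (carrier (tensor R (spline_ring R G') S)) (splines S (base_change_graph S G'))"
  shows "bij_betw \<theta> (carrier pair.MN) (splines S FG)"
proof -
  have G'_simps [simp]: "vertices G' = V" "edges G' = E - {e}" "ends G' = ends G" "label G' = label G"
    by (simp_all add: G')
  have diag' [simp]: "diag G' = diag G"
    by (simp add: diag_def fun_eq_iff)
  have "edge_labeled_graph R G'"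
    using graph by (auto simp: edge_labeled_graph_def)
  then interpret G': spline_algebra R G' S
    by unfold_locales
  obtain \<theta>' where \<theta>': "G'.comparison \<theta>'"
    using G'.ex_comparison by blast
  have bij: "bij_betw \<theta>' (carrier G'.pair.MN) (splines S G'.FG)"
    by (rule IH[OF \<theta>'])
  obtain u w where uw: "u \<in> V" "w \<in> V" "ends G e = {u, w}"
    using edge_cases[OF e] .
  define I where "I = label G e"
  interpret I: ideal I R
    unfolding I_def by (rule label_ideal[OF e])
  let ?Q = "quotient_module R I"
  interpret RQ: cring "R Quot I"
    by (rule I.quotient_is_cring[OF is_cring])
  have Q: "module R ?Q"
    by (rule quotient_module[OF is_cring I.ideal_axioms])
  note \<pi> = I.rcos_ring_hom
  define \<pi>uw where "\<pi>uw s = I +> (s u \<ominus> s w)" for s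
  have coset_zero: "I +> r = \<zero>\<^bsub>R Quot I\<^esub> \<longleftrightarrow> r \<in> I" if "r \<in> carrier R" for r
    using I.a_rcos_const[of r] I.a_rcos_self[OF that] by (auto simp: FactRing_def)
  have sub: "splines R G \<subseteq> splines R G'"
    by (auto simp: splines_def)
  have lin_id: "linear_map R R_G G'.R_G (\<lambda>s. s)"
    using sub by (auto simp: linear_map_def)
  \<comment> \<open>With this endomorphism in front, exactness at \<open>R_G\<close> expresses
    injectivity of the inclusion into \<open>G'.R_G\<close>.\<close>
  have lin_zero: "linear_map R R_G R_G (\<lambda>s. \<zero>\<^bsub>R_G\<^esub>)"
    using diag_spline by (auto simp: linear_map_def diag_def intro!: restrict_ext)
  have lin_\<pi>: "linear_map R G'.R_G ?Q \<pi>uw"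
    unfolding linear_map_def
  proof (intro conjI ballI)
    have closed: "s u \<in> carrier R \<and> s w \<in> carrier R" if "s \<in> splines R G'" for s
      using G'.spline_closed[OF that] uw by simp
    show "\<pi>uw \<in> carrier G'.R_G \<rightarrow> carrier ?Q"
      using closed ring_hom_closed[OF \<pi>] by (auto simp: \<pi>uw_def)
    fix s t assume st: "s \<in> carrier G'.R_G" "t \<in> carrier G'.R_G"
    have "s u \<oplus> t u \<ominus> (s w \<oplus> t w) = (s u \<ominus> s w) \<oplus> (t u \<ominus> t w)"
      using closed[of s] closed[of t] st by (simp add: a_minus_def minus_add a_ac)
    then show "\<pi>uw (s \<oplus>\<^bsub>G'.R_G\<^esub> t) = \<pi>uw s \<oplus>\<^bsub>?Q\<^esub> \<pi>uw t"
      using closed[of s] closed[of t] st uw by (simp add: \<pi>uw_def ring_hom_add[OF \<pi>])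
  next
    fix r s assume rs: "r \<in> carrier R" "s \<in> carrier G'.R_G"
    then have suw: "s u \<in> carrier R" "s w \<in> carrier R"
      using G'.spline_closed[of s] uw by auto
    have "r \<otimes> s u \<ominus> r \<otimes> s w = r \<otimes> (s u \<ominus> s w)"
      using rs suw by (simp add: a_minus_def r_distr r_minus)
    then show "\<pi>uw (r \<odot>\<^bsub>G'.R_G\<^esub> s) = r \<odot>\<^bsub>?Q\<^esub> \<pi>uw s"
      using rs suw uw by (simp add: \<pi>uw_def ring_hom_mult[OF \<pi>])
  qed
  have exact: "(\<lambda>s. s) ` carrier R_G = a_kernel G'.R_G ?Q \<pi>uw"
  proof (intro equalityI subsetI)
    fix s assume "s \<in> (\<lambda>s. s) ` carrier R_G"
    then have s: "s \<in> splines R G"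
      by simp
    then show "s \<in> a_kernel G'.R_G ?Q \<pi>uw"
      using sub uw spline_edge[OF s e uw(3)] by (auto simp: mem_a_kernel \<pi>uw_def coset_zero simp flip: I_def)
  next
    fix s assume "s \<in> a_kernel G'.R_G ?Q \<pi>uw"
    then have s: "s \<in> splines R G'" "\<pi>uw s = \<zero>\<^bsub>R Quot I\<^esub>"
      by (simp_all add: mem_a_kernel)
    then have "s u \<ominus> s w \<in> label G e"
      using coset_zero[of "s u \<ominus> s w"] G'.spline_closed[OF s(1)] uw by (simp add: \<pi>uw_def I_def)
    then have "\<exists>u v. ends G e' = {u, v} \<and> s u \<ominus> s v \<in> label G e'" if e': "e' \<in> E" for e'
    proof (cases "e' = e")
      case True
      then show ?thesis
        using \<open>s u \<ominus> s w \<in> label G e\<close> uw(3) by blast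
    next
      case False
      obtain u' v' where "ends G e' = {u', v'}"
        using edge_cases[OF e'] by metis
      then show ?thesis
        using G'.spline_edge[OF s(1), of e' u' v'] e' False by auto
    qed
    moreover have "s \<in> V \<rightarrow>\<^sub>E carrier R"
      using s(1) by (simp add: splines_def)
    ultimately have "s \<in> splines R G"
      by (intro splineI_orientation)
    then show "s \<in> (\<lambda>s. s) ` carrier R_G"
      by simp
  qed
  have exact_zero: "(\<lambda>s. \<zero>\<^bsub>R_G\<^esub>) ` carrier R_G = a_kernel R_G G'.R_G (\<lambda>s. s)"
    using diag_spline[OF zero_closed] by (auto simp: mem_a_kernel)
  \<comment> \<open>An enumeration \<open>n\<close> of the finite vertex set with left inverse
    \<open>k\<close>: the sequence \<open>s \<circ> k\<close> determines \<open>s\<close> on the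
    vertices, and its singleton has the carrier type of \<open>flat\<close>.\<close>
  obtain k n where kn: "\<And>v. v \<in> V \<Longrightarrow> k (n v :: nat) = v"
    using finite_imp_inj_to_nat_seg[OF finite_V] inv_into_f_f by metis
  let ?\<iota> = "\<lambda>s. {s \<circ> k}"
  have \<iota>: "inj_on ?\<iota> (splines R G')"
  proof (rule inj_onI)
    fix s t assume "s \<in> splines R G'" "t \<in> splines R G'" "{s \<circ> k} = {t \<circ> k}"
    then show "s = t"
      using kn by (intro G'.spline_eqI) (auto simp: fun_eq_iff, metis)
  qed
  have \<iota>G: "inj_on ?\<iota> (splines R G)"
    using \<iota> sub by (rule inj_on_subset)
  \<comment> \<open>A coset is a set of ring elements; replacing each element by a constant sequence
    gives it the required type.\<close>
  have \<iota>Q: "inj_on (\<lambda>X. (\<lambda>x _ :: nat. x) ` X) (carrier ?Q)"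
  proof (rule inj_onI)
    fix X Y assume "X \<in> carrier ?Q" "Y \<in> carrier ?Q" "(\<lambda>x _ :: nat. x) ` X = (\<lambda>x _ :: nat. x) ` Y"
    then show "X = Y"
      by (simp add: inj_image_eq_iff inj_def fun_eq_iff)
  qed
  note mods = spline_ring_module G'.spline_ring_module Q S.module
  have flat1: "tensor_map R R_G G'.R_G S (\<lambda>s. s) ` carrier pair.MN =
      a_kernel G'.pair.MN (tensor R ?Q S) (tensor_map R G'.R_G ?Q S \<pi>uw)"
    by (rule flat_exact[OF flat _ _ _ _ _ _ lin_id lin_\<pi> exact])
      (use mods \<iota> \<iota>G \<iota>Q in simp_all)
  have flat0: "tensor_map R R_G R_G S (\<lambda>s. \<zero>\<^bsub>R_G\<^esub>) ` carrier pair.MN =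
      a_kernel pair.MN G'.pair.MN (tensor_map R R_G G'.R_G S (\<lambda>s. s))"
    by (rule flat_exact[OF flat _ _ _ _ _ _ lin_zero lin_id exact_zero])
      (use mods \<iota> \<iota>G in simp_all)
  interpret incl: linear_tensor R R_G S G'.R_G "\<lambda>s. s"
    by (intro linear_tensorI mods lin_id)
  interpret zer: linear_tensor R R_G S R_G "\<lambda>s. \<zero>\<^bsub>R_G\<^esub>"
    by (intro linear_tensorI mods lin_zero)
  interpret pi: linear_tensor R G'.R_G S ?Q \<pi>uw
    by (intro linear_tensorI mods lin_\<pi>)
  have zer: "zer.fN X = \<zero>\<^bsub>pair.MN\<^esub>" if "X \<in> carrier pair.MN" for X
    using that
  proof (induction rule: pair.tensor_induct)
    case (pure s y)
    then show ?case
      using pair.pure_zero_left[of y] by (simp add: zer.tensor_map_pure del: spline_ring_simps(5))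
  qed (simp_all add: zer.tensor_map_zero zer.tensor_map_add del: spline_ring_simps(5))
  have incl_inj: "X = Y" if X: "X \<in> carrier pair.MN" and Y: "Y \<in> carrier pair.MN"
    and eq: "incl.fN X = incl.fN Y" for X Y
  proof -
    have "incl.fN (X \<ominus>\<^bsub>pair.MN\<^esub> Y) = \<zero>\<^bsub>G'.pair.MN\<^esub>"
      using X Y eq incl.tensor_map_closed[OF Y]
      by (simp add: a_minus_def incl.tensor_map_add incl.tensor_map_uminus G'.pair.tensor.r_neg)
    then have "X \<ominus>\<^bsub>pair.MN\<^esub> Y \<in> zer.fN ` carrier pair.MN"
      unfolding flat0 using X Y by (simp add: mem_a_kernel)
    then have "X \<ominus>\<^bsub>pair.MN\<^esub> Y = \<zero>\<^bsub>pair.MN\<^esub>"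
      using zer by auto
    moreover have "X = (X \<ominus>\<^bsub>pair.MN\<^esub> Y) \<oplus>\<^bsub>pair.MN\<^esub> Y"
      using X Y by (simp add: a_minus_def pair.tensor.a_assoc pair.tensor.l_neg)
    ultimately show ?thesis
      using Y by simp
  qed
  \<comment> \<open>The map \<open>\<theta>\<close> factors through the tensored inclusion: both
    sides are additive in \<open>X\<close> and agree on pure tensors.\<close>
  have \<theta>\<theta>': "\<theta> X v = \<theta>' (incl.fN X) v" if "X \<in> carrier pair.MN" and v: "v \<in> V" for X v
    using that(1)
  proof (induction rule: pair.tensor_induct)
    case zero
    then show ?case
      using comparison_zero[OF \<theta> v] G'.comparison_zero[OF \<theta>', of v] v by (simp add: incl.tensor_map_zero)
  next
    case (pure s y)
    then show ?case
      using comparisonD(3)[OF \<theta>, of s y v] G'.comparisonD(3)[OF \<theta>', of s y v] v sub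
      by (simp add: incl.tensor_map_pure subset_iff)
  next
    case (add X Y)
    then show ?case
      using comparisonD(2)[OF \<theta>, of X Y v] G'.comparisonD(2)[OF \<theta>', of "incl.fN X" "incl.fN Y" v] v
      by (simp add: incl.tensor_map_add)
  qed
  \<comment> \<open>This is the map \<open>y \<mapsto> 1 \<otimes> y\<close> from \<open>S\<close>
    to \<open>R/I \<otimes> S\<close>.\<close>
  let ?p = "pure_tensor R ?Q S (I +> \<one>)"
  have p1: "I +> \<one> \<in> carrier ?Q"
    using ring_hom_closed[OF \<pi> one_closed] by simp
  have p_smult: "pure_tensor R ?Q S (I +> r) y = ?p (r \<odot>\<^bsub>S\<^esub> y)" if "r \<in> carrier R" "y \<in> carrier S" for r y
    using pi.P'.pure_balanced[OF that(1) p1 that(2)] that ring_hom_mult[OF \<pi> that(1) one_closed] by simp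
  have p_uminus: "?p (\<ominus>\<^bsub>S\<^esub> y) = \<ominus>\<^bsub>tensor R ?Q S\<^esub> ?p y" if "y \<in> carrier S" for y
    using pi.P'.pure_add_right[OF p1, of "\<ominus>\<^bsub>S\<^esub> y" y] that p1
    by (intro pi.P'.tensor.minus_equality[symmetric]) (simp_all add: S.M.l_neg pi.P'.pure_zero_right[OF p1])
  \<comment> \<open>Seen through \<open>\<theta>'\<close>, the tensored difference map is
    \<open>t \<mapsto> 1 \<otimes> (t u - t w)\<close>: on a pure tensor the scalar
    \<open>s u - s w\<close> moves from the coset to the right factor.\<close>
  have pi_eq: "pi.fN X = ?p (\<theta>' X u \<ominus>\<^bsub>S\<^esub> \<theta>' X w)" if "X \<in> carrier G'.pair.MN" for X
    using that
  proof (induction rule: G'.pair.tensor_induct)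
    case zero
    then show ?case
      using uw p1 by (simp add: pi.tensor_map_zero G'.comparison_zero[OF \<theta>'] pi.P'.pure_zero_right a_minus_def S.M.r_neg)
  next
    case (pure s y)
    then have s: "s u \<in> carrier R" "s w \<in> carrier R"
      using G'.spline_closed[of s] uw by auto
    have "pi.fN (G'.pair.pure s y) = ?p ((s u \<ominus> s w) \<odot>\<^bsub>S\<^esub> y)"
      using pure s p_smult[of "s u \<ominus> s w" y] by (simp add: pi.tensor_map_pure \<pi>uw_def)
    then show ?case
      using pure s uw by (simp add: G'.comparisonD(3)[OF \<theta>'] smult_minus_left)
  next
    case (add X Y)
    have c: "\<theta>' Z v \<in> carrier S" if "Z \<in> carrier G'.pair.MN" "v \<in> {u, w}" for Z v
      using G'.comparison_apply_closed[OF \<theta>' that(1), of v] that(2) uw by auto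
    note cs = c[OF add.hyps(1), of u] c[OF add.hyps(1), of w] c[OF add.hyps(2), of u] c[OF add.hyps(2), of w]
    have "(\<theta>' X u \<oplus>\<^bsub>S\<^esub> \<theta>' Y u) \<ominus>\<^bsub>S\<^esub> (\<theta>' X w \<oplus>\<^bsub>S\<^esub> \<theta>' Y w) =
        (\<theta>' X u \<ominus>\<^bsub>S\<^esub> \<theta>' X w) \<oplus>\<^bsub>S\<^esub> (\<theta>' Y u \<ominus>\<^bsub>S\<^esub> \<theta>' Y w)"
      using cs by (simp add: a_minus_def S.M.minus_add S.M.a_ac)
    then show ?case
      using add uw cs p1
      by (simp add: pi.tensor_map_add G'.comparisonD(2)[OF \<theta>'] pi.P'.pure_add_right)
  qed
  \<comment> \<open>The largest ideal of \<open>S\<close> inside the kernel of \<open>?p\<close>.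
    Quantifying over \<open>a\<close> makes it an ideal without an \<open>S\<close>-action on
    \<open>R/I \<otimes> S\<close>. It contains \<open>r \<odot> 1\<close> for \<open>r\<close> in
    \<open>I\<close>, since the coset of \<open>r\<close> is zero, hence it contains
    \<open>I S\<close>.\<close>
  define J where "J = {z \<in> carrier S. \<forall>a\<in>carrier S. ?p (z \<otimes>\<^bsub>S\<^esub> a) = \<zero>\<^bsub>tensor R ?Q S\<^esub>}"
  have J: "ideal J S"
  proof (rule idealI[OF S.ring_axioms])
    show "subgroup J (add_monoid S)"
    proof (rule S.M.add.subgroupI)
      show "J \<subseteq> carrier S"
        by (auto simp: J_def)
      have "\<zero>\<^bsub>S\<^esub> \<in> J"
        using pi.P'.pure_zero_right[OF p1] by (simp add: J_def)
      then show "J \<noteq> {}"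
        by blast
      show "\<ominus>\<^bsub>S\<^esub> x \<in> J" if "x \<in> J" for x
        using that by (simp add: J_def S.l_minus p_uminus)
      show "x \<oplus>\<^bsub>S\<^esub> y \<in> J" if "x \<in> J" "y \<in> J" for x y
        using that by (simp add: J_def S.l_distr pi.P'.pure_add_right[OF p1])
    qed
    fix x y assume xy: "x \<in> J" "y \<in> carrier S"
    then show "x \<otimes>\<^bsub>S\<^esub> y \<in> J"
      by (simp add: J_def S.m_assoc)
    then show "y \<otimes>\<^bsub>S\<^esub> x \<in> J"
      using xy by (simp add: J_def S.m_comm)
  qed
  have "(\<lambda>r. r \<odot>\<^bsub>S\<^esub> \<one>\<^bsub>S\<^esub>) ` I \<subseteq> J"
  proof
    fix z assume "z \<in> (\<lambda>r. r \<odot>\<^bsub>S\<^esub> \<one>\<^bsub>S\<^esub>) ` I"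
    then obtain r where r: "r \<in> I" "r \<in> carrier R" "z = r \<odot>\<^bsub>S\<^esub> \<one>\<^bsub>S\<^esub>"
      using I.Icarr by auto
    have "?p (z \<otimes>\<^bsub>S\<^esub> a) = \<zero>\<^bsub>tensor R ?Q S\<^esub>" if a: "a \<in> carrier S" for a
    proof -
      have "?p (z \<otimes>\<^bsub>S\<^esub> a) = pure_tensor R ?Q S (I +> r) a"
        using r a S.smult_assoc2[OF r(2) S.one_closed a] p_smult[OF r(2) a] by simp
      also have "I +> r = \<zero>\<^bsub>?Q\<^esub>"
        using coset_zero[OF r(2)] r(1) by simp
      finally show ?thesis
        using pi.P'.pure_zero_left[OF a] by simp
    qed
    then show "z \<in> J"
      using r by (simp add: J_def)
  qed
  then have Idl: "Idl\<^bsub>S\<^esub> ((\<lambda>r. r \<odot>\<^bsub>S\<^esub> \<one>\<^bsub>S\<^esub>) ` I) \<subseteq> J"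
    by (rule S.genideal_minimal[OF J])
  show ?thesis
  proof (rule comparison_bijI[OF \<theta>])
    fix X Y assume X: "X \<in> carrier pair.MN" and Y: "Y \<in> carrier pair.MN"
      and eq: "\<And>v. v \<in> V \<Longrightarrow> \<theta> X v = \<theta> Y v"
    have "\<theta>' (incl.fN X) = \<theta>' (incl.fN Y)"
      using eq \<theta>\<theta>'[OF X] \<theta>\<theta>'[OF Y] X Y
      by (intro G'.FG.spline_eqI G'.comparisonD(1)[OF \<theta>'] incl.tensor_map_closed) auto
    then have "incl.fN X = incl.fN Y"
      using bij X Y by (auto simp: bij_betw_def inj_on_def)
    then show "X = Y"
      by (rule incl_inj[OF X Y])
  next
    fix t assume t: "t \<in> splines S FG"
    then have "t \<in> splines S G'.FG"
      by (auto simp: splines_def)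
    then have "t \<in> \<theta>' ` carrier G'.pair.MN"
      using bij by (simp add: bij_betw_def)
    then obtain X where X: "X \<in> carrier G'.pair.MN" "\<theta>' X = t"
      by blast
    \<comment> \<open>The edge condition of \<open>t\<close> at \<open>e\<close> puts this
      difference into \<open>I S\<close>, hence into \<open>J\<close>. So \<open>pi.fN X\<close>
      vanishes, and \<open>flat1\<close> provides a preimage of \<open>X\<close> in
      \<open>R_G \<otimes> S\<close>.\<close>
    have "t u \<ominus>\<^bsub>S\<^esub> t w \<in> label FG e"
      using FG.spline_edge[OF t, of e u w] e uw by simp
    then have J_mem: "t u \<ominus>\<^bsub>S\<^esub> t w \<in> J"
      using Idl by (auto simp: I_def)
    then have "t u \<ominus>\<^bsub>S\<^esub> t w \<in> carrier S"
      by (simp add: J_def)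
    moreover have "?p ((t u \<ominus>\<^bsub>S\<^esub> t w) \<otimes>\<^bsub>S\<^esub> \<one>\<^bsub>S\<^esub>) = \<zero>\<^bsub>tensor R ?Q S\<^esub>"
      using J_mem S.one_closed unfolding J_def by blast
    ultimately have "pi.fN X = \<zero>\<^bsub>tensor R ?Q S\<^esub>"
      using pi_eq[OF X(1)] X(2) by simp
    then have "X \<in> incl.fN ` carrier pair.MN"
      unfolding flat1 using X(1) by (simp add: mem_a_kernel)
    then obtain X' where "X' \<in> carrier pair.MN" "X = incl.fN X'"
      by blast
    then show "\<exists>X\<in>carrier pair.MN. \<forall>v\<in>V. \<theta> X v = t v"
      using \<theta>\<theta>' X(2) by (intro bexI[of _ X']) auto
  qed
qed

end

lemma comparison_bij:
  assumes "flat R S" "spline_algebra R G S" "spline_algebra.comparison R G S \<theta>"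
  shows "bij_betw \<theta> (carrier (tensor R (spline_ring R G) S)) (splines S (base_change_graph S G))"
  using assms(2,3)
proof (induction "card (edges G)" arbitrary: G \<theta>)
  case 0
  then interpret spline_algebra R G S by simp
  show ?case
    using 0 finite_E by (intro comparison_bij_no_edges) auto
next
  case (Suc n)
  interpret spline_algebra R G S by fact
  obtain e where e: "e \<in> E"
    using Suc.hyps(2) by (metis card.empty ex_in_conv nat.distinct(1))
  let ?G' = "G\<lparr>edges := E - {e}\<rparr>"
  have "edge_labeled_graph R ?G'"
    using graph by (auto simp: edge_labeled_graph_def)
  then have "spline_algebra R ?G' S"
    by unfold_locales
  moreover have "n = card (edges ?G')"
    using Suc.hyps(2) e finite_E by (simp add: card_Diff_singleton)
  ultimately show ?case
    using Suc.hyps(1) by (intro comparison_bij_add_edge[OF assms(1) Suc.prems(2) e refl])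
qed

section \<open>From the bijection to an isomorphism of schemes\<close>

text \<open>For the tensor product, this replaces a verification of the ring axioms on cosets: they
  are carried over from the splines over \<open>S\<close>.\<close>

lemma (in cring) cring_of_bij:
  assumes h: "bij_betw h (carrier B) (carrier R)"
    and mult: "\<And>x y. \<lbrakk>x \<in> carrier B; y \<in> carrier B\<rbrakk> \<Longrightarrow> x \<otimes>\<^bsub>B\<^esub> y \<in> carrier B \<and> h (x \<otimes>\<^bsub>B\<^esub> y) = h x \<otimes> h y"
    and add: "\<And>x y. \<lbrakk>x \<in> carrier B; y \<in> carrier B\<rbrakk> \<Longrightarrow> x \<oplus>\<^bsub>B\<^esub> y \<in> carrier B \<and> h (x \<oplus>\<^bsub>B\<^esub> y) = h x \<oplus> h y"
    and one: "\<one>\<^bsub>B\<^esub> \<in> carrier B" "h \<one>\<^bsub>B\<^esub> = \<one>" and zero: "\<zero>\<^bsub>B\<^esub> \<in> carrier B" "h \<zero>\<^bsub>B\<^esub> = \<zero>"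
  shows "cring B"
proof -
  let ?k = "inv_into (carrier B) h"
  have hk: "h (?k y) = y" "?k y \<in> carrier B" if "y \<in> carrier R" for y
    using bij_betw_inv_into_right[OF h that] bij_betwE[OF bij_betw_inv_into[OF h]] that by auto
  have kh: "?k (h x) = x" if "x \<in> carrier B" for x
    by (rule bij_betw_inv_into_left[OF h that])
  have "?k \<in> ring_iso R B"
  proof (rule ring_iso_memI)
    fix x y assume xy: "x \<in> carrier R" "y \<in> carrier R"
    show "?k (x \<otimes> y) = ?k x \<otimes>\<^bsub>B\<^esub> ?k y"
      using mult[of "?k x" "?k y"] kh[of "?k x \<otimes>\<^bsub>B\<^esub> ?k y"] hk xy by simp
    show "?k (x \<oplus> y) = ?k x \<oplus>\<^bsub>B\<^esub> ?k y"
      using add[of "?k x" "?k y"] kh[of "?k x \<oplus>\<^bsub>B\<^esub> ?k y"] hk xy by simp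
  next
    show "?k \<one> = \<one>\<^bsub>B\<^esub>"
      using kh[OF one(1)] one(2) by simp
  qed (use hk bij_betw_inv_into[OF h] in auto)
  \<comment> \<open>Preservation of zero is not part of \<open>ring_iso\<close>, so the transferred
    ring has the image of zero as its \<open>zero\<close> component; the assumption
    \<open>zero\<close> identifies it with that of \<open>B\<close>.\<close>
  then have "cring (B\<lparr>zero := ?k \<zero>\<rparr>)"
    by (rule ring_iso_imp_img_cring)
  moreover have "B\<lparr>zero := ?k \<zero>\<rparr> = B"
    using kh[OF zero(1)] zero(2) by simp
  ultimately show ?thesis
    by simp
qed

proposition (in spline_algebra) base_change_isomorphic_over:
  assumes "flat R S"
  shows "isomorphic_over (Spec S) (Spec pair.MN) (base_change_morphism R R_G S)
    (Spec (spline_ring S FG)) (spline_morphism S FG)"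
proof -
  obtain \<theta> where \<theta>: "comparison \<theta>"
    using ex_comparison by blast
  have bij: "bij_betw \<theta> (carrier pair.MN) (carrier (spline_ring S FG))"
    using comparison_bij[OF assms spline_algebra_axioms \<theta>] by simp
  interpret FGR: cring "spline_ring S FG"
    by (rule FG.spline_ring_cring)
  note closed = comparisonD(1)[OF \<theta>] and [simp] = pair.tensor_mult_closed
  have one: "\<one>\<^bsub>pair.MN\<^esub> \<in> carrier pair.MN"
    by (simp add: pair.tensor_one diag_spline)
  \<comment> \<open>Compatibility with the structure maps from \<open>S\<close>: the element
    \<open>1 \<otimes> y\<close> goes to the constant spline \<open>y\<close>.\<close>
  have pure_one: "\<theta> (pair.pure (diag G \<one>) y) = diag FG y" if "y \<in> carrier S" for y
    using that comparisonD(3)[OF \<theta>, of "diag G \<one>" y] diag_spline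
    by (intro FG.spline_eqI closed FG.diag_spline) auto
  have \<theta>_zero: "\<theta> \<zero>\<^bsub>pair.MN\<^esub> = \<zero>\<^bsub>spline_ring S FG\<^esub>"
    using FG.diag_spline by (intro FG.spline_eqI closed) (auto simp: comparison_zero[OF \<theta>])
  have \<theta>_add: "\<theta> (X \<oplus>\<^bsub>pair.MN\<^esub> Y) = \<theta> X \<oplus>\<^bsub>spline_ring S FG\<^esub> \<theta> Y"
    if "X \<in> carrier pair.MN" "Y \<in> carrier pair.MN" for X Y
    using that FG.add_spline[OF closed closed, of X Y]
    by (intro FG.spline_eqI closed) (auto simp: comparisonD(2)[OF \<theta>])
  \<comment> \<open>Multiplicativity takes two inductions on tensors: the first varies the left
    factor against a fixed pure tensor, the second varies the right factor.\<close>
  have \<theta>_pure_mult: "\<theta> (X \<otimes>\<^bsub>pair.MN\<^esub> pair.pure s y) = \<theta> X \<otimes>\<^bsub>spline_ring S FG\<^esub> \<theta> (pair.pure s y)"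
    if "X \<in> carrier pair.MN" and s: "s \<in> splines R G" "y \<in> carrier S" for X s y
    using that(1)
  proof (induction rule: pair.tensor_induct)
    case zero
    show ?case
      using s closed[of "pair.pure s y"] FGR.l_null[of "\<theta> (pair.pure s y)"]
      by (simp add: pair.tensor_mult_zero(1) \<theta>_zero del: spline_ring_simps(2))
  next
    case (pure t z)
    have t: "t \<in> splines R G"
      using pure by simp
    have prod: "pair.pure t z \<otimes>\<^bsub>pair.MN\<^esub> pair.pure s y = pair.pure (\<lambda>v\<in>V. t v \<otimes> s v) (z \<otimes>\<^bsub>S\<^esub> y)"
      using pair.pure_mult[of t s z y] pure s by simp
    have mem: "pair.pure t z \<in> carrier pair.MN" "pair.pure s y \<in> carrier pair.MN"
      using pure s by simp_all
    show ?case
    proof (rule FG.spline_eqI)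
      show "\<theta> (pair.pure t z \<otimes>\<^bsub>pair.MN\<^esub> pair.pure s y) \<in> splines S FG"
        using mem by (intro closed pair.tensor_mult_closed)
      show "\<theta> (pair.pure t z) \<otimes>\<^bsub>spline_ring S FG\<^esub> \<theta> (pair.pure s y) \<in> splines S FG"
        using FG.mult_spline[OF closed closed] mem by simp
      fix v assume "v \<in> FG.V"
      then have v: "v \<in> V"
        by simp
      have "\<theta> (pair.pure t z \<otimes>\<^bsub>pair.MN\<^esub> pair.pure s y) v = (t v \<otimes> s v) \<odot>\<^bsub>S\<^esub> (z \<otimes>\<^bsub>S\<^esub> y)"
        unfolding prod using comparisonD(3)[OF \<theta> mult_spline[OF t s(1)], of "z \<otimes>\<^bsub>S\<^esub> y" v] pure s v
        by simp
      also have "\<dots> = t v \<odot>\<^bsub>S\<^esub> (s v \<odot>\<^bsub>S\<^esub> (y \<otimes>\<^bsub>S\<^esub> z))"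
        using pure s t v by (simp add: S.smult_assoc1 S.m_comm)
      also have "\<dots> = t v \<odot>\<^bsub>S\<^esub> ((s v \<odot>\<^bsub>S\<^esub> y) \<otimes>\<^bsub>S\<^esub> z)"
        using pure s v by (simp add: S.smult_assoc2)
      also have "(s v \<odot>\<^bsub>S\<^esub> y) \<otimes>\<^bsub>S\<^esub> z = z \<otimes>\<^bsub>S\<^esub> (s v \<odot>\<^bsub>S\<^esub> y)"
        using pure s v by (intro S.m_comm) auto
      also have "t v \<odot>\<^bsub>S\<^esub> (z \<otimes>\<^bsub>S\<^esub> (s v \<odot>\<^bsub>S\<^esub> y)) = (t v \<odot>\<^bsub>S\<^esub> z) \<otimes>\<^bsub>S\<^esub> (s v \<odot>\<^bsub>S\<^esub> y)"
        using pure s t v by (simp add: S.smult_assoc2)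
      finally show "\<theta> (pair.pure t z \<otimes>\<^bsub>pair.MN\<^esub> pair.pure s y) v =
          (\<theta> (pair.pure t z) \<otimes>\<^bsub>spline_ring S FG\<^esub> \<theta> (pair.pure s y)) v"
        using pure s t v by (simp add: comparisonD(3)[OF \<theta>])
    qed
  next
    case (add X Y)
    then show ?case
      using s closed[of X] closed[of Y] closed[of "pair.pure s y"]
        FGR.l_distr[of "\<theta> X" "\<theta> Y" "\<theta> (pair.pure s y)"]
      by (simp add: pair.tensor_mult_add_left \<theta>_add del: spline_ring_simps(2,3))
  qed
  have \<theta>_mult: "\<theta> (X \<otimes>\<^bsub>pair.MN\<^esub> Y) = \<theta> X \<otimes>\<^bsub>spline_ring S FG\<^esub> \<theta> Y"
    if X: "X \<in> carrier pair.MN" and "Y \<in> carrier pair.MN" for X Y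
    using that(2)
  proof (induction rule: pair.tensor_induct)
    case zero
    show ?case
      using X closed[of X] FGR.r_null[of "\<theta> X"]
      by (simp add: pair.tensor_mult_zero(2) \<theta>_zero del: spline_ring_simps(2))
  next
    case (pure s y)
    then show ?case
      using \<theta>_pure_mult[OF X] by simp
  next
    case (add Y Z)
    then show ?case
      using X closed[of X] closed[of Y] closed[of Z] FGR.r_distr[of "\<theta> Y" "\<theta> Z" "\<theta> X"]
      by (simp add: pair.tensor_mult_add_right \<theta>_add del: spline_ring_simps(2,3))
  qed
  have \<theta>_one: "\<theta> \<one>\<^bsub>pair.MN\<^esub> = \<one>\<^bsub>spline_ring S FG\<^esub>"
    using pure_one[of "\<one>\<^bsub>S\<^esub>"] by (simp add: pair.tensor_one)
  have cring: "cring pair.MN"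
    by (rule FGR.cring_of_bij[OF bij]) (use \<theta>_mult \<theta>_add \<theta>_one \<theta>_zero one in auto)
  have iso: "\<theta> \<in> ring_iso pair.MN (spline_ring S FG)"
    by (rule ring_iso_memI) (use \<theta>_mult \<theta>_add \<theta>_one closed bij in auto)
  have "pair.pure \<one>\<^bsub>R_G\<^esub> \<in> ring_hom S pair.MN"
  proof (rule ring_hom_memI)
    fix x y assume "x \<in> carrier S" "y \<in> carrier S"
    then show "pair.pure \<one>\<^bsub>R_G\<^esub> (x \<otimes>\<^bsub>S\<^esub> y) = pair.pure \<one>\<^bsub>R_G\<^esub> x \<otimes>\<^bsub>pair.MN\<^esub> pair.pure \<one>\<^bsub>R_G\<^esub> y"
      "pair.pure \<one>\<^bsub>R_G\<^esub> (x \<oplus>\<^bsub>S\<^esub> y) = pair.pure \<one>\<^bsub>R_G\<^esub> x \<oplus>\<^bsub>pair.MN\<^esub> pair.pure \<one>\<^bsub>R_G\<^esub> y"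
      using pair.pure_mult[OF pair.A.one_closed pair.A.one_closed] pair.pure_add_right[OF pair.A.one_closed]
        pair.A.r_one[OF pair.A.one_closed] by simp_all
  qed (use pair.A.one_closed pair.pure_closed pair.tensor_one in auto)
  then have hom1: "spec_hom S pair.MN (pair.pure \<one>\<^bsub>R_G\<^esub>)"
    using cring S.M_cring by (simp add: spec_hom_def spec_hom_axioms_def)
  have hom2: "spec_hom S (spline_ring S FG) (diag FG)"
    using FGR.is_cring S.M_cring FG.diag_hom by (simp add: spec_hom_def spec_hom_axioms_def)
  show ?thesis
    unfolding base_change_morphism_def spline_morphism_def
    by (rule Spec_isomorphic_over[OF hom1 hom2 iso]) (simp add: pure_one)
qed

theorem theorem3:
  fixes R :: "('a, 'm) ring_scheme" and G :: "('v, 'e, 'a) lgraph"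
  assumes "cring R" and "edge_labeled_graph R G"
  shows "(\<forall>S :: ('a, 'b, 'n) module_scheme. algebra R S \<and> flat R S \<longrightarrow>
            isomorphic_over (Spec S)
              (Spec (tensor R (spline_ring R G) S))
              (base_change_morphism R (spline_ring R G) S)
              (Spec (spline_ring S (base_change_graph S G)))
              (spline_morphism S (base_change_graph S G)))
       \<and> (\<forall>P. primeideal P R \<longrightarrow>
            (let T = carrier R - P; RP = localization R T; GP = base_change_graph RP G;
                 T' = diag G ` T
             in algebras_isomorphic RP
                  (localization (spline_ring R G) T') (spline_ring RP GP)
                  (localization_map (spline_ring R G) T' (diag G)) (diag GP)))
       \<and> (\<forall>f\<in>carrier R.
            (let T = powers R f; Rf = localization R T; Gf = base_change_graph Rf G;
                 T' = diag G ` T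
             in algebras_isomorphic Rf
                  (localization (spline_ring R G) T') (spline_ring Rf Gf)
                  (localization_map (spline_ring R G) T' (diag G)) (diag Gf)))"
proof (intro conjI allI ballI impI)
  fix S :: "('a, 'b, 'n) module_scheme"
  assume S: "algebra R S \<and> flat R S"
  then interpret spline_algebra R G S
    using assms by (simp add: spline_algebra_def spline_graph_def spline_graph_axioms_def)
  show "isomorphic_over (Spec S) (Spec (tensor R (spline_ring R G) S))
      (base_change_morphism R (spline_ring R G) S)
      (Spec (spline_ring S (base_change_graph S G))) (spline_morphism S (base_change_graph S G))"
    using S base_change_isomorphic_over by blast
next
  fix P assume "primeideal P R"
  then show "let T = carrier R - P; RP = localization R T; GP = base_change_graph RP G;
      T' = diag G ` T
    in algebras_isomorphic RP (localization (spline_ring R G) T') (spline_ring RP GP)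
      (localization_map (spline_ring R G) T' (diag G)) (diag GP)"
    unfolding Let_def
    by (intro localization_spline_ring multiplicative_subset_prime assms)
next
  fix f assume "f \<in> carrier R"
  then show "let T = powers R f; Rf = localization R T; Gf = base_change_graph Rf G;
      T' = diag G ` T
    in algebras_isomorphic Rf (localization (spline_ring R G) T') (spline_ring Rf Gf)
      (localization_map (spline_ring R G) T' (diag G)) (diag Gf)"
    unfolding Let_def
    by (intro localization_spline_ring multiplicative_subset_powers assms)
qed

end
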